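(* Let $\dot x=F(x)=Ax+X(x)$ be a differential system on a neighborhood of $0$ in $\mathbb C^n$, with $F$ analytic, $A=\mathrm{diag}(\lambda_1,\dots,\lambda_n)$ and $X$ containing only terms of degree at least two. Assume that (i) the eigenvalues of $A$ satisfy Condition $\omega$; and (ii) some (formal) Poincaré-Dulac normal form of $F$ satisfies Condition AS. Then there exists a convergent normalizing transformation for $F$.
   Context: Notation: for $Q=(q_1,\dots,q_n)\in\mathbb Z^n$ put $\|Q\|=|q_1+\dots+q_n|$, $x^Q=x_1^{q_1}\cdots x_n^{q_n}$, and $\langle Q,v\rangle=\sum_i q_iv_i$ for $v\in\mathbb C^n$. $\mathbf N_i=\{Q\in\mathbb Z^n: q_i\ge -1,\ q_j\ge 0 \text{ for } j\ne i\}$, $\mathbf N=\mathbf N_1\cup\dots\cup\mathbf N_n$. $\odot$ is the componentwise (Hadamard) product. $\lambda=(\lambda_1,\dots,\lambda_n)^\top$, so $Ax=\lambda\odot x$. Every formal power series vector field is written uniquely as $F(x)=\sum_{Q\in\mathbf N}(x\odot F_Q)x^Q$ with $F_Q\in\mathbb C^n$ (the $i$-th entry of $F_Q$ being $0$ unless $Q\in\mathbf N_i$). It is in (Poincaré-Dulac) normal form if $F_Q=0$ whenever $\langle Q,\lambda\rangle\ne 0$. A transformation is a formal substitution $x=H(y)=y+h(y)$ with $h$ having only terms of degree at least two; the transformed field $\widetilde F$ is defined by $DH(y)\widetilde F(y)=F(H(y))$. The transformation is normalizing if $\widetilde F$ is in normal form (then $\widetilde F$ is called a normal form of $F$), and convergent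 if $H$ converges in a neighborhood of $0$. Condition $\omega$: with $\omega_k=\min\{|\langle Q,\lambda\rangle|:\ Q\in\mathbf N,\ \langle Q,\lambda\rangle\ne0,\ \|Q\|<2^k\}$, one has $\sum_{k\ge1}2^{-k}\log(\omega_k^{-1})<\infty$. An additive decomposition of $\lambda$ consists of linearly independent $\lambda^{(1)},\dots,\lambda^{(r)}\in\mathbb C^n$ ($r\ge1$) for which there are $\gamma_1,\dots,\gamma_r\in\mathbb C$ with $\lambda=\sum_j\gamma_j\lambda^{(j)}$. It satisfies the diophantine hull condition if there is a constant $c>0$ with $|\langle Q,\lambda^{(j)}\rangle|\le c\,|\langle Q,\lambda\rangle|$ for all $1\le j\le r$ and all $Q\in\mathbf N$. Let $M_\lambda^+=\{P\in\mathbb Z_{\ge0}^n:\langle P,\lambda\rangle=0\}$. A vector field $G(x)=Ax+\cdots$ in normal form satisfies Condition AS if there is an additive decomposition of $\lambda$ satisfying the diophantine hull condition such that $G(x)=\sum_{P\in M_\lambda^+}(x\odot G_P)x^P$ with every $G_P=\sum_j\beta_{j,P}\lambda^{(j)}$, $\beta_{j,P}\in\mathbb C$. *)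

theory Defs
  imports "HOL-Analysis.Analysis"
begin

text \<open>Exponents are vectors of naturals, ordered and added componentwise.\<close>

typedef ('a, 'n::finite) mfps = "UNIV :: (nat ^ 'n \<Rightarrow> 'a) set"
  morphisms mfps_nth Abs_mfps by simp

setup_lifting type_definition_mfps

lemma mfps_eqI: "(\<And>P. mfps_nth f P = mfps_nth g P) \<Longrightarrow> f = g"
  by (metis ext mfps_nth_inject)

lemma mfps_nth_Abs [simp]: "mfps_nth (Abs_mfps f) = f"
  by (simp add: Abs_mfps_inverse)

lemma finite_mindex_le: "finite {Q :: nat ^ 'n::finite. Q \<le> P}"
proof -
  have "{Q. Q \<le> P} \<subseteq> vec_lambda ` (\<Pi>\<^sub>E i\<in>UNIV. {..P $ i})"
  proof
    fix Q assume "Q \<in> {Q. Q \<le> P}"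
    then have "($) Q \<in> (\<Pi>\<^sub>E i\<in>UNIV. {..P $ i})" by (auto simp: less_eq_vec_def)
    then show "Q \<in> vec_lambda ` (\<Pi>\<^sub>E i\<in>UNIV. {..P $ i})"
      by (metis image_eqI vec_nth_inverse)
  qed
  then show ?thesis
    by (rule finite_subset) (intro finite_imageI finite_PiE; simp)
qed

lemma finite_mindex_splits: "finite {(Q, R). Q + R = (P :: nat ^ 'n::finite)}"
proof (rule finite_subset)
  show "{(Q, R). Q + R = P} \<subseteq> {Q. Q \<le> P} \<times> {R. R \<le> P}"
    by (auto simp: less_eq_vec_def)
qed (intro finite_cartesian_product finite_mindex_le)

instantiation mfps :: (comm_ring_1, finite) comm_ring_1
begin

lift_definition zero_mfps :: "('a, 'b) mfps" is "\<lambda>_. 0" .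
lift_definition one_mfps :: "('a, 'b) mfps" is "\<lambda>P. if P = 0 then 1 else 0" .
lift_definition plus_mfps :: "('a, 'b) mfps \<Rightarrow> ('a, 'b) mfps \<Rightarrow> ('a, 'b) mfps"
  is "\<lambda>f g P. f P + g P" .
lift_definition minus_mfps :: "('a, 'b) mfps \<Rightarrow> ('a, 'b) mfps \<Rightarrow> ('a, 'b) mfps"
  is "\<lambda>f g P. f P - g P" .
lift_definition uminus_mfps :: "('a, 'b) mfps \<Rightarrow> ('a, 'b) mfps"
  is "\<lambda>f P. - f P" .
lift_definition times_mfps :: "('a, 'b) mfps \<Rightarrow> ('a, 'b) mfps \<Rightarrow> ('a, 'b) mfps"
  is "\<lambda>f g P. \<Sum>(Q, R) | Q + R = P. f Q * g R" .

instance
proof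
  fix a b c :: "('a, 'b) mfps"
  show "a * b * c = a * (b * c)"
  proof (rule mfps_eqI)
    fix P :: "nat ^ 'b"
    have "mfps_nth (a * b * c) P =
      (\<Sum>p | fst p + snd p = P. \<Sum>q | fst q + snd q = fst p.
         mfps_nth a (fst q) * mfps_nth b (snd q) * mfps_nth c (snd p))"
      by (simp add: times_mfps.rep_eq case_prod_unfold sum_distrib_right)
    also have "\<dots> = (\<Sum>(p, q) \<in> (SIGMA p:{p. fst p + snd p = P}. {q. fst q + snd q = fst p}).
         mfps_nth a (fst q) * mfps_nth b (snd q) * mfps_nth c (snd p))"
      using finite_mindex_splits by (subst sum.Sigma) (auto simp: case_prod_unfold)
    also have "\<dots> = (\<Sum>(p, q) \<in> (SIGMA p:{p. fst p + snd p = P}. {q. fst q + snd q = snd p}).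
         mfps_nth a (fst p) * (mfps_nth b (fst q) * mfps_nth c (snd q)))"
      by (rule sum.reindex_bij_witness
          [where i = "\<lambda>((x, y), (z, w)). ((x + z, w), (x, z))"
             and j = "\<lambda>((x, y), (z, w)). ((z, w + y), (w, y))"])
        (auto simp: algebra_simps)
    also have "\<dots> = (\<Sum>p | fst p + snd p = P. \<Sum>q | fst q + snd q = snd p.
         mfps_nth a (fst p) * (mfps_nth b (fst q) * mfps_nth c (snd q)))"
      using finite_mindex_splits by (subst sum.Sigma) (auto simp: case_prod_unfold)
    also have "\<dots> = mfps_nth (a * (b * c)) P"
      by (simp add: times_mfps.rep_eq case_prod_unfold sum_distrib_left)
    finally show "mfps_nth (a * b * c) P = mfps_nth (a * (b * c)) P" .
  qed
  show "a * b = b * a"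
  proof (rule mfps_eqI)
    fix P :: "nat ^ 'b"
    show "mfps_nth (a * b) P = mfps_nth (b * a) P"
      unfolding times_mfps.rep_eq
      by (rule sum.reindex_bij_witness[where i = prod.swap and j = prod.swap])
        (auto simp: algebra_simps)
  qed
  show "1 * a = a"
  proof (rule mfps_eqI)
    fix P :: "nat ^ 'b"
    have "mfps_nth (1 * a) P =
        (\<Sum>p\<in>{(Q, R). Q + R = P}. if p = (0, P) then mfps_nth a P else 0)"
      unfolding times_mfps.rep_eq one_mfps.rep_eq by (rule sum.cong) (auto split: if_splits)
    also have "\<dots> = mfps_nth a P"
      by (subst sum.delta) (auto simp: finite_mindex_splits)
    finally show "mfps_nth (1 * a) P = mfps_nth a P" .
  qed
  show "(a + b) * c = a * c + b * c"
    by (rule mfps_eqI)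
      (simp add: times_mfps.rep_eq plus_mfps.rep_eq case_prod_unfold distrib_right sum.distrib)
  show "(0 :: ('a, 'b) mfps) \<noteq> 1"
    by (metis one_mfps.rep_eq zero_mfps.rep_eq zero_neq_one)
  show "a + b + c = a + (b + c)"
    by (rule mfps_eqI) (simp add: plus_mfps.rep_eq add.assoc)
  show "a + b = b + a"
    by (rule mfps_eqI) (simp add: plus_mfps.rep_eq add.commute)
  show "0 + a = a"
    by (rule mfps_eqI) (simp add: plus_mfps.rep_eq zero_mfps.rep_eq)
  show "- a + a = 0"
    by (rule mfps_eqI) (simp add: plus_mfps.rep_eq uminus_mfps.rep_eq zero_mfps.rep_eq)
  show "a - b = a + - b"
    by (rule mfps_eqI) (simp add: plus_mfps.rep_eq uminus_mfps.rep_eq minus_mfps.rep_eq)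
qed

end

definition mdegree :: "nat ^ 'n::finite \<Rightarrow> nat"
  where "mdegree P = (\<Sum>i\<in>UNIV. P $ i)"

definition mfps_const :: "'a::comm_ring_1 \<Rightarrow> ('a, 'n::finite) mfps"
  where "mfps_const c = Abs_mfps (\<lambda>P. if P = 0 then c else 0)"

definition mfps_var :: "'n::finite \<Rightarrow> ('a::comm_ring_1, 'n) mfps"
  where "mfps_var i = Abs_mfps (\<lambda>P. if P = axis i 1 then 1 else 0)"

definition mfps_deriv :: "'n::finite \<Rightarrow> ('a::comm_ring_1, 'n) mfps \<Rightarrow> ('a, 'n) mfps"
  where "mfps_deriv j f = Abs_mfps (\<lambda>P. of_nat (P $ j + 1) * mfps_nth f (P + axis j 1))"

text \<open>
  Substitution of \<open>H\<close> into \<open>f\<close>, meaningful when \<open>H\<close> has no constant terms: then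
  \<open>H\<^sup>Q\<close> only has terms of degree at least \<open>|Q|\<close>, so that the infinite sum of the
  \<open>f\<^sub>Q H\<^sup>Q\<close> has the following coefficients.
\<close>

definition mfps_compose ::
  "('a::comm_ring_1, 'n::finite) mfps \<Rightarrow> ('a, 'n) mfps ^ 'n \<Rightarrow> ('a, 'n) mfps"
  where "mfps_compose f H =
    Abs_mfps (\<lambda>P. \<Sum>Q | mdegree Q \<le> mdegree P.
      mfps_nth f Q * mfps_nth (\<Prod>k\<in>UNIV. (H $ k) ^ (Q $ k)) P)"

lemma finite_mdegree_le: "finite {Q :: nat ^ 'n::finite. mdegree Q \<le> d}"
proof (rule finite_subset)
  have "Q $ i \<le> mdegree Q" for Q :: "nat ^ 'n" and i
    unfolding mdegree_def by (rule member_le_sum) simp_all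
  then show "{Q :: nat ^ 'n. mdegree Q \<le> d} \<subseteq> {Q. Q \<le> (\<chi> i. d)}"
    using order_trans by (fastforce simp: less_eq_vec_def)
qed (rule finite_mindex_le)

type_synonym 'n fvf = "(complex, 'n) mfps ^ 'n"

definition order_ge2 :: "'n::finite fvf \<Rightarrow> bool"
  where "order_ge2 h \<longleftrightarrow> (\<forall>i P. mdegree P < 2 \<longrightarrow> mfps_nth (h $ i) P = 0)"

definition fvf_diag :: "complex ^ 'n \<Rightarrow> 'n::finite fvf"
  where "fvf_diag lam = (\<chi> i. mfps_const (lam $ i) * mfps_var i)"

definition fvf_jacobian :: "'n::finite fvf \<Rightarrow> (complex, 'n) mfps ^ 'n ^ 'n"
  where "fvf_jacobian H = (\<chi> i j. mfps_deriv j (H $ i))"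

definition fvf_compose :: "'n::finite fvf \<Rightarrow> 'n fvf \<Rightarrow> 'n fvf"
  where "fvf_compose F H = (\<chi> i. mfps_compose (F $ i) H)"

definition mpower :: "complex ^ 'n::finite \<Rightarrow> nat ^ 'n \<Rightarrow> complex"
  where "mpower x P = (\<Prod>k\<in>UNIV. (x $ k) ^ (P $ k))"

definition fvf_convergent :: "'n::finite fvf \<Rightarrow> bool"
  where "fvf_convergent H \<longleftrightarrow> (\<exists>U. open U \<and> 0 \<in> U \<and>
    (\<forall>x\<in>U. \<forall>i. (\<lambda>P. mfps_nth (H $ i) P * mpower x P) summable_on UNIV))"

text \<open>\<open>f\<close> is the Taylor series of \<open>F\<close> at \<open>a\<close>, and it represents \<open>F\<close> near \<open>a\<close>.\<close>

definition has_taylor_series ::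
  "(complex ^ 'n \<Rightarrow> complex ^ 'n) \<Rightarrow> complex ^ 'n \<Rightarrow> 'n::finite fvf \<Rightarrow> bool"
  where "has_taylor_series F a f \<longleftrightarrow> (\<exists>U. open U \<and> 0 \<in> U \<and>
    (\<forall>x\<in>U. \<forall>i. ((\<lambda>P. mfps_nth (f $ i) P * mpower x P) has_sum (F (a + x) $ i)) UNIV))"

definition vf_analytic_on ::
  "(complex ^ 'n \<Rightarrow> complex ^ 'n::finite) \<Rightarrow> (complex ^ 'n) set \<Rightarrow> bool"
  where "vf_analytic_on F U \<longleftrightarrow> (\<forall>a\<in>U. \<exists>f. has_taylor_series F a f)"

definition N_comp :: "'n::finite \<Rightarrow> (int ^ 'n) set"
  where "N_comp i = {Q. Q $ i \<ge> -1 \<and> (\<forall>j. j \<noteq> i \<longrightarrow> Q $ j \<ge> 0)}"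

definition N_all :: "(int ^ 'n::finite) set"
  where "N_all = (\<Union>i. N_comp i)"

definition Q_norm :: "int ^ 'n::finite \<Rightarrow> int"
  where "Q_norm Q = \<bar>\<Sum>i\<in>UNIV. Q $ i\<bar>"

definition pairing :: "int ^ 'n::finite \<Rightarrow> complex ^ 'n \<Rightarrow> complex"
  where "pairing Q v = (\<Sum>i\<in>UNIV. of_int (Q $ i) * v $ i)"

text \<open>
  \<open>fvf_coeff F Q\<close> is the vector \<open>F\<^sub>Q\<close> in \<open>F(x) = \<Sum>\<^sub>Q (x \<odot> F\<^sub>Q) x\<^sup>Q\<close>: its \<open>i\<close>-th entry is the
  coefficient of the monomial \<open>x\<^sub>i x\<^sup>Q\<close> in the \<open>i\<close>-th component of \<open>F\<close> when \<open>Q \<in> N_comp i\<close>,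
  and \<open>0\<close> otherwise.
\<close>

definition fvf_coeff :: "'n::finite fvf \<Rightarrow> int ^ 'n \<Rightarrow> complex ^ 'n"
  where "fvf_coeff F Q = (\<chi> i. if Q \<in> N_comp i
    then mfps_nth (F $ i) (\<chi> k. nat ((Q + axis i 1) $ k)) else 0)"

lemma mfps_nth_eq_fvf_coeff:
  "mfps_nth (F $ i) P = fvf_coeff F ((\<chi> k. int (P $ k)) - axis i 1) $ i"
  by (simp add: fvf_coeff_def N_comp_def axis_def)

lemma fvf_coeff_outside: "Q \<notin> N_all \<Longrightarrow> fvf_coeff F Q = 0"
  by (auto simp: fvf_coeff_def N_all_def vec_eq_iff)

definition normal_form :: "complex ^ 'n \<Rightarrow> 'n::finite fvf \<Rightarrow> bool"
  where "normal_form lam G \<longleftrightarrow> (\<forall>Q\<in>N_all. pairing Q lam \<noteq> 0 \<longrightarrow> fvf_coeff G Q = 0)"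

definition is_transformation :: "'n::finite fvf \<Rightarrow> bool"
  where "is_transformation H \<longleftrightarrow> (\<exists>h. order_ge2 h \<and> H = (\<chi> i. mfps_var i) + h)"

text \<open>\<open>G\<close> is the field \<open>F\<close> transformed by \<open>x = H(y)\<close>: \<open>DH(y) G(y) = F(H(y))\<close>.\<close>

definition transforms_to :: "'n::finite fvf \<Rightarrow> 'n fvf \<Rightarrow> 'n fvf \<Rightarrow> bool"
  where "transforms_to H F G \<longleftrightarrow> fvf_jacobian H *v G = fvf_compose F H"

definition normalizing :: "complex ^ 'n \<Rightarrow> 'n fvf \<Rightarrow> 'n::finite fvf \<Rightarrow> bool"
  where "normalizing lam F H \<longleftrightarrow>
    is_transformation H \<and> (\<exists>G. transforms_to H F G \<and> normal_form lam G)"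

definition normal_form_of :: "complex ^ 'n \<Rightarrow> 'n fvf \<Rightarrow> 'n::finite fvf \<Rightarrow> bool"
  where "normal_form_of lam F G \<longleftrightarrow>
    (\<exists>H. is_transformation H \<and> transforms_to H F G \<and> normal_form lam G)"

definition small_divisors :: "complex ^ 'n::finite \<Rightarrow> nat \<Rightarrow> real set"
  where "small_divisors lam k =
    {cmod (pairing Q lam) | Q. Q \<in> N_all \<and> pairing Q lam \<noteq> 0 \<and> Q_norm Q < 2 ^ k}"

lemma finite_small_divisors: "finite (small_divisors (lam :: complex ^ 'n::finite) k)"
proof -
  let ?B = "2 ^ k + int CARD('n)"
  have lower: "-1 \<le> Q $ j" if "Q \<in> N_all" for Q :: "int ^ 'n" and j
  proof -
    obtain i where "Q $ i \<ge> -1" "\<And>j. j \<noteq> i \<Longrightarrow> Q $ j \<ge> 0"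
      using \<open>Q \<in> N_all\<close> by (auto simp: N_all_def N_comp_def)
    then show ?thesis by (cases "j = i") (simp_all add: order_trans[of "-1" 0])
  qed
  have upper: "Q $ j \<le> ?B" if "Q \<in> N_all" "Q_norm Q < 2 ^ k" for Q :: "int ^ 'n" and j
  proof -
    have "Q $ j + 1 \<le> (\<Sum>i\<in>UNIV. Q $ i + 1)"
    proof (rule member_le_sum)
      show "0 \<le> Q $ i + 1" for i using lower[OF that(1), of i] by linarith
    qed simp_all
    also have "\<dots> = (\<Sum>i\<in>UNIV. Q $ i) + int CARD('n)"
      by (simp add: sum.distrib)
    finally show ?thesis using that(2) by (simp add: Q_norm_def)
  qed
  have "{Q :: int ^ 'n. Q \<in> N_all \<and> Q_norm Q < 2 ^ k}
      \<subseteq> vec_lambda ` (\<Pi>\<^sub>E i\<in>UNIV. {-1..?B})"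
  proof
    fix Q :: "int ^ 'n" assume "Q \<in> {Q. Q \<in> N_all \<and> Q_norm Q < 2 ^ k}"
    then have "($) Q \<in> (\<Pi>\<^sub>E i\<in>UNIV. {-1..?B})" using lower upper by auto
    then show "Q \<in> vec_lambda ` (\<Pi>\<^sub>E i\<in>UNIV. {-1..?B})"
      by (metis image_eqI vec_nth_inverse)
  qed
  then have "finite {Q :: int ^ 'n. Q \<in> N_all \<and> Q_norm Q < 2 ^ k}"
    by (rule finite_subset) (intro finite_imageI finite_PiE; simp)
  then show ?thesis
    by (rule finite_surj[where f = "\<lambda>Q. cmod (pairing Q lam)"]) (auto simp: small_divisors_def)
qed

definition omega :: "complex ^ 'n::finite \<Rightarrow> nat \<Rightarrow> real"
  where "omega lam k = Min (small_divisors lam k)"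

text \<open>
  The terms of the series are bounded below by a summable sequence, so finiteness of the sum is
  summability. For \<open>lam = 0\<close> there are no small divisors; then \<open>omega lam\<close> is
  a constant sequence and the condition holds.
\<close>

definition condition_omega :: "complex ^ 'n::finite \<Rightarrow> bool"
  where "condition_omega lam \<longleftrightarrow>
    summable (\<lambda>k. ln (inverse (omega lam (Suc k))) / 2 ^ Suc k)"

lemma condition_omega_0: "condition_omega (0 :: complex ^ 'n::finite)"
proof -
  have *: "small_divisors (0 :: complex ^ 'n) k = {}" for k
    by (simp add: small_divisors_def pairing_def)
  have "summable (\<lambda>k. (1 / 2) ^ Suc k :: real)"
    by (simp add: summable_geometric)
  then have "summable (\<lambda>k. ln (inverse (Min {})) * (1 / 2) ^ Suc k :: real)"
    by (rule summable_mult)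
  then show ?thesis by (simp add: condition_omega_def omega_def * field_simps)
qed

text \<open>Linear independence of the family \<open>L 1, \<dots>, L r\<close> includes that it has no repetitions.\<close>

definition additive_decomposition ::
  "complex ^ 'n::finite \<Rightarrow> nat \<Rightarrow> (nat \<Rightarrow> complex ^ 'n) \<Rightarrow> bool"
  where "additive_decomposition lam r L \<longleftrightarrow> r \<ge> 1 \<and>
    inj_on L {1..r} \<and> vec.independent (L ` {1..r}) \<and>
    (\<exists>\<gamma>. lam = (\<Sum>j = 1..r. \<gamma> j *s L j))"

definition diophantine_hull ::
  "complex ^ 'n::finite \<Rightarrow> nat \<Rightarrow> (nat \<Rightarrow> complex ^ 'n) \<Rightarrow> bool"
  where "diophantine_hull lam r L \<longleftrightarrow> (\<exists>c>0. \<forall>j\<in>{1..r}. \<forall>Q\<in>N_all.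
    cmod (pairing Q (L j)) \<le> c * cmod (pairing Q lam))"

definition M_plus :: "complex ^ 'n::finite \<Rightarrow> (int ^ 'n) set"
  where "M_plus lam = {P. (\<forall>i. P $ i \<ge> 0) \<and> pairing P lam = 0}"

text \<open>
  By uniqueness of the expansion, \<open>G(x) = \<Sum>\<^sub>P (x \<odot> G\<^sub>P) x\<^sup>P\<close> over \<open>P \<in> M_plus lam\<close> says that the
  coefficients at all other indices vanish.
\<close>

definition condition_AS :: "complex ^ 'n::finite \<Rightarrow> 'n fvf \<Rightarrow> bool"
  where "condition_AS lam G \<longleftrightarrow> (\<exists>r L.
    additive_decomposition lam r L \<and> diophantine_hull lam r L \<and>
    (\<forall>Q\<in>N_all - M_plus lam. fvf_coeff G Q = 0) \<and>
    (\<exists>\<beta>. \<forall>P\<in>M_plus lam. fvf_coeff G P = (\<Sum>j = 1..r. \<beta> j P *s L j)))"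

end

theory Submission
  imports Defs
begin

text \<open>
  Write \<open>A\<^sub>j\<close> for the diagonal field with eigenvalue vector \<open>L j\<close>. Among all normalizing
  transformations, take the one \<open>H = id + h\<close> for which \<open>h\<close> has no resonant term, that is, no term
  \<open>x\<^sub>i x\<^sup>Q\<close> with \<open>\<langle>Q, lam\<rangle> = 0\<close>, and let \<open>G = A x + r\<close> be the resulting normal form; the pair exists by
  a contraction argument (\<open>distinguished_normal_form\<close>). The claim is that this \<open>H\<close> converges.

  The hypothesis concerns some other normal form, but two normalizing transformations differ by a
  right factor that commutes with \<open>A\<close>, hence, by the diophantine hull condition, with every
  \<open>A\<^sub>j\<close>. Therefore \<open>G\<close> has the special form as well: \<open>G = \<Sum>\<^sub>j g\<^sub>j A\<^sub>j x\<close> with first integrals \<open>g\<^sub>j\<close> of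
  \<open>A x\<close> (\<open>special_field_invariance\<close>).

  The coefficients of \<open>h\<close> are bounded in blocks of degrees \<open>m < deg \<le> 2m\<close>, in the manner of
  Newton's method. Let \<open>H\<close> and \<open>G\<close> now be truncated at degree \<open>m\<close>, let \<open>E = F \<circ> H - DH G\<close>, which has
  order greater than \<open>m\<close>, let \<open>dh\<close> and \<open>dG\<close> be the next blocks of \<open>h\<close> and \<open>r\<close>, and write
  \<open>dh = DH w\<close>. Differentiating \<open>F \<circ> H = DH G + E\<close> eliminates \<open>DF\<close> from the linearized equation and
  leaves \<open>DH (Dw G - DG w + dG) = E\<close> up to degree \<open>2m\<close> (\<open>newton_block\<close>). A crude bound of \<open>E\<close>
  suffices: because of its order, its norm gains a factor \<open>\<theta>\<^sup>m\<close> when the radius shrinks by \<open>\<theta>\<close>.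

  The special form enters when this equation is solved for \<open>w\<close>. The bracket is
  \<open>\<Sum>\<^sub>j g\<^sub>j \<Lambda>\<^sub>j w - \<Sum>\<^sub>j (Dg\<^sub>j w) A\<^sub>j x\<close>, where \<open>\<Lambda>\<^sub>j\<close> multiplies the coefficient with index \<open>Q\<close> by
  \<open>\<langle>Q, L j\<rangle>\<close>. By the hull condition \<open>\<Lambda>\<^sub>j\<close> is bounded by the multiplier \<open>\<Lambda>\<close> with symbol \<open>\<langle>Q, lam\<rangle>\<close>, so
  the first sum is a small perturbation of \<open>\<Lambda> w\<close>. The second sum is harmless since
  \<open>Dg\<^sub>i (A\<^sub>j x) = 0\<close>: applying \<open>Dg\<^sub>i\<close> to the equation removes it and leaves a scalar equation of the
  same kind for \<open>Dg\<^sub>i w\<close>. Hence a block is divided by small divisors at most twice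
  (\<open>bracket_split\<close>, \<open>block_estimate\<close>). The resonant part of \<open>w\<close> is determined by the requirement
  that \<open>dh\<close> has no resonant terms.

  With \<open>\<Omega>\<close> a bound for the inverse small divisors of the block, this gives an increment of at most
  \<open>C m\<^sup>3 \<Omega>\<^sup>2 \<theta>\<^sup>m\<close> (\<open>block_growth\<close>). For \<open>m = 2\<^sup>k\<close> the increments can be made summable by
  \<open>- log \<theta>\<^sub>k\<close> of size \<open>2\<^sup>-\<^sup>k (k + log \<Omega>\<^sub>k)\<close>, and Condition \<open>\<omega>\<close> says that these numbers are summable, so
  that the radii stay away from \<open>0\<close> (\<open>dyadic_radii\<close>, \<open>convergence_from_growth\<close>).
\<close>

section \<open>Multi-indices and the degree filtration\<close>

lemma mdegree_0 [simp]: "mdegree 0 = 0"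
  by (simp add: mdegree_def)

lemma mdegree_add [simp]: "mdegree (P + Q) = mdegree P + mdegree Q"
  by (simp add: mdegree_def sum.distrib)

lemma mdegree_axis [simp]: "mdegree (axis i 1) = 1"
  by (simp add: mdegree_def axis_def)

lemma mdegree_axis_Suc [simp]: "mdegree (axis i (Suc 0)) = 1"
  using mdegree_axis[of i] by simp

lemma mdegree_eq_0_iff: "mdegree P = 0 \<longleftrightarrow> P = 0"
  by (auto simp: mdegree_def vec_eq_iff)

lemma obtain_minus_axis:
  fixes P :: "nat ^ 'n::finite"
  assumes "P $ i > 0" obtains R where "P = R + axis i 1"
proof
  show "P = (P - axis i 1) + axis i 1"
    using assms by (auto simp: vec_eq_iff axis_def)
qed

lemma mfps_nth_0 [simp]: "mfps_nth 0 P = 0"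
  by (simp add: zero_mfps.rep_eq)

lemma mfps_nth_add [simp]: "mfps_nth (f + g) P = mfps_nth f P + mfps_nth g P"
  by (simp add: plus_mfps.rep_eq)

lemma mfps_nth_diff [simp]: "mfps_nth (f - g) P = mfps_nth f P - mfps_nth g P"
  by (simp add: minus_mfps.rep_eq)

lemma mfps_nth_uminus [simp]: "mfps_nth (- f) P = - mfps_nth f P"
  by (simp add: uminus_mfps.rep_eq)

lemma mfps_nth_sum: "mfps_nth (\<Sum>i\<in>A. f i) P = (\<Sum>i\<in>A. mfps_nth (f i) P)"
  by (induction A rule: infinite_finite_induct) auto

lemma mfps_nth_mult: "mfps_nth (f * g) P = (\<Sum>(Q, R) | Q + R = P. mfps_nth f Q * mfps_nth g R)"
  by (simp add: times_mfps.rep_eq)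

lemma mfps_nth_const: "mfps_nth (mfps_const c) P = (if P = 0 then c else 0)"
  by (simp add: mfps_const_def)

lemma mfps_nth_var: "mfps_nth (mfps_var i) P = (if P = axis i 1 then 1 else 0)"
  by (simp add: mfps_var_def)

lemma mfps_nth_deriv:
  "mfps_nth (mfps_deriv j f) P = of_nat (P $ j + 1) * mfps_nth f (P + axis j 1)"
  by (simp add: mfps_deriv_def)

lemma mfps_nth_const_mult [simp]: "mfps_nth (mfps_const c * f) P = c * mfps_nth f P"
proof -
  have "mfps_nth (mfps_const c * f) P =
      (\<Sum>p\<in>{(Q, R). Q + R = P}. if p = (0, P) then c * mfps_nth f P else 0)"
    unfolding mfps_nth_mult by (rule sum.cong) (auto simp: mfps_nth_const split: if_splits)
  also have "\<dots> = c * mfps_nth f P"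
    by (subst sum.delta) (auto simp: finite_mindex_splits)
  finally show ?thesis .
qed

lemma mfps_nth_var_mult:
  "mfps_nth (mfps_var i * f) P = (if P $ i = 0 then 0 else mfps_nth f (P - axis i 1))"
proof (cases "P $ i = 0")
  case True
  have "mfps_nth (mfps_var i * f) P = 0"
    unfolding mfps_nth_mult using True by (intro sum.neutral) (auto simp: mfps_nth_var axis_def)
  then show ?thesis using True by simp
next
  case False
  then obtain R where P: "P = R + axis i 1" using obtain_minus_axis by blast
  have "mfps_nth (mfps_var i * f) P =
      (\<Sum>p\<in>{(Q, R). Q + R = P}. if p = (axis i 1, R) then mfps_nth f R else 0)"
    unfolding mfps_nth_mult
    by (rule sum.cong) (auto simp: mfps_nth_var P add.commute split: if_splits)
  also have "\<dots> = mfps_nth f R"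
    by (subst sum.delta) (auto simp: finite_mindex_splits P add.commute)
  finally show ?thesis using False P by simp
qed

lemma mfps_nth_var_mult_add [simp]:
  "mfps_nth (mfps_var i * f) (P + axis i (Suc 0)) = mfps_nth f P"
  by (simp add: mfps_nth_var_mult)

definition ord_ge :: "nat \<Rightarrow> ('a::comm_ring_1, 'n::finite) mfps \<Rightarrow> bool"
  where "ord_ge d f \<longleftrightarrow> (\<forall>P. mdegree P < d \<longrightarrow> mfps_nth f P = 0)"

lemma ord_ge_0 [simp]: "ord_ge d 0"
  by (simp add: ord_ge_def)

lemma ord_ge_zero [simp]: "ord_ge 0 f"
  by (simp add: ord_ge_def)

lemma ord_geD: "ord_ge d f \<Longrightarrow> mdegree P < d \<Longrightarrow> mfps_nth f P = 0"
  by (simp add: ord_ge_def)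

lemma ord_ge_mono: "ord_ge d f \<Longrightarrow> e \<le> d \<Longrightarrow> ord_ge e f"
  by (simp add: ord_ge_def)

lemma ord_ge_add: "ord_ge d f \<Longrightarrow> ord_ge d g \<Longrightarrow> ord_ge d (f + g)"
  by (simp add: ord_ge_def)

lemma ord_ge_diff: "ord_ge d f \<Longrightarrow> ord_ge d g \<Longrightarrow> ord_ge d (f - g)"
  by (simp add: ord_ge_def)

lemma ord_ge_uminus: "ord_ge d f \<Longrightarrow> ord_ge d (- f)"
  by (simp add: ord_ge_def)

lemma ord_ge_sum: "(\<And>i. i \<in> A \<Longrightarrow> ord_ge d (f i)) \<Longrightarrow> ord_ge d (\<Sum>i\<in>A. f i)"
  by (induction A rule: infinite_finite_induct) (auto intro: ord_ge_add)

lemma ord_ge_commute: "ord_ge d (f - g) \<longleftrightarrow> ord_ge d (g - f)"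
  by (metis minus_diff_eq ord_ge_uminus)

lemma ord_ge_mult:
  fixes f g :: "('a::comm_ring_1, 'n::finite) mfps"
  assumes "ord_ge d f" "ord_ge e g" shows "ord_ge (d + e) (f * g)"
  unfolding ord_ge_def
proof (intro allI impI)
  fix P :: "nat ^ 'n" assume P: "mdegree P < d + e"
  have "mfps_nth f Q * mfps_nth g R = 0" if "Q + R = P" for Q R
  proof -
    have "mdegree Q + mdegree R < d + e" using P that by auto
    then have "mdegree Q < d \<or> mdegree R < e" by linarith
    then show ?thesis using assms by (auto simp: ord_geD)
  qed
  then show "mfps_nth (f * g) P = 0"
    unfolding mfps_nth_mult by (intro sum.neutral) auto
qed

lemma ord_ge_mult_left: "ord_ge d f \<Longrightarrow> ord_ge d (g * f)"
  using ord_ge_mult[of 0 g d f] by simp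

lemma ord_ge_mult_right: "ord_ge d f \<Longrightarrow> ord_ge d (f * g)"
  using ord_ge_mult[of d f 0 g] by simp

lemma ord_ge_eq0: "(\<And>d. ord_ge d f) \<Longrightarrow> f = 0"
  by (rule mfps_eqI) (metis lessI mfps_nth_0 ord_geD)

lemma ord_ge_deriv: "ord_ge d f \<Longrightarrow> ord_ge (d - 1) (mfps_deriv j f)"
  by (auto simp: ord_ge_def mfps_nth_deriv)

lemma ord_ge_deriv': "ord_ge (Suc d) f \<Longrightarrow> ord_ge d (mfps_deriv j f)"
  using ord_ge_deriv by fastforce

lemma ord_ge_var [simp]: "ord_ge (Suc 0) (mfps_var i)"
  by (auto simp: ord_ge_def mfps_nth_var)

lemma mfps_const_0 [simp]: "mfps_const 0 = 0"
  by (rule mfps_eqI) (simp add: mfps_nth_const)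

lemma mfps_const_1: "mfps_const 1 = 1"
  by (rule mfps_eqI) (simp add: mfps_nth_const one_mfps.rep_eq)

section \<open>Partial derivatives\<close>

lemma mfps_deriv_add: "mfps_deriv j (f + g) = mfps_deriv j f + mfps_deriv j g"
  by (rule mfps_eqI) (simp add: mfps_nth_deriv algebra_simps)

lemma mfps_deriv_diff: "mfps_deriv j (f - g) = mfps_deriv j f - mfps_deriv j g"
  by (rule mfps_eqI) (simp add: mfps_nth_deriv algebra_simps)

lemma mfps_deriv_0 [simp]: "mfps_deriv j 0 = 0"
  by (rule mfps_eqI) (simp add: mfps_nth_deriv)

lemma mfps_deriv_const [simp]: "mfps_deriv j (mfps_const c) = 0"
  by (rule mfps_eqI) (auto simp: mfps_nth_deriv mfps_nth_const vec_eq_iff axis_def)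

lemma mfps_deriv_var: "mfps_deriv j (mfps_var i) = (if i = j then 1 else 0)"
proof (rule mfps_eqI)
  fix P :: "nat ^ 'b"
  have "P + axis j 1 = axis i 1 \<longleftrightarrow> i = j \<and> P = 0"
  proof
    assume eq: "P + axis j 1 = axis i 1"
    then have "mdegree P + 1 = 1" by (metis mdegree_add mdegree_axis)
    then have "P = 0" using mdegree_eq_0_iff[of P] by simp
    moreover have "i = j" using eq \<open>P = 0\<close> by (simp add: axis_eq_axis)
    ultimately show "i = j \<and> P = 0" by simp
  qed simp
  then show "mfps_nth (mfps_deriv j (mfps_var i)) P = mfps_nth (if i = j then 1 else 0) P"
    by (auto simp: mfps_nth_deriv mfps_nth_var one_mfps.rep_eq)
qed

lemma mfps_deriv_sum: "mfps_deriv j (\<Sum>i\<in>A. f i) = (\<Sum>i\<in>A. mfps_deriv j (f i))"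
  by (induction A rule: infinite_finite_induct) (auto simp: mfps_deriv_add)

lemma mfps_deriv_commute: "mfps_deriv j (mfps_deriv k f) = mfps_deriv k (mfps_deriv j f)"
  by (rule mfps_eqI) (cases "j = k"; auto simp: mfps_nth_deriv axis_def ac_simps)

lemma sum_splits_shift:
  fixes f g :: "nat ^ 'n::finite \<Rightarrow> 'a::comm_ring_1"
  shows "(\<Sum>(Q, R) | Q + R = P + axis j 1. of_nat (Q $ j) * f Q * g R) =
    (\<Sum>(Q, R) | Q + R = P. of_nat (Q $ j + 1) * f (Q + axis j 1) * g R)"
proof -
  let ?h = "\<lambda>(Q, R). (Q + axis j 1, R :: nat ^ 'n)"
  have inj: "inj_on ?h {(Q, R). Q + R = P}" by (auto simp: inj_on_def)
  have "(\<Sum>(Q, R) | Q + R = P + axis j 1. of_nat (Q $ j) * f Q * g R) =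
      (\<Sum>(Q, R) \<in> ?h ` {(Q, R). Q + R = P}. of_nat (Q $ j) * f Q * g R)"
  proof (rule sum.mono_neutral_right)
    show "\<forall>i\<in>{(Q, R). Q + R = P + axis j 1} - ?h ` {(Q, R). Q + R = P}.
        (case i of (Q, R) \<Rightarrow> of_nat (Q $ j) * f Q * g R) = 0"
    proof safe
      fix Q R assume QR: "Q + R = P + axis j 1" "(Q, R) \<notin> ?h ` {(Q, R). Q + R = P}"
      have "Q $ j = 0"
      proof (rule ccontr)
        assume "Q $ j \<noteq> 0"
        then obtain Q' where "Q = Q' + axis j 1" using obtain_minus_axis by blast
        moreover from this QR(1) have "(Q' + R) + axis j 1 = P + axis j 1"
          by (simp add: ac_simps)
        then have "Q' + R = P" by (simp only: add_right_cancel)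
        ultimately show False using QR(2) by (auto simp: image_iff)
      qed
      then show "of_nat (Q $ j) * f Q * g R = 0" by simp
    qed
  qed (auto simp: finite_mindex_splits ac_simps)
  also have "\<dots> = (\<Sum>(Q, R) | Q + R = P. of_nat (Q $ j + 1) * f (Q + axis j 1) * g R)"
    by (subst sum.reindex[OF inj]) (auto simp: case_prod_unfold axis_def o_def)
  finally show ?thesis .
qed

lemma mfps_deriv_mult:
  fixes f g :: "('a::comm_ring_1, 'n::finite) mfps"
  shows "mfps_deriv j (f * g) = mfps_deriv j f * g + f * mfps_deriv j g"
proof (rule mfps_eqI)
  fix P :: "nat ^ 'n"
  let ?A = "{(Q, R). Q + R = P + axis j 1}"
  have "mfps_nth (mfps_deriv j (f * g)) P =
      (\<Sum>(Q, R)\<in>?A. of_nat (P $ j + 1) * (mfps_nth f Q * mfps_nth g R))"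
    by (simp add: mfps_nth_deriv mfps_nth_mult sum_distrib_left case_prod_unfold)
  also have "\<dots> = (\<Sum>(Q, R)\<in>?A. of_nat (Q $ j) * mfps_nth f Q * mfps_nth g R
      + of_nat (R $ j) * mfps_nth g R * mfps_nth f Q)"
  proof (rule sum.cong, simp, safe)
    fix Q R assume "Q + R = P + axis j 1"
    then have "(Q + R) $ j = (P + axis j 1) $ j" by simp
    then have "Q $ j + R $ j = P $ j + 1" by (simp add: axis_def)
    then have "(of_nat (P $ j + 1) :: 'a) = of_nat (Q $ j + R $ j)" by (rule arg_cong[OF sym])
    then have "(of_nat (P $ j + 1) :: 'a) = of_nat (Q $ j) + of_nat (R $ j)" by simp
    then show "of_nat (P $ j + 1) * (mfps_nth f Q * mfps_nth g R) =
      of_nat (Q $ j) * mfps_nth f Q * mfps_nth g R + of_nat (R $ j) * mfps_nth g R * mfps_nth f Q"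
      by (simp add: algebra_simps)
  qed
  also have "\<dots> = (\<Sum>(Q, R)\<in>?A. of_nat (Q $ j) * mfps_nth f Q * mfps_nth g R)
      + (\<Sum>(Q, R)\<in>?A. of_nat (R $ j) * mfps_nth g R * mfps_nth f Q)"
    by (simp add: sum.distrib case_prod_unfold)
  also have "(\<Sum>(Q, R)\<in>?A. of_nat (R $ j) * mfps_nth g R * mfps_nth f Q) =
      (\<Sum>(Q, R)\<in>?A. of_nat (Q $ j) * mfps_nth g Q * mfps_nth f R)"
    by (rule sum.reindex_bij_witness[where i = prod.swap and j = prod.swap])
      (auto simp: add.commute)
  finally show "mfps_nth (mfps_deriv j (f * g)) P =
      mfps_nth (mfps_deriv j f * g + f * mfps_deriv j g) P"
    unfolding sum_splits_shift mult.commute[of f "mfps_deriv j g"]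
    by (simp add: mfps_nth_mult mfps_nth_deriv)
qed

text \<open>Every series is \<open>c + \<Sum>\<^sub>i x\<^sub>i f\<^sub>i\<close>: assign each nonconstant monomial to one of its variables. Iterating
this \<open>d\<close> times approximates \<open>f\<close> up to degree \<open>d\<close> within the subring generated by constants and
variables. Identities between continuous ring operations can therefore be checked on generators.\<close>

lemma mfps_approx:
  fixes f :: "('a::comm_ring_1, 'n::finite) mfps"
  assumes "\<And>c. P (mfps_const c)" "\<And>i. P (mfps_var i)"
    "\<And>f g. P f \<Longrightarrow> P g \<Longrightarrow> P (f + g)" "\<And>f g. P f \<Longrightarrow> P g \<Longrightarrow> P (f * g)"
  shows "\<exists>g. P g \<and> ord_ge d (f - g)"
proof (induction d arbitrary: f)
  case 0
  then show ?case using assms(1) by (auto simp: ord_ge_def)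
next
  case (Suc d)
  \<comment> \<open>a variable occurring in the given monomial\<close>
  define ch where "ch = (\<lambda>R :: nat ^ 'n. SOME i. R $ i \<noteq> 0)"
  define part where "part i = Abs_mfps (\<lambda>R. if ch (R + axis i 1) = i then mfps_nth f (R + axis i 1) else 0)" for i
  have "\<forall>i. \<exists>g. P g \<and> ord_ge d (part i - g)"
    using Suc.IH by blast
  from choice[OF this] obtain g where g: "\<And>i. P (g i)" "\<And>i. ord_ge d (part i - g i)"
    by blast
  have P0: "P 0" using assms(1)[of 0] by simp
  have Psum: "P (\<Sum>i\<in>A. mfps_var i * g i)" for A :: "'n set"
    by (induction A rule: infinite_finite_induct) (simp_all add: P0 assms(2-4) g(1))
  have f: "f = mfps_const (mfps_nth f 0) + (\<Sum>i\<in>UNIV. mfps_var i * part i)"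
  proof (rule mfps_eqI)
    fix R
    show "mfps_nth f R = mfps_nth (mfps_const (mfps_nth f 0) + (\<Sum>i\<in>UNIV. mfps_var i * part i)) R"
    proof (cases "R = 0")
      case False
      then have nz: "R $ ch R \<noteq> 0" unfolding ch_def by (metis (mono_tags) someI_ex vec_eq_iff zero_index)
      have eq: "mfps_nth (mfps_var i * part i) R = (if i = ch R then mfps_nth f R else 0)" for i
      proof (cases "R $ i = 0")
        case True then show ?thesis using nz by (auto simp: mfps_nth_var_mult)
      next
        case False
        then obtain S where "R = S + axis i 1" using obtain_minus_axis by blast
        then show ?thesis by (auto simp: part_def)
      qed
      show ?thesis using False by (simp add: mfps_nth_const mfps_nth_sum eq)
    qed (simp add: mfps_nth_const mfps_nth_sum mfps_nth_var_mult)
  qed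
  have "f - (mfps_const (mfps_nth f 0) + (\<Sum>i\<in>UNIV. mfps_var i * g i))
      = (\<Sum>i\<in>UNIV. mfps_var i * (part i - g i))"
    by (subst (1) f) (simp add: algebra_simps sum_subtractf)
  moreover have "ord_ge (Suc d) (\<Sum>i\<in>UNIV. mfps_var i * (part i - g i))"
    using g(2) ord_ge_mult[OF ord_ge_var] by (intro ord_ge_sum) fastforce
  moreover have "P (mfps_const (mfps_nth f 0) + (\<Sum>i\<in>UNIV. mfps_var i * g i))"
    by (intro assms(1,3) Psum)
  ultimately show ?case by auto
qed

lemma mfps_dense_induct [case_names const var add mult limit]:
  fixes f :: "('a::comm_ring_1, 'n::finite) mfps"
  assumes "\<And>c. P (mfps_const c)" "\<And>i. P (mfps_var i)"
    "\<And>f g. P f \<Longrightarrow> P g \<Longrightarrow> P (f + g)" "\<And>f g. P f \<Longrightarrow> P g \<Longrightarrow> P (f * g)"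
    "\<And>f. (\<And>d. \<exists>g. P g \<and> ord_ge d (f - g)) \<Longrightarrow> P f"
  shows "P f"
  using assms(5) mfps_approx[of P, OF assms(1-4)] by blast

section \<open>Composition\<close>

definition vord_ge :: "nat \<Rightarrow> ('a::comm_ring_1, 'n::finite) mfps ^ 'n \<Rightarrow> bool"
  where "vord_ge d w \<longleftrightarrow> (\<forall>i. ord_ge d (w $ i))"

lemma vord_geD: "vord_ge d w \<Longrightarrow> ord_ge d (w $ i)"
  by (simp add: vord_ge_def)

lemma vord_ge_0 [simp]: "vord_ge d 0"
  by (simp add: vord_ge_def)

lemma vord_ge_zero [simp]: "vord_ge 0 w"
  by (simp add: vord_ge_def)

lemma vord_ge_mono: "vord_ge d f \<Longrightarrow> e \<le> d \<Longrightarrow> vord_ge e f"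
  by (auto simp: vord_ge_def intro: ord_ge_mono)

lemma vord_ge_add: "vord_ge d f \<Longrightarrow> vord_ge d g \<Longrightarrow> vord_ge d (f + g)"
  by (simp add: vord_ge_def ord_ge_add)

lemma vord_ge_diff: "vord_ge d f \<Longrightarrow> vord_ge d g \<Longrightarrow> vord_ge d (f - g)"
  by (simp add: vord_ge_def ord_ge_diff)

lemma vord_ge_trans: "vord_ge d (f - g) \<Longrightarrow> vord_ge d (g - h) \<Longrightarrow> vord_ge d (f - h)"
  using vord_ge_add by fastforce

lemma vord_ge_commute: "vord_ge d (f - g) \<longleftrightarrow> vord_ge d (g - f)"
  by (simp add: vord_ge_def ord_ge_commute)

lemma vord_ge_eq0: "(\<And>d. vord_ge d f) \<Longrightarrow> f = 0"
  by (simp add: vord_ge_def vec_eq_iff ord_ge_eq0)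

definition mmonom :: "('a::comm_ring_1, 'n::finite) mfps ^ 'n \<Rightarrow> nat ^ 'n \<Rightarrow> ('a, 'n) mfps"
  where "mmonom H Q = (\<Prod>k\<in>UNIV. (H $ k) ^ (Q $ k))"

lemma mmonom_0 [simp]: "mmonom H 0 = 1"
  by (simp add: mmonom_def)

lemma mmonom_add: "mmonom H (Q + R) = mmonom H Q * mmonom H R"
  by (simp add: mmonom_def power_add prod.distrib)

lemma mmonom_axis [simp]: "mmonom H (axis i 1) = H $ i"
proof -
  have "(H $ k) ^ (axis i 1 $ k) = (if k = i then H $ i else 1)" for k
    by (simp add: axis_def)
  then show ?thesis by (simp add: mmonom_def)
qed

lemma ord_ge_power: "ord_ge (Suc 0) f \<Longrightarrow> ord_ge n (f ^ n)"
  by (induction n) (use ord_ge_mult in fastforce)+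

lemma ord_ge_prod: "(\<And>i. i \<in> A \<Longrightarrow> ord_ge (n i) (f i)) \<Longrightarrow> ord_ge (sum n A) (prod f A)"
  by (induction A rule: infinite_finite_induct) (simp_all add: ord_ge_mult)

lemma ord_ge_mmonom: "vord_ge (Suc 0) H \<Longrightarrow> ord_ge (mdegree Q) (mmonom H Q)"
  unfolding mmonom_def mdegree_def by (intro ord_ge_prod ord_ge_power vord_geD)

lemma mfps_nth_compose:
  assumes "vord_ge (Suc 0) H" "mdegree P \<le> d"
  shows "mfps_nth (mfps_compose f H) P =
    (\<Sum>Q | mdegree Q \<le> d. mfps_nth f Q * mfps_nth (mmonom H Q) P)"
proof -
  have "mfps_nth (mfps_compose f H) P =
      (\<Sum>Q | mdegree Q \<le> mdegree P. mfps_nth f Q * mfps_nth (mmonom H Q) P)"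
    by (simp add: mfps_compose_def mmonom_def)
  also have "\<dots> = (\<Sum>Q | mdegree Q \<le> d. mfps_nth f Q * mfps_nth (mmonom H Q) P)"
    using assms by (intro sum.mono_neutral_left finite_mdegree_le)
      (auto simp: ord_geD[OF ord_ge_mmonom])
  finally show ?thesis .
qed

text \<open>Up to degree \<open>d\<close> a composition is a finite sum of products, because \<open>H\<^sup>Q\<close> has order at least \<open>|Q|\<close>.
This reduces multiplicativity and norm bounds of compositions to finite sums.\<close>

lemma compose_partial_sum:
  assumes "vord_ge (Suc 0) H"
  shows "ord_ge (Suc d) (mfps_compose f H -
    (\<Sum>Q | mdegree Q \<le> d. mfps_const (mfps_nth f Q) * mmonom H Q))"
  using mfps_nth_compose[OF assms] by (auto simp: ord_ge_def mfps_nth_sum)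

lemma compose_add: "mfps_compose (f + g) H = mfps_compose f H + mfps_compose g H"
  by (rule mfps_eqI) (simp add: mfps_compose_def algebra_simps sum.distrib)

lemma compose_diff: "mfps_compose (f - g) H = mfps_compose f H - mfps_compose g H"
  by (rule mfps_eqI) (simp add: mfps_compose_def algebra_simps sum_subtractf)

lemma compose_0 [simp]: "mfps_compose 0 H = 0"
  by (rule mfps_eqI) (simp add: mfps_compose_def)

lemma compose_sum: "mfps_compose (\<Sum>i\<in>A. f i) H = (\<Sum>i\<in>A. mfps_compose (f i) H)"
  by (induction A rule: infinite_finite_induct) (auto simp: compose_add)

lemma compose_const [simp]: "mfps_compose (mfps_const c) H = mfps_const c"
proof (rule mfps_eqI)
  fix P :: "nat ^ 'b"
  have "mfps_nth (mfps_compose (mfps_const c) H) P =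
      (\<Sum>Q | mdegree (Q :: nat ^ 'b) \<le> mdegree P. if Q = 0 then c * mfps_nth 1 P else 0)"
    unfolding mfps_compose_def mfps_nth_Abs
    by (rule sum.cong) (auto simp: mfps_nth_const)
  also have "\<dots> = c * mfps_nth 1 P"
    by (simp add: sum.delta finite_mdegree_le)
  finally show "mfps_nth (mfps_compose (mfps_const c) H) P = mfps_nth (mfps_const c) P"
    by (simp add: mfps_nth_const one_mfps.rep_eq)
qed

lemma compose_1 [simp]: "mfps_compose 1 H = 1"
  using compose_const[of 1 H] by (simp add: mfps_const_1)

lemma compose_var [simp]:
  assumes "vord_ge (Suc 0) H" shows "mfps_compose (mfps_var i) H = H $ i"
proof (rule mfps_eqI)
  fix P :: "nat ^ 'b"
  have "mfps_nth (mfps_compose (mfps_var i) H) P =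
      (\<Sum>Q | mdegree Q \<le> mdegree P + 1. if Q = axis i 1 then mfps_nth (H $ i) P else 0)"
    unfolding mfps_nth_compose[OF assms le_add1[of "mdegree P" 1]]
    by (rule sum.cong) (auto simp: mfps_nth_var mmonom_axis[simplified])
  also have "\<dots> = mfps_nth (H $ i) P"
    by (simp add: sum.delta finite_mdegree_le)
  finally show "mfps_nth (mfps_compose (mfps_var i) H) P = mfps_nth (H $ i) P" .
qed

lemma ord_ge_mult_cong:
  assumes "ord_ge d (f - f')" "ord_ge d (g - g')" shows "ord_ge d (f * g - f' * g')"
proof -
  have "f * g - f' * g' = f * (g - g') + (f - f') * g'" by (simp add: algebra_simps)
  then show ?thesis using assms by (simp add: ord_ge_add ord_ge_mult_left ord_ge_mult_right)
qed

lemma ord_ge_nth_eq: "ord_ge d (f - g) \<Longrightarrow> mdegree P < d \<Longrightarrow> mfps_nth f P = mfps_nth g P"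
  using ord_geD[of d "f - g" P] by simp

lemma compose_mult:
  fixes f g :: "('a::comm_ring_1, 'n::finite) mfps"
  assumes H: "vord_ge (Suc 0) H"
  shows "mfps_compose (f * g) H = mfps_compose f H * mfps_compose g H"
proof (rule mfps_eqI)
  fix P :: "nat ^ 'n"
  define D where "D = {Q :: nat ^ 'n. mdegree Q \<le> mdegree P}"
  define t where "t = (\<lambda>(Q, R). mfps_nth f Q * mfps_nth g R * mfps_nth (mmonom H (Q + R)) P)"
  have finD: "finite D" unfolding D_def by (rule finite_mdegree_le)
  have "mfps_nth (mfps_compose f H * mfps_compose g H) P =
      mfps_nth ((\<Sum>Q\<in>D. mfps_const (mfps_nth f Q) * mmonom H Q) *
        (\<Sum>Q\<in>D. mfps_const (mfps_nth g Q) * mmonom H Q)) P"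
    unfolding D_def
    by (rule ord_ge_nth_eq[OF ord_ge_mult_cong[OF compose_partial_sum[OF H] compose_partial_sum[OF H]]])
      simp
  also have "\<dots> = (\<Sum>Q\<in>D. \<Sum>R\<in>D. t (Q, R))"
  proof -
    have "mfps_const a * mmonom H Q * (mfps_const b * mmonom H R) =
        mfps_const a * (mfps_const b * mmonom H (Q + R))" for a b Q R
      unfolding mmonom_add by (simp only: ac_simps)
    then show ?thesis by (simp add: sum_product mfps_nth_sum t_def mult.assoc)
  qed
  also have "\<dots> = (\<Sum>p\<in>D \<times> D. t p)"
    by (simp add: sum.cartesian_product)
  also have "\<dots> = (\<Sum>p\<in>{(Q, R). Q + R \<in> D}. t p)"
  proof (rule sum.mono_neutral_right)
    have z: "t (Q, R) = 0" if "Q + R \<notin> D" for Q R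
    proof -
      have "mfps_nth (mmonom H (Q + R)) P = 0"
        using that by (intro ord_geD[OF ord_ge_mmonom[OF H]]) (simp add: D_def not_le)
      then show ?thesis by (simp add: t_def)
    qed
    show "\<forall>i\<in>D \<times> D - {(Q, R). Q + R \<in> D}. t i = 0"
      using z by blast
  qed (use finD in \<open>simp, auto simp: D_def\<close>)
  also have "\<dots> = (\<Sum>p\<in>(SIGMA S:D. {(Q, R). Q + R = S}). t (snd p))"
    by (rule sum.reindex_bij_witness[where i = snd and j = "\<lambda>(Q, R). (Q + R, (Q, R))"]) auto
  also have "\<dots> = (\<Sum>S\<in>D. \<Sum>p\<in>{(Q, R). Q + R = S}. t p)"
    by (subst sum.Sigma) (auto simp: finD case_prod_unfold
        intro: finite_mindex_splits[unfolded case_prod_unfold])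
  also have "\<dots> = mfps_nth (mfps_compose (f * g) H) P"
    by (simp add: mfps_nth_compose[OF H order_refl] mfps_nth_mult sum_distrib_right D_def t_def
        case_prod_unfold)
  finally show "mfps_nth (mfps_compose (f * g) H) P =
      mfps_nth (mfps_compose f H * mfps_compose g H) P" by simp
qed

lemma ord_ge_compose:
  assumes "ord_ge d f" "vord_ge (Suc 0) H" shows "ord_ge d (mfps_compose f H)"
  using assms by (auto simp: ord_ge_def mfps_nth_compose[OF assms(2) order_refl] intro!: sum.neutral)

text \<open>The step from generators to all series for two additive operators. Both may lower the order by one,
since the operators compared in the chain rule contain a derivative.\<close>

lemma compose_eq_by_density:
  assumes "\<And>f g. \<Phi> (f - g) = \<Phi> f - \<Phi> g" "\<And>f g. \<Psi> (f - g) = \<Psi> f - \<Psi> g"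
    and "\<And>f d. ord_ge (Suc d) f \<Longrightarrow> ord_ge d (\<Phi> f)" "\<And>f d. ord_ge (Suc d) f \<Longrightarrow> ord_ge d (\<Psi> f)"
    and "\<And>d. \<exists>g. \<Phi> g = \<Psi> g \<and> ord_ge d (f - g)"
  shows "\<Phi> f = (\<Psi> f :: ('a::comm_ring_1, 'n::finite) mfps)"
proof -
  have "ord_ge d (\<Phi> f - \<Psi> f)" for d
  proof -
    obtain g where g: "\<Phi> g = \<Psi> g" "ord_ge (Suc d) (f - g)" using assms(5) by blast
    have "\<Phi> f - \<Psi> f = \<Phi> (f - g) - \<Psi> (f - g)" using g(1) by (simp add: assms(1,2))
    then show ?thesis using assms(3,4)[OF g(2)] by (simp add: ord_ge_diff)
  qed
  then show ?thesis using ord_ge_eq0 by (metis right_minus_eq)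
qed

lemma vord_ge_compose:
  "vord_ge d F \<Longrightarrow> vord_ge (Suc 0) H \<Longrightarrow> vord_ge d (\<chi> k. mfps_compose (F $ k) H)"
  by (simp add: vord_ge_def ord_ge_compose)

lemma compose_assoc:
  assumes H: "vord_ge (Suc 0) H" and T: "vord_ge (Suc 0) T"
  shows "mfps_compose (mfps_compose f H) T = mfps_compose f (\<chi> k. mfps_compose (H $ k) T)"
    (is "?L f = ?R f")
proof (induction f rule: mfps_dense_induct)
  case (limit f)
  show ?case
    by (rule compose_eq_by_density[OF _ _ _ _ limit])
      (use H T in \<open>auto simp: compose_diff vord_ge_compose intro!: ord_ge_compose intro: ord_ge_mono\<close>)
qed (simp_all add: H T vord_ge_compose compose_add compose_mult)

section \<open>Directional derivatives\<close>

definition dird :: "('a::comm_ring_1, 'n::finite) mfps \<Rightarrow> ('a, 'n) mfps ^ 'n \<Rightarrow> ('a, 'n) mfps"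
  where "dird f w = (\<Sum>j\<in>UNIV. mfps_deriv j f * w $ j)"

lemma jacobian_mult_nth: "(fvf_jacobian H *v G) $ i = dird (H $ i) G"
  by (simp add: fvf_jacobian_def matrix_vector_mult_def dird_def)

lemma dird_0_left [simp]: "dird 0 w = 0"
  by (simp add: dird_def)

lemma dird_const [simp]: "dird (mfps_const c) w = 0"
  by (simp add: dird_def)

lemma dird_var [simp]: "dird (mfps_var i) w = w $ i"
proof -
  have "mfps_deriv j (mfps_var i) * w $ j = (if j = i then w $ i else 0)" for j
    by (simp add: mfps_deriv_var)
  then show ?thesis by (simp add: dird_def)
qed

lemma dird_add_left: "dird (f + g) w = dird f w + dird g w"
  by (simp add: dird_def mfps_deriv_add algebra_simps sum.distrib)

lemma dird_diff_left: "dird (f - g) w = dird f w - dird g w"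
  by (simp add: dird_def mfps_deriv_diff algebra_simps sum_subtractf)

lemma dird_add_right: "dird f (v + w) = dird f v + dird f w"
  by (simp add: dird_def algebra_simps sum.distrib)

lemma dird_diff_right: "dird f (v - w) = dird f v - dird f w"
  by (simp add: dird_def algebra_simps sum_subtractf)

lemma dird_0_right [simp]: "dird f 0 = 0"
  by (simp add: dird_def)

lemma dird_sum_left: "dird (\<Sum>i\<in>A. f i) w = (\<Sum>i\<in>A. dird (f i) w)"
  by (induction A rule: infinite_finite_induct) (auto simp: dird_add_left)

lemma dird_sum_right: "dird f (\<Sum>i\<in>A. w i) = (\<Sum>i\<in>A. dird f (w i))"
  by (induction A rule: infinite_finite_induct) (auto simp: dird_add_right)

lemma dird_mult_left: "dird (f * g) w = dird f w * g + f * dird g w"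
  by (simp add: dird_def mfps_deriv_mult algebra_simps sum.distrib sum_distrib_left)

lemma dird_scale_right: "dird f (\<chi> i. a * w $ i) = a * dird f w"
  by (simp add: dird_def algebra_simps sum_distrib_left)

lemma ord_ge_dird: "ord_ge d f \<Longrightarrow> vord_ge e w \<Longrightarrow> ord_ge (d - 1 + e) (dird f w)"
  unfolding dird_def by (intro ord_ge_sum ord_ge_mult ord_ge_deriv vord_geD)

lemma ord_ge_dird': "ord_ge (Suc d) f \<Longrightarrow> vord_ge e w \<Longrightarrow> n \<le> d + e \<Longrightarrow> ord_ge n (dird f w)"
  using ord_ge_dird[of "Suc d" f e w] by (auto intro: ord_ge_mono)

lemma ord_ge_dird_right: "vord_ge e w \<Longrightarrow> ord_ge e (dird f w)"
  using ord_ge_dird[of 0 f e w] by simp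

text \<open>The commutator of two derivations is the derivation along the Lie bracket. It removes all second
derivatives of the transformation from the linearized conjugacy equation.\<close>

lemma dird_commutator:
  "dird (dird f w) G - dird (dird f G) w = dird f (\<chi> k. dird (w $ k) G - dird (G $ k) w)"
proof -
  have exp: "dird (dird f w) G = (\<Sum>j\<in>UNIV. \<Sum>k\<in>UNIV. mfps_deriv j (mfps_deriv k f) * w $ k * G $ j)
      + (\<Sum>k\<in>UNIV. mfps_deriv k f * dird (w $ k) G)" for w G :: "('a, 'b) mfps ^ 'b"
  proof -
    have "dird (dird f w) G = (\<Sum>j\<in>UNIV. \<Sum>k\<in>UNIV. mfps_deriv j (mfps_deriv k f) * w $ k * G $ j)
      + (\<Sum>j\<in>UNIV. \<Sum>k\<in>UNIV. mfps_deriv k f * (mfps_deriv j (w $ k) * G $ j))"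
      by (simp add: dird_def mfps_deriv_sum mfps_deriv_mult sum_distrib_right distrib_right
          sum.distrib mult.assoc)
    also have "(\<Sum>j\<in>UNIV. \<Sum>k\<in>UNIV. mfps_deriv k f * (mfps_deriv j (w $ k) * G $ j)) =
        (\<Sum>k\<in>UNIV. mfps_deriv k f * dird (w $ k) G)"
      by (subst sum.swap) (simp add: dird_def sum_distrib_left)
    finally show ?thesis .
  qed
  have "(\<Sum>j\<in>UNIV. \<Sum>k\<in>UNIV. mfps_deriv j (mfps_deriv k f) * w $ k * G $ j) =
      (\<Sum>j\<in>UNIV. \<Sum>k\<in>UNIV. mfps_deriv j (mfps_deriv k f) * G $ k * w $ j)"
    by (subst sum.swap) (simp add: mfps_deriv_commute ac_simps)
  then show ?thesis
    by (simp add: exp[of w G] exp[of G w]) (simp add: dird_def algebra_simps sum_subtractf)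
qed

lemma dird_compose:
  assumes H: "vord_ge (Suc 0) H"
  shows "dird (mfps_compose f H) w = (\<Sum>k\<in>UNIV. mfps_compose (mfps_deriv k f) H * dird (H $ k) w)"
proof (induction f rule: mfps_dense_induct)
  case (var i)
  have "mfps_compose (mfps_deriv k (mfps_var i)) H * dird (H $ k) w =
      (if k = i then dird (H $ i) w else 0)" for k
    by (simp add: mfps_deriv_var)
  then show ?case by (simp add: H)
next
  case (limit f)
  show ?case
  proof (rule compose_eq_by_density[OF _ _ _ _ limit])
    fix f :: "('a, 'b) mfps" and d assume f: "ord_ge (Suc d) f"
    show "ord_ge d (dird (mfps_compose f H) w)"
      by (rule ord_ge_dird'[OF ord_ge_compose[OF f H] vord_ge_zero]) simp
    show "ord_ge d (\<Sum>k\<in>UNIV. mfps_compose (mfps_deriv k f) H * dird (H $ k) w)"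
      by (intro ord_ge_sum ord_ge_mult_right ord_ge_compose ord_ge_deriv' f H)
  qed (simp_all add: compose_diff mfps_deriv_diff dird_diff_left algebra_simps sum_subtractf)
next
  case (mult f g)
  then show ?case
    by (simp add: H compose_mult compose_add mfps_deriv_mult dird_mult_left algebra_simps sum.distrib
        sum_distrib_left)
qed (simp_all add: compose_add mfps_deriv_add dird_add_left algebra_simps sum.distrib)

text \<open>The property is closed under products: writing each factor as value, linear part and remainder, what
is left besides remainders is the product of two linear parts, of order \<open>2 e\<close>.\<close>

lemma compose_taylor:
  fixes f :: "('a::comm_ring_1, 'n::finite) mfps"
  assumes H: "vord_ge (Suc 0) H" and v: "vord_ge e v" and e: "e \<ge> 1"
  shows "ord_ge (2 * e) (mfps_compose f (H + v) - mfps_compose f H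
    - (\<Sum>k\<in>UNIV. mfps_compose (mfps_deriv k f) H * v $ k))"
proof -
  define R where "R f = mfps_compose f (H + v) - mfps_compose f H
    - (\<Sum>k\<in>UNIV. mfps_compose (mfps_deriv k f) H * v $ k)" for f :: "('a, 'n) mfps"
  define B where "B f = mfps_compose f H" for f :: "('a, 'n) mfps"
  define L where "L f = (\<Sum>k\<in>UNIV. mfps_compose (mfps_deriv k f) H * v $ k)" for f :: "('a, 'n) mfps"
  have Hv: "vord_ge (Suc 0) (H + v)"
    using H v e by (auto intro!: vord_ge_add intro: vord_ge_mono)
  have L: "ord_ge e (L f)" for f
    unfolding L_def by (intro ord_ge_sum ord_ge_mult_left vord_geD v)
  have Lm: "L (f * g) = L f * B g + B f * L g" for f g
    by (simp add: L_def B_def H compose_mult compose_add mfps_deriv_mult algebra_simps sum.distrib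
        sum_distrib_left)
  have "ord_ge (2 * e) (R f)"
  proof (induction f rule: mfps_dense_induct)
    case (const c)
    then show ?case by (simp add: R_def)
  next
    case (var i)
    have "mfps_compose (mfps_deriv k (mfps_var i)) H * v $ k = (if k = i then v $ i else 0)" for k
      by (simp add: mfps_deriv_var)
    then show ?case by (simp add: R_def H Hv)
  next
    case (add f g)
    have "R (f + g) = R f + R g"
      by (simp add: R_def compose_add mfps_deriv_add algebra_simps sum.distrib)
    then show ?case using add by (simp add: ord_ge_add)
  next
    case (mult f g)
    have Rf: "mfps_compose h (H + v) = B h + L h + R h" for h
      by (simp add: R_def B_def L_def)
    have "R (f * g) = mfps_compose f (H + v) * mfps_compose g (H + v) - B f * B g - L (f * g)"
      unfolding R_def by (simp add: compose_mult Hv H B_def L_def)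
    also have "\<dots> = R f * (B g + L g + R g) + (B f + L f) * R g + L f * L g"
      unfolding Rf Lm by (simp add: algebra_simps)
    also have "ord_ge (2 * e) \<dots>"
      using mult ord_ge_mult[OF L[of f] L[of g]]
        ord_ge_mult_right[of "2 * e" "R f"] ord_ge_mult_left[of "2 * e" "R g"]
      by (simp add: ord_ge_add mult_2)
    finally show ?case .
  next
    case (limit f)
    obtain g where g: "ord_ge (2 * e) (R g)" "ord_ge (Suc (2 * e)) (f - g)" using limit by blast
    have "R f = R (f - g) + R g"
      by (simp add: R_def compose_diff mfps_deriv_diff algebra_simps sum_subtractf)
    moreover have "ord_ge (2 * e) (R h)" if h: "ord_ge (Suc (2 * e)) h" for h
    proof -
      have "ord_ge (2 * e) h" using h by (rule ord_ge_mono) simp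
      then show ?thesis
        unfolding R_def
        by (intro ord_ge_diff ord_ge_sum ord_ge_mult_right ord_ge_compose ord_ge_deriv' h H Hv)
    qed
    note this[OF g(2)]
    ultimately show ?case using g(1) by (simp add: ord_ge_add)
  qed
  then show ?thesis by (simp add: R_def)
qed

text \<open>A consequence of the Taylor formula. For \<open>e = 1\<close>, when \<open>f\<close> has order two, composition raises the
order of differences, which makes the operators below contractions.\<close>

lemma compose_cong:
  assumes H: "vord_ge (Suc 0) H" and TH: "vord_ge d (T - H)" and d: "d \<ge> 1"
    and f: "ord_ge (Suc e) f" and e: "e \<le> 1"
  shows "ord_ge (d + e) (mfps_compose f T - mfps_compose f H)"
proof -
  define S where "S = (\<Sum>k\<in>UNIV. mfps_compose (mfps_deriv k f) H * (T - H) $ k)"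
  have "ord_ge (2 * d) (mfps_compose f T - mfps_compose f H - S)"
    using compose_taylor[OF H TH d] by (simp add: S_def)
  then have "ord_ge (d + e) (mfps_compose f T - mfps_compose f H - S)"
    by (rule ord_ge_mono) (use d e in simp)
  moreover have "ord_ge (e + d) S"
    unfolding S_def by (intro ord_ge_sum ord_ge_mult ord_ge_compose ord_ge_deriv' f H vord_geD[OF TH])
  then have "ord_ge (d + e) S" by (simp add: add.commute)
  ultimately show ?thesis using ord_ge_add by fastforce
qed

section \<open>Fixed points of contractions\<close>

text \<open>The iterates agree in more and more degrees, so each coefficient becomes stationary.\<close>

lemma contraction_fixpoint:
  fixes \<Phi> :: "('a::comm_ring_1, 'n::finite) mfps ^ 'n \<Rightarrow> ('a, 'n) mfps ^ 'n"
  assumes inv: "\<And>f. vord_ge e f \<Longrightarrow> vord_ge e (\<Phi> f)"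
    and contr: "\<And>f g d. vord_ge e f \<Longrightarrow> vord_ge e g \<Longrightarrow> d \<ge> e \<Longrightarrow> vord_ge d (f - g) \<Longrightarrow>
      vord_ge (Suc d) (\<Phi> f - \<Phi> g)"
  obtains f where "vord_ge e f" "\<Phi> f = f"
proof -
  define s where "s n = (\<Phi> ^^ n) 0" for n
  have s_Suc: "s (Suc n) = \<Phi> (s n)" for n by (simp add: s_def)
  have se: "vord_ge e (s n)" for n
    by (induction n) (simp_all add: s_def inv)
  have step: "vord_ge (e + n) (s (Suc n) - s n)" for n
  proof (induction n)
    case 0
    then show ?case using se by (simp add: vord_ge_diff)
  next
    case (Suc n)
    then show ?case using contr[OF se se _ Suc] by (simp add: s_Suc)
  qed
  have near: "vord_ge (e + n) (s (n + k) - s n)" for n k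
  proof (induction k)
    case (Suc k)
    have "vord_ge (e + n) (s (Suc (n + k)) - s (n + k))"
      using step by (rule vord_ge_mono) simp
    then show ?case using Suc vord_ge_trans by fastforce
  qed simp
  \<comment> \<open>the coefficients of degree \<open>d\<close> are final after \<open>Suc d\<close> iterations\<close>
  define f where "f = (\<chi> i. Abs_mfps (\<lambda>P. mfps_nth (s (Suc (mdegree P)) $ i) P))"
  have fs: "vord_ge (e + n) (f - s n)" if "n \<ge> 1" for n
    unfolding vord_ge_def ord_ge_def
  proof (intro allI impI)
    fix i and P :: "nat ^ 'n" assume P: "mdegree P < e + n"
    let ?N = "Suc (mdegree P)"
    have eq: "mfps_nth (s (?N + k) $ i) P = mfps_nth (s ?N $ i) P" for k
      using ord_ge_nth_eq[of "e + ?N" "s (?N + k) $ i" "s ?N $ i" P]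
        vord_geD[OF near[of ?N k], of i] by simp
    have eq2: "mfps_nth (s (n + k) $ i) P = mfps_nth (s n $ i) P" for k
      using ord_ge_nth_eq[of "e + n" "s (n + k) $ i" "s n $ i" P] P
        vord_geD[OF near[of n k], of i] by simp
    have "mfps_nth (s ?N $ i) P = mfps_nth (s n $ i) P"
      using eq[of n] eq2[of ?N] by (simp add: add.commute)
    then show "mfps_nth ((f - s n) $ i) P = 0" by (simp add: f_def)
  qed
  have fe: "vord_ge e f"
  proof -
    have "vord_ge e (f - s 1)" using fs[of 1] by (rule vord_ge_mono) auto
    then have "vord_ge e (f - s 1 + s 1)" using se vord_ge_add by blast
    then show ?thesis by simp
  qed
  have "vord_ge n (\<Phi> f - f)" for n
  proof -
    have "vord_ge (Suc (e + Suc n)) (\<Phi> f - \<Phi> (s (Suc n)))"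
      using fs[of "Suc n"] by (intro contr fe se) auto
    then have 1: "vord_ge n (\<Phi> f - \<Phi> (s (Suc n)))" by (rule vord_ge_mono) simp
    have "vord_ge (e + Suc (Suc n)) (f - s (Suc (Suc n)))" by (rule fs) simp
    then have "vord_ge n (f - \<Phi> (s (Suc n)))" unfolding s_Suc by (rule vord_ge_mono) simp
    then show ?thesis using 1 vord_ge_trans vord_ge_commute by blast
  qed
  then have "\<Phi> f = f" using vord_ge_eq0[of "\<Phi> f - f"] by simp
  then show ?thesis using fe that by blast
qed

section \<open>Weights and multipliers\<close>

definition intv :: "nat ^ 'n::finite \<Rightarrow> int ^ 'n"
  where "intv P = (\<chi> k. int (P $ k))"

lemma intv_add: "intv (P + Q) = intv P + intv Q"
  by (simp add: intv_def vec_eq_iff)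

lemma intv_0 [simp]: "intv 0 = 0"
  by (simp add: intv_def vec_eq_iff)

lemma intv_axis [simp]: "intv (axis i (Suc 0)) = axis i 1"
  by (simp add: intv_def vec_eq_iff axis_def)

lemma pairing_add: "pairing (P + Q) v = pairing P v + pairing Q v"
  by (simp add: pairing_def algebra_simps sum.distrib)

lemma pairing_diff: "pairing (P - Q) v = pairing P v - pairing Q v"
  by (simp add: pairing_def algebra_simps sum_subtractf)

lemma pairing_0 [simp]: "pairing 0 v = 0"
  by (simp add: pairing_def)

lemma pairing_axis [simp]: "pairing (axis i 1) v = v $ i"
proof -
  have "of_int (axis i 1 $ k) * v $ k = (if k = i then v $ i else 0)" for k
    by (simp add: axis_def)
  then show ?thesis by (simp add: pairing_def)
qed

lemma pairing_sum_right: "pairing Q (\<Sum>j\<in>A. c j *s L j) = (\<Sum>j\<in>A. c j * pairing Q (L j))"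
  unfolding pairing_def
  by (simp add: sum_distrib_left) (subst sum.swap, simp add: mult.left_commute)

lemma intv_minus_axis_in_N: "intv P - axis i 1 \<in> N_all"
  by (auto simp: N_all_def N_comp_def intv_def axis_def)

lemma intv_in_N: "intv P \<in> N_all"
  by (auto simp: N_all_def N_comp_def intv_def intro: order_trans[of _ 0])

definition idf :: "('a::comm_ring_1, 'n::finite) mfps ^ 'n"
  where "idf = (\<chi> i. mfps_var i)"

lemma idf_nth [simp]: "idf $ i = mfps_var i"
  by (simp add: idf_def)

lemma vord_ge_idf [simp]: "vord_ge (Suc 0) idf"
  by (simp add: vord_ge_def)

lemma vord_ge_idf_add: "vord_ge 2 h \<Longrightarrow> vord_ge (Suc 0) (idf + h)"
  by (intro vord_ge_add vord_ge_idf) (auto intro: vord_ge_mono)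

lemma fvf_diag_nth [simp]: "fvf_diag v $ i = mfps_const (v $ i) * mfps_var i"
  by (simp add: fvf_diag_def)

text \<open>Weight \<open>\<alpha>\<close> means that \<open>f\<close> is an eigenvector, with eigenvalue \<open>\<alpha>\<close>, of differentiation along the diagonal
field of \<open>lam\<close>. Series of weight \<open>0\<close> are its first integrals, and the fields commuting with it are
those whose \<open>i\<close>-th component has weight \<open>lam $ i\<close>; these are the fields called resonant.\<close>

definition has_weight :: "complex ^ 'n \<Rightarrow> complex \<Rightarrow> (complex, 'n::finite) mfps \<Rightarrow> bool"
  where "has_weight lam \<alpha> f \<longleftrightarrow> (\<forall>P. mfps_nth f P \<noteq> 0 \<longrightarrow> pairing (intv P) lam = \<alpha>)"

definition resonant :: "complex ^ 'n \<Rightarrow> 'n::finite fvf \<Rightarrow> bool"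
  where "resonant lam w \<longleftrightarrow> (\<forall>i. has_weight lam (lam $ i) (w $ i))"

lemma has_weight_1 [simp]: "has_weight lam 0 1"
  by (auto simp: has_weight_def one_mfps.rep_eq split: if_splits)

lemma has_weight_diff:
  assumes "has_weight lam \<alpha> f" "has_weight lam \<alpha> g" shows "has_weight lam \<alpha> (f - g)"
  unfolding has_weight_def
proof (intro allI impI)
  fix P assume "mfps_nth (f - g) P \<noteq> 0"
  then have "mfps_nth f P \<noteq> 0 \<or> mfps_nth g P \<noteq> 0" by auto
  then show "pairing (intv P) lam = \<alpha>" using assms by (auto simp: has_weight_def)
qed

lemma has_weight_sum: "(\<And>i. i \<in> A \<Longrightarrow> has_weight lam \<alpha> (f i)) \<Longrightarrow> has_weight lam \<alpha> (\<Sum>i\<in>A. f i)"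
  unfolding has_weight_def mfps_nth_sum by (meson sum.not_neutral_contains_not_neutral)

lemma has_weight_mult:
  assumes "has_weight lam \<alpha> f" "has_weight lam \<beta> g" "\<gamma> = \<alpha> + \<beta>"
  shows "has_weight lam \<gamma> (f * g)"
  unfolding has_weight_def
proof (intro allI impI)
  fix P assume "mfps_nth (f * g) P \<noteq> 0"
  then obtain Q R where "Q + R = P" "mfps_nth f Q * mfps_nth g R \<noteq> 0"
    unfolding mfps_nth_mult by (auto elim!: sum.not_neutral_contains_not_neutral)
  then show "pairing (intv P) lam = \<gamma>"
    using assms by (auto simp: has_weight_def intv_add pairing_add)
qed

lemma has_weight_power:
  "has_weight lam \<alpha> f \<Longrightarrow> has_weight lam (of_nat n * \<alpha>) (f ^ n)"
proof (induction n)
  case (Suc n)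
  show ?case
    using has_weight_mult[OF Suc.prems Suc.IH[OF Suc.prems] refl] by (simp add: algebra_simps)
qed simp

lemma has_weight_prod:
  "(\<And>i. i \<in> A \<Longrightarrow> has_weight lam (\<alpha> i) (f i)) \<Longrightarrow> has_weight lam (sum \<alpha> A) (prod f A)"
  by (induction A rule: infinite_finite_induct) (auto intro: has_weight_mult)

lemma has_weight_compose:
  assumes f: "has_weight lam \<alpha> f" and T: "resonant lam T"
  shows "has_weight lam \<alpha> (mfps_compose f T)"
  unfolding has_weight_def
proof (intro allI impI)
  fix P assume "mfps_nth (mfps_compose f T) P \<noteq> 0"
  then obtain Q where Q: "mfps_nth f Q \<noteq> 0" "mfps_nth (mmonom T Q) P \<noteq> 0"
    unfolding mfps_compose_def mmonom_def[symmetric]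
    by (auto elim!: sum.not_neutral_contains_not_neutral)
  have "has_weight lam (\<Sum>k\<in>UNIV. of_nat (Q $ k) * lam $ k) (mmonom T Q)"
    unfolding mmonom_def using T by (intro has_weight_prod has_weight_power) (simp add: resonant_def)
  then have "pairing (intv P) lam = (\<Sum>k\<in>UNIV. of_nat (Q $ k) * lam $ k)"
    using Q(2) by (simp add: has_weight_def)
  also have "\<dots> = pairing (intv Q) lam"
    by (simp add: pairing_def intv_def)
  finally show "pairing (intv P) lam = \<alpha>"
    using f Q(1) by (simp add: has_weight_def)
qed

lemma has_weight_deriv:
  assumes "has_weight lam \<alpha> f" shows "has_weight lam (\<alpha> - lam $ k) (mfps_deriv k f)"
  unfolding has_weight_def
proof (intro allI impI)
  fix P assume "mfps_nth (mfps_deriv k f) P \<noteq> 0"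
  then have "mfps_nth f (P + axis k 1) \<noteq> 0" by (auto simp: mfps_nth_deriv)
  then have "pairing (intv (P + axis k 1)) lam = \<alpha>" using assms by (simp add: has_weight_def)
  then show "pairing (intv P) lam = \<alpha> - lam $ k" by (simp add: intv_add pairing_add eq_diff_eq)
qed

lemma has_weight_dird:
  assumes "has_weight lam \<alpha> f" "resonant lam w" shows "has_weight lam \<alpha> (dird f w)"
  unfolding dird_def using assms
  by (intro has_weight_sum has_weight_mult[OF has_weight_deriv]) (auto simp: resonant_def)

text \<open>The coefficient of \<open>x\<^sup>P\<close> in the \<open>i\<close>-th component of a field has the index \<open>P - axis i 1\<close>, whereas in a scalar
series it has the index \<open>P\<close>. The shift \<open>a\<close> covers both cases.\<close>

definition smult_by :: "int ^ 'n \<Rightarrow> (int ^ 'n \<Rightarrow> complex) \<Rightarrow>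
    (complex, 'n::finite) mfps \<Rightarrow> (complex, 'n) mfps"
  where "smult_by a m f = Abs_mfps (\<lambda>P. m (intv P - a) * mfps_nth f P)"

definition vmult_by :: "(int ^ 'n \<Rightarrow> complex) \<Rightarrow> 'n::finite fvf \<Rightarrow> 'n fvf"
  where "vmult_by m w = (\<chi> i. smult_by (axis i 1) m (w $ i))"

lemma mfps_nth_smult_by [simp]: "mfps_nth (smult_by a m f) P = m (intv P - a) * mfps_nth f P"
  by (simp add: smult_by_def)

lemma vmult_by_nth [simp]: "vmult_by m w $ i = smult_by (axis i 1) m (w $ i)"
  by (simp add: vmult_by_def)

lemma smult_by_add: "smult_by a m (f + g) = smult_by a m f + smult_by a m g"
  by (rule mfps_eqI) (simp add: algebra_simps)

lemma smult_by_diff: "smult_by a m (f - g) = smult_by a m f - smult_by a m g"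
  by (rule mfps_eqI) (simp add: algebra_simps)

lemma smult_by_sum: "smult_by a m (\<Sum>i\<in>A. f i) = (\<Sum>i\<in>A. smult_by a m (f i))"
  by (rule mfps_eqI) (simp add: mfps_nth_sum sum_distrib_left)

lemma smult_by_comp: "smult_by a m (smult_by a m' f) = smult_by a (\<lambda>Q. m Q * m' Q) f"
  by (rule mfps_eqI) simp

lemma smult_by_const_mult: "smult_by a m (mfps_const c * f) = mfps_const c * smult_by a m f"
  by (rule mfps_eqI) simp

lemma ord_ge_smult_by: "ord_ge d f \<Longrightarrow> ord_ge d (smult_by a m f)"
  by (simp add: ord_ge_def)

lemma vord_ge_vmult_by: "vord_ge d w \<Longrightarrow> vord_ge d (vmult_by m w)"
  by (simp add: vord_ge_def ord_ge_smult_by)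

lemma vmult_by_diff: "vmult_by m (v - w) = vmult_by m v - vmult_by m w"
  by (simp add: vec_eq_iff smult_by_diff)

text \<open>Multiplication by a factor that only shifts indices in directions along which the symbol \<open>m\<close> is
constant commutes with the multiplier.\<close>

lemma smult_by_mult:
  assumes "\<And>Q R. mfps_nth f Q \<noteq> 0 \<Longrightarrow> m (intv (Q + R) - a) = m (intv R - b)"
  shows "smult_by a m (f * g) = f * smult_by b m g"
proof (rule mfps_eqI)
  fix P
  show "mfps_nth (smult_by a m (f * g)) P = mfps_nth (f * smult_by b m g) P"
    unfolding mfps_nth_smult_by mfps_nth_mult sum_distrib_left
  proof (rule sum.cong, simp, safe)
    fix Q R :: "nat ^ 'a" assume "P = Q + R"
    then show "m (intv (Q + R) - a) * (mfps_nth f Q * mfps_nth g R) =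
        mfps_nth f Q * (m (intv R - b) * mfps_nth g R)"
      using assms[of Q R] by (cases "mfps_nth f Q = 0") auto
  qed
qed

lemma smult_by_var_mult: "smult_by (axis i 1) m (mfps_var i * f) = mfps_var i * smult_by 0 m f"
  by (rule smult_by_mult) (auto simp: mfps_nth_var intv_add split: if_splits)

text \<open>Symbols that do not change under shifts by indices of first integrals. Those depending on
\<open>pairing Q lam\<close> only are of this kind, and under the hull condition so are
\<open>pairing Q (L j)\<close> and its quotient by \<open>pairing Q lam\<close>.\<close>

definition invariant_multiplier :: "complex ^ 'n \<Rightarrow> (int ^ 'n::finite \<Rightarrow> complex) \<Rightarrow> bool"
  where "invariant_multiplier lam m \<longleftrightarrow> (\<forall>Q\<in>M_plus lam. \<forall>R. m (Q + R) = m R)"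

lemma has_weight_0_M_plus: "has_weight lam 0 g \<Longrightarrow> mfps_nth g Q \<noteq> 0 \<Longrightarrow> intv Q \<in> M_plus lam"
  by (simp add: has_weight_def M_plus_def intv_def)

lemma smult_by_scale:
  assumes "has_weight lam 0 g" "invariant_multiplier lam m"
  shows "smult_by a m (g * f) = g * smult_by a m f"
proof (rule smult_by_mult)
  fix Q R assume "mfps_nth g Q \<noteq> 0"
  then have "m (intv Q + (intv R - a)) = m (intv R - a)"
    using assms by (auto simp: invariant_multiplier_def dest: has_weight_0_M_plus)
  then show "m (intv (Q + R) - a) = m (intv R - a)" by (simp add: intv_add algebra_simps)
qed

lemma smult_by_dird:
  assumes "has_weight lam 0 g" "invariant_multiplier lam m"
  shows "smult_by 0 m (dird g w) = dird g (vmult_by m w)"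
  unfolding dird_def smult_by_sum vmult_by_nth
proof (intro sum.cong refl smult_by_mult)
  fix k Q R assume "mfps_nth (mfps_deriv k g) Q \<noteq> 0"
  then have "intv (Q + axis k 1) \<in> M_plus lam"
    by (intro has_weight_0_M_plus[OF assms(1)]) (auto simp: mfps_nth_deriv)
  then have "m (intv (Q + axis k 1) + (intv R - axis k 1)) = m (intv R - axis k 1)"
    using assms(2) by (auto simp: invariant_multiplier_def)
  then show "m (intv (Q + R) - 0) = m (intv R - axis k 1)" by (simp add: intv_add algebra_simps)
qed

text \<open>Euler's formula.\<close>

lemma dird_diag: "dird f (fvf_diag v) = smult_by 0 (\<lambda>Q. pairing Q v) f"
proof (rule mfps_eqI)
  fix P
  have "mfps_nth (mfps_deriv j f * (mfps_const (v $ j) * mfps_var j)) P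
      = v $ j * (of_nat (P $ j) * mfps_nth f P)" for j
  proof -
    have "mfps_nth (mfps_var j * mfps_deriv j f) P = of_nat (P $ j) * mfps_nth f P"
    proof (cases "P $ j = 0")
      case False
      then obtain R where "P = R + axis j 1" using obtain_minus_axis by blast
      moreover have "axis j (Suc 0) $ j = Suc 0" by (simp add: axis_def)
      ultimately show ?thesis by (simp add: mfps_nth_deriv)
    qed (simp add: mfps_nth_var_mult)
    then have "mfps_nth (mfps_const (v $ j) * (mfps_var j * mfps_deriv j f)) P
        = v $ j * (of_nat (P $ j) * mfps_nth f P)" by simp
    then show ?thesis by (simp only: ac_simps)
  qed
  then show "mfps_nth (dird f (fvf_diag v)) P = mfps_nth (smult_by 0 (\<lambda>Q. pairing Q v) f) P"
    by (simp add: dird_def mfps_nth_sum pairing_def intv_def sum_distrib_left ac_simps)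
qed

lemma lie_diag:
  "dird f (fvf_diag v) - mfps_const (v $ i) * f = smult_by (axis i 1) (\<lambda>Q. pairing Q v) f"
  by (rule mfps_eqI) (simp add: dird_diag pairing_diff left_diff_distrib)

section \<open>The distinguished normal form\<close>

definition nonres :: "complex ^ 'n::finite \<Rightarrow> int ^ 'n \<Rightarrow> complex"
  where "nonres lam Q = (if pairing Q lam = 0 then 0 else 1)"

definition res :: "complex ^ 'n::finite \<Rightarrow> int ^ 'n \<Rightarrow> complex"
  where "res lam Q = (if pairing Q lam = 0 then 1 else 0)"

lemma resonant_vmult_by_res: "resonant lam (vmult_by (res lam) w)"
  by (auto simp: resonant_def has_weight_def res_def pairing_diff)

lemma res_add_nonres: "smult_by a (res lam) f + smult_by a (nonres lam) f = f"
  by (rule mfps_eqI) (simp add: res_def nonres_def)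

text \<open>With \<open>Z = h + r\<close>, where \<open>h\<close> is the nonresonant and \<open>r\<close> the resonant part, a single unknown series
suffices. The conjugacy equation reads \<open>r + \<Lambda> h = X (x + h) - Dh r\<close>, where \<open>\<Lambda>\<close> multiplies by
\<open>pairing Q lam\<close>. Dividing by this number at the nonresonant indices gives a fixed point equation for a
contraction: \<open>X\<close>, \<open>h\<close> and \<open>r\<close> have order two, so the right-hand side raises the order of differences.\<close>

lemma distinguished_normal_form:
  fixes X :: "'n::finite fvf"
  assumes X: "vord_ge 2 X"
  obtains h r where "vord_ge 2 h" "vord_ge 2 r" "vmult_by (res lam) h = 0" "resonant lam r"
    "\<And>i. dird ((idf + h) $ i) (fvf_diag lam + r) = mfps_compose ((fvf_diag lam + X) $ i) (idf + h)"
proof -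
  define \<kappa> where "\<kappa> Q = (if pairing Q lam = 0 then 1 else pairing Q lam)" for Q :: "int ^ 'n"
  have \<kappa>0: "\<kappa> Q \<noteq> 0" for Q by (simp add: \<kappa>_def)
  define n where "n Z = vmult_by (nonres lam) Z" for Z :: "'n fvf"
  define r where "r Z = vmult_by (res lam) Z" for Z :: "'n fvf"
  define \<Psi> where "\<Psi> Z = (\<chi> i. mfps_compose (X $ i) (idf + n Z) - dird (n Z $ i) (r Z))" for Z
  define \<Phi> where "\<Phi> Z = vmult_by (\<lambda>Q. 1 / \<kappa> Q) (\<Psi> Z)" for Z
  have nr: "vord_ge d (n Z)" "vord_ge d (r Z)" if "vord_ge d Z" for d Z
    using that by (simp_all add: n_def r_def vord_ge_vmult_by)
  have inv: "vord_ge 2 (\<Phi> Z)" if Z: "vord_ge 2 Z" for Z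
  proof -
    have "vord_ge (Suc 0) (idf + n Z)" using nr(1)[OF Z] by (rule vord_ge_idf_add)
    then have "ord_ge 2 (\<Psi> Z $ i)" for i
      unfolding \<Psi>_def vec_lambda_beta
      by (intro ord_ge_diff ord_ge_compose ord_ge_dird_right vord_geD[OF X] nr Z)
    then have "vord_ge 2 (\<Psi> Z)" by (simp add: vord_ge_def)
    then show ?thesis by (simp add: \<Phi>_def vord_ge_vmult_by)
  qed
  have contr: "vord_ge (Suc d) (\<Phi> Z - \<Phi> Y)"
    if Z: "vord_ge 2 Z" and Y: "vord_ge 2 Y" and d: "d \<ge> 2" and ZY: "vord_ge d (Z - Y)" for Z Y d
  proof -
    have n: "vord_ge d (n Z - n Y)" and r: "vord_ge d (r Z - r Y)"
      using ZY by (simp_all add: n_def r_def vord_ge_vmult_by flip: vmult_by_diff)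
    have "ord_ge (Suc d) (\<Psi> Z $ i - \<Psi> Y $ i)" for i
    proof -
      have X': "ord_ge (Suc 1) (X $ i)" using vord_geD[OF X, of i] by (simp add: numeral_2_eq_2)
      have "ord_ge (d + 1) (mfps_compose (X $ i) (idf + n Z) - mfps_compose (X $ i) (idf + n Y))"
        using d n by (intro compose_cong[OF vord_ge_idf_add[OF nr(1)[OF Y]] _ _ X']) simp_all
      moreover have "ord_ge (Suc d) (dird (n Z $ i - n Y $ i) (r Z))"
        using ord_ge_dird[OF vord_geD[OF n, of i] nr(2)[OF Z]] d by simp
      moreover have "ord_ge (Suc d) (dird (n Y $ i) (r Z - r Y))"
        using ord_ge_dird[OF vord_geD[OF nr(1)[OF Y], of i] r] by simp
      moreover have "\<Psi> Z $ i - \<Psi> Y $ i =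
          (mfps_compose (X $ i) (idf + n Z) - mfps_compose (X $ i) (idf + n Y))
          - dird (n Z $ i - n Y $ i) (r Z) - dird (n Y $ i) (r Z - r Y)"
        by (simp add: \<Psi>_def dird_diff_left dird_diff_right)
      ultimately show ?thesis by (simp add: ord_ge_diff)
    qed
    then have "vord_ge (Suc d) (\<Psi> Z - \<Psi> Y)" by (simp add: vord_ge_def)
    then show ?thesis by (simp add: \<Phi>_def vord_ge_vmult_by flip: vmult_by_diff)
  qed
  obtain Z where Z: "vord_ge 2 Z" "\<Phi> Z = Z"
    using contraction_fixpoint[of 2 \<Phi>, OF inv contr] by blast
  have key: "\<Psi> Z $ i = smult_by (axis i 1) \<kappa> (Z $ i)" for i
    by (subst Z(2)[symmetric]) (simp add: \<Phi>_def smult_by_comp \<kappa>0 mfps_eqI)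
  have split: "smult_by (axis i 1) \<kappa> (Z $ i) =
      r Z $ i + smult_by (axis i 1) (\<lambda>Q. pairing Q lam) (n Z $ i)" for i
    by (rule mfps_eqI) (simp add: \<kappa>_def r_def n_def res_def nonres_def)
  show ?thesis
  proof
    show "vord_ge 2 (n Z)" "vord_ge 2 (r Z)" using nr Z(1) by auto
    show "vmult_by (res lam) (n Z) = 0"
      by (simp add: vec_eq_iff n_def smult_by_comp) (auto intro!: mfps_eqI simp: res_def nonres_def)
    show "resonant lam (r Z)" by (simp add: r_def resonant_vmult_by_res)
    fix i
    have H: "vord_ge (Suc 0) (idf + n Z)" by (intro vord_ge_idf_add nr Z)
    have "r Z $ i + (dird (n Z $ i) (fvf_diag lam) - mfps_const (lam $ i) * n Z $ i) =
        mfps_compose (X $ i) (idf + n Z) - dird (n Z $ i) (r Z)"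
      using key[of i] unfolding split lie_diag by (simp add: \<Psi>_def)
    then have "mfps_compose (X $ i) (idf + n Z) =
        r Z $ i + (dird (n Z $ i) (fvf_diag lam) - mfps_const (lam $ i) * n Z $ i)
        + dird (n Z $ i) (r Z)" by (simp add: algebra_simps)
    then show "dird ((idf + n Z) $ i) (fvf_diag lam + r Z) =
        mfps_compose ((fvf_diag lam + X) $ i) (idf + n Z)"
      using H by (simp add: compose_add compose_mult dird_add_left dird_add_right algebra_simps)
  qed
qed

section \<open>Invariance of the special form\<close>

text \<open>The Jacobian of a transformation is the identity plus terms of positive order, hence it can be
cancelled: a solution \<open>\<delta>\<close> has arbitrarily high order.\<close>

lemma unipotent_cancel:
  fixes \<delta> :: "('a::comm_ring_1, 'n::finite) mfps ^ 'n" and M :: "'n \<Rightarrow> 'n \<Rightarrow> ('a, 'n) mfps"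
  assumes M: "\<And>i k. ord_ge (Suc 0) (M i k)" and \<delta>: "\<And>i. \<delta> $ i = (\<Sum>k\<in>UNIV. M i k * \<delta> $ k)"
  shows "\<delta> = 0"
proof (rule vord_ge_eq0)
  fix d show "vord_ge d \<delta>"
  proof (induction d)
    case (Suc d)
    have "ord_ge (Suc d) (\<delta> $ i)" for i
    proof -
      have "ord_ge (Suc 0 + d) (\<Sum>k\<in>UNIV. M i k * \<delta> $ k)"
        by (intro ord_ge_sum ord_ge_mult M vord_geD[OF Suc])
      then show ?thesis by (simp only: \<delta>[of i, symmetric] add_Suc add_0)
    qed
    then show ?case by (simp add: vord_ge_def)
  qed simp
qed

lemma dird_unipotent_cancel:
  assumes t: "vord_ge 2 t" and "\<And>i. dird ((idf + t) $ i) v = dird ((idf + t) $ i) w"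
  shows "v = w"
proof -
  have "v - w = 0"
  proof (rule unipotent_cancel[where M = "\<lambda>i k. - mfps_deriv k (t $ i)"])
    show "ord_ge (Suc 0) (- mfps_deriv k (t $ i))" for i k
      using vord_geD[OF t, of i] by (intro ord_ge_uminus ord_ge_deriv') (simp add: numeral_2_eq_2)
    show "(v - w) $ i = (\<Sum>k\<in>UNIV. - mfps_deriv k (t $ i) * (v - w) $ k)" for i
    proof -
      have "dird ((idf + t) $ i) (v - w) = 0" by (simp only: dird_diff_right assms(2) diff_self)
      then have "(v - w) $ i + dird (t $ i) (v - w) = 0" by (simp add: dird_add_left)
      then have "(v - w) $ i = - dird (t $ i) (v - w)" by (simp only: eq_neg_iff_add_eq_0)
      then show ?thesis by (simp only: dird_def sum_negf mult_minus_left)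
    qed
  qed
  then show ?thesis by simp
qed

text \<open>The shape that Condition AS prescribes for a normal form: a combination of the diagonal fields of the
\<open>L j\<close> with scalar series as coefficients.\<close>

definition special_field :: "nat \<Rightarrow> (nat \<Rightarrow> complex ^ 'n) \<Rightarrow>
    (nat \<Rightarrow> (complex, 'n::finite) mfps) \<Rightarrow> 'n fvf"
  where "special_field p L g = (\<chi> i. \<Sum>j=1..p. g j * fvf_diag (L j) $ i)"

lemma dird_special_field:
  "dird f (special_field p L g) = (\<Sum>j=1..p. g j * dird f (fvf_diag (L j)))"
proof -
  have "special_field p L g = (\<Sum>j=1..p. (\<chi> i. g j * fvf_diag (L j) $ i))"
    by (simp add: vec_eq_iff special_field_def)
  then show ?thesis by (simp only: dird_sum_right dird_scale_right)
qed

text \<open>Let \<open>T\<close> be determined by \<open>idf + h = (idf + h0) \<circ> T\<close>; it conjugates the two normal forms. Comparing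
the two sides degree by degree, the lowest nonresonant part of \<open>T\<close> would be annihilated by the
homological operator, which is injective there; so \<open>T\<close> is resonant and commutes with the diagonal
field of \<open>lam\<close>. Resonance for \<open>lam\<close> implies resonance for each \<open>L j\<close>, so \<open>T\<close> commutes with these fields
too, and it transforms the special form by composing the coefficients \<open>g0 j\<close> with \<open>T\<close>.\<close>

lemma special_field_invariance:
  fixes Fs X h h0 r r0 :: "'n::finite fvf"
  assumes Fs: "Fs = fvf_diag lam + X" and X: "vord_ge 2 X"
    and h0: "vord_ge 2 h0" and h: "vord_ge 2 h"
    and r0: "vord_ge 2 r0" "resonant lam r0" and r: "vord_ge 2 r" "resonant lam r"
    and eq0: "\<And>i. dird ((idf + h0) $ i) (fvf_diag lam + r0) = mfps_compose (Fs $ i) (idf + h0)"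
    and eq: "\<And>i. dird ((idf + h) $ i) (fvf_diag lam + r) = mfps_compose (Fs $ i) (idf + h)"
    and L: "\<And>j Q. j \<in> {1..p} \<Longrightarrow> Q \<in> N_all \<Longrightarrow> pairing Q lam = 0 \<Longrightarrow> pairing Q (L j) = 0"
    and g0: "fvf_diag lam + r0 = special_field p L g0" "\<And>j. has_weight lam 0 (g0 j)"
  obtains g where "fvf_diag lam + r = special_field p L g" "\<And>j. has_weight lam 0 (g j)"
proof -
  have H0: "vord_ge (Suc 0) (idf + h0)" using h0 by (rule vord_ge_idf_add)
  obtain t where t: "vord_ge 2 t" "h - (\<chi> k. mfps_compose (h0 $ k) (idf + t)) = t"
  proof (rule contraction_fixpoint[of 2 "\<lambda>t. h - (\<chi> k. mfps_compose (h0 $ k) (idf + t))"])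
    fix t :: "'n fvf" assume "vord_ge 2 t"
    then show "vord_ge 2 (h - (\<chi> k. mfps_compose (h0 $ k) (idf + t)))"
      by (intro vord_ge_diff h vord_ge_compose h0 vord_ge_idf_add)
  next
    fix t s :: "'n fvf" and d assume ts: "vord_ge 2 t" "vord_ge 2 s" "2 \<le> d" "vord_ge d (t - s)"
    have "ord_ge (d + 1) (mfps_compose (h0 $ k) (idf + s) - mfps_compose (h0 $ k) (idf + t))" for k
      using ts vord_geD[OF h0, of k]
      by (intro compose_cong vord_ge_idf_add) (simp_all add: numeral_2_eq_2 vord_ge_commute)
    then show "vord_ge (Suc d) (h - (\<chi> k. mfps_compose (h0 $ k) (idf + t))
        - (h - (\<chi> k. mfps_compose (h0 $ k) (idf + s))))"
      by (simp add: vord_ge_def)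
  qed
  define T where "T = idf + t"
  have T: "vord_ge (Suc 0) T" unfolding T_def using t(1) by (rule vord_ge_idf_add)
  have "mfps_compose ((idf + h0) $ k) T = (idf + h) $ k" for k
  proof -
    have "t $ k = h $ k - mfps_compose (h0 $ k) T"
      by (subst t(2)[symmetric]) (simp add: T_def)
    then show ?thesis using T by (simp add: compose_add) (simp add: T_def)
  qed
  then have HT: "(\<chi> k. mfps_compose ((idf + h0) $ k) T) = idf + h" by (simp add: vec_eq_iff)
  define G where "G = fvf_diag lam + r"
  define G0 where "G0 = fvf_diag lam + r0"
  \<comment> \<open>the defect of \<open>T\<close> as a conjugacy between the two normal forms\<close>
  define \<delta> where "\<delta> = (\<chi> k. dird (T $ k) G - mfps_compose (G0 $ k) T)"
  have "\<delta> = 0"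
  proof (rule unipotent_cancel[where M = "\<lambda>i k. - mfps_compose (mfps_deriv k (h0 $ i)) T"])
    show "ord_ge (Suc 0) (- mfps_compose (mfps_deriv k (h0 $ i)) T)" for i k
      using vord_geD[OF h0, of i]
      by (intro ord_ge_uminus ord_ge_compose T ord_ge_deriv') (simp add: numeral_2_eq_2)
    fix i
    let ?H0 = "(idf + h0) $ i"
    have "(\<Sum>k\<in>UNIV. mfps_compose (mfps_deriv k ?H0) T * dird (T $ k) G) = dird (mfps_compose ?H0 T) G"
      by (simp add: dird_compose[OF T])
    also have "\<dots> = mfps_compose (Fs $ i) (idf + h)"
      using eq[of i] HT by (simp add: G_def vec_eq_iff)
    also have "\<dots> = mfps_compose (dird ?H0 G0) T"
      unfolding G0_def eq0 HT[symmetric] compose_assoc[OF H0 T] ..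
    also have "\<dots> = (\<Sum>k\<in>UNIV. mfps_compose (mfps_deriv k ?H0) T * mfps_compose (G0 $ k) T)"
      by (simp add: dird_def compose_sum compose_mult[OF T])
    finally have "(\<Sum>k\<in>UNIV. mfps_compose (mfps_deriv k ?H0) T * \<delta> $ k) = 0"
      by (simp add: \<delta>_def right_diff_distrib sum_subtractf)
    moreover have "mfps_compose (mfps_deriv k ?H0) T * \<delta> $ k =
        (if k = i then \<delta> $ i else 0) + mfps_compose (mfps_deriv k (h0 $ i)) T * \<delta> $ k" for k
      by (simp add: mfps_deriv_add mfps_deriv_var compose_add algebra_simps)
    ultimately have "\<delta> $ i + (\<Sum>k\<in>UNIV. mfps_compose (mfps_deriv k (h0 $ i)) T * \<delta> $ k) = 0"
      by (simp add: sum.distrib)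
    then have "\<delta> $ i = - (\<Sum>k\<in>UNIV. mfps_compose (mfps_deriv k (h0 $ i)) T * \<delta> $ k)"
      by (simp only: eq_neg_iff_add_eq_0)
    then show "\<delta> $ i = (\<Sum>k\<in>UNIV. - mfps_compose (mfps_deriv k (h0 $ i)) T * \<delta> $ k)"
      by (simp only: sum_negf mult_minus_left)
  qed
  then have conj: "dird (T $ i) G = mfps_compose (G0 $ i) T" for i
    by (simp add: \<delta>_def vec_eq_iff)
  define Tn where "Tn = vmult_by (nonres lam) T"
  define Tr where "Tr = vmult_by (res lam) T"
  have TnT: "T = Tr + Tn" by (simp add: vec_eq_iff Tr_def Tn_def res_add_nonres)
  have Tr: "vord_ge (Suc 0) Tr" "resonant lam Tr"
    using T by (simp_all add: Tr_def vord_ge_vmult_by resonant_vmult_by_res)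
  have Tn: "vord_ge (Suc d) Tn" for d
  proof (induction d)
    case 0
    then show ?case using T by (simp add: Tn_def vord_ge_vmult_by)
  next
    case (Suc d)
    show ?case unfolding vord_ge_def ord_ge_def
    proof (intro allI impI)
      fix i and P :: "nat ^ 'n" assume P: "mdegree P < Suc (Suc d)"
      \<comment> \<open>the nonlinear terms with \<open>T\<close> replaced by its resonant part; the
        replacement is invisible in the degrees considered\<close>
      define S where "S = mfps_compose (r0 $ i) Tr - dird (Tr $ i) r"
      have 1: "ord_ge (Suc d + 1) (mfps_compose (r0 $ i) T - mfps_compose (r0 $ i) Tr)"
        using Suc vord_geD[OF r0(1), of i]
        by (intro compose_cong Tr) (simp_all add: TnT numeral_2_eq_2)
      have 2: "ord_ge (Suc d + 1) (dird (Tn $ i) r)"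
        using ord_ge_dird[OF vord_geD[OF Suc, of i] r(1)] by simp
      have "smult_by (axis i 1) (\<lambda>Q. pairing Q lam) (T $ i) =
          mfps_compose (r0 $ i) T - dird (T $ i) r"
        using conj[of i] T by (simp add: G_def G0_def dird_add_right compose_add compose_mult algebra_simps
            flip: lie_diag)
      also have "dird (T $ i) r = dird (Tr $ i) r + dird (Tn $ i) r"
        by (simp add: TnT dird_add_left)
      finally have "smult_by (axis i 1) (\<lambda>Q. pairing Q lam) (T $ i) - S =
          (mfps_compose (r0 $ i) T - mfps_compose (r0 $ i) Tr) - dird (Tn $ i) r"
        by (simp add: S_def algebra_simps)
      then have "ord_ge (Suc d + 1) (smult_by (axis i 1) (\<lambda>Q. pairing Q lam) (T $ i) - S)"
        using 1 2 by (simp add: ord_ge_diff)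
      from ord_ge_nth_eq[OF this, of P]
      have *: "pairing (intv P - axis i 1) lam * mfps_nth (T $ i) P = mfps_nth S P"
        using P by simp
      have "has_weight lam (lam $ i) S"
        using r0(2) r(2) Tr(2) unfolding S_def
        by (intro has_weight_diff has_weight_compose has_weight_dird) (auto simp: resonant_def)
      then show "mfps_nth (Tn $ i) P = 0"
        using * by (cases "mfps_nth S P = 0")
          (auto simp: Tn_def nonres_def has_weight_def pairing_diff)
    qed
  qed
  have "Tn = 0"
  proof (rule vord_ge_eq0)
    show "vord_ge d Tn" for d using Tn[of d] by (rule vord_ge_mono) simp
  qed
  then have Tres: "resonant lam T" using TnT Tr(2) by simp
  have comm: "dird (T $ i) (fvf_diag (L j)) = mfps_const (L j $ i) * T $ i" if j: "j \<in> {1..p}" for i j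
  proof -
    have "smult_by (axis i 1) (\<lambda>Q. pairing Q (L j)) (T $ i) = 0"
    proof (rule mfps_eqI)
      fix P
      show "mfps_nth (smult_by (axis i 1) (\<lambda>Q. pairing Q (L j)) (T $ i)) P = mfps_nth 0 P"
      proof (cases "mfps_nth (T $ i) P = 0")
        case False
        then have "pairing (intv P - axis i 1) lam = 0"
          using Tres by (simp add: resonant_def has_weight_def pairing_diff)
        then show ?thesis using L[OF j intv_minus_axis_in_N] by simp
      qed simp
    qed
    then show ?thesis unfolding lie_diag[symmetric] by simp
  qed
  show ?thesis
  proof
    show "has_weight lam 0 (mfps_compose (g0 j) T)" for j
      using g0(2) Tres by (rule has_weight_compose)
    have "G = special_field p L (\<lambda>j. mfps_compose (g0 j) T)"
    proof (rule dird_unipotent_cancel[OF t(1)], fold T_def)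
      fix i
      have "dird (T $ i) (special_field p L (\<lambda>j. mfps_compose (g0 j) T)) =
          (\<Sum>j=1..p. mfps_compose (g0 j) T * (mfps_const (L j $ i) * T $ i))"
        unfolding dird_special_field by (rule sum.cong) (simp_all add: comm)
      also have "\<dots> = mfps_compose (G0 $ i) T"
        by (simp add: G0_def g0(1) special_field_def compose_sum compose_mult[OF T] compose_var[OF T])
      finally show "dird (T $ i) G = dird (T $ i) (special_field p L (\<lambda>j. mfps_compose (g0 j) T))"
        by (simp add: conj)
    qed
    then show "fvf_diag lam + r = special_field p L (\<lambda>j. mfps_compose (g0 j) T)" by (simp add: G_def)
  qed
qed

section \<open>Truncated norms\<close>

text \<open>Coefficient norms on a polydisc of radius \<open>\<rho>\<close>, cut off at degree \<open>d\<close>. The cut-off makes them finite for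
every formal series, so that estimates can precede any knowledge of convergence; it respects
products, since a coefficient of a product involves lower degrees only. The variant \<open>dnorm\<close> is the norm
of the Euler derivative; divided by \<open>\<rho>\<close> it controls the gradient norm \<open>gnorm\<close>.\<close>

definition tnorm :: "real \<Rightarrow> nat \<Rightarrow> (complex, 'n::finite) mfps \<Rightarrow> real"
  where "tnorm \<rho> d f = (\<Sum>P | mdegree P \<le> d. cmod (mfps_nth f P) * \<rho> ^ mdegree P)"

definition vtnorm :: "real \<Rightarrow> nat \<Rightarrow> 'n::finite fvf \<Rightarrow> real"
  where "vtnorm \<rho> d w = (\<Sum>i\<in>UNIV. tnorm \<rho> d (w $ i))"

definition gnorm :: "real \<Rightarrow> nat \<Rightarrow> (complex, 'n::finite) mfps \<Rightarrow> real"
  where "gnorm \<rho> d f = (\<Sum>j\<in>UNIV. tnorm \<rho> d (mfps_deriv j f))"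

definition dnorm :: "real \<Rightarrow> nat \<Rightarrow> (complex, 'n::finite) mfps \<Rightarrow> real"
  where "dnorm \<rho> d f = (\<Sum>P | mdegree P \<le> d. real (mdegree P) * (cmod (mfps_nth f P) * \<rho> ^ mdegree P))"

lemma tnorm_nonneg [simp]: "0 \<le> \<rho> \<Longrightarrow> 0 \<le> tnorm \<rho> d f"
  unfolding tnorm_def by (intro sum_nonneg) simp

lemma vtnorm_nonneg [simp]: "0 \<le> \<rho> \<Longrightarrow> 0 \<le> vtnorm \<rho> d w"
  unfolding vtnorm_def by (intro sum_nonneg) simp

lemma gnorm_nonneg [simp]: "0 \<le> \<rho> \<Longrightarrow> 0 \<le> gnorm \<rho> d f"
  unfolding gnorm_def by (intro sum_nonneg) simp

lemma tnorm_0 [simp]: "tnorm \<rho> d 0 = 0"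
  by (simp add: tnorm_def)

lemma tnorm_add_le: "0 \<le> \<rho> \<Longrightarrow> tnorm \<rho> d (f + g) \<le> tnorm \<rho> d f + tnorm \<rho> d g"
  unfolding tnorm_def sum.distrib[symmetric]
  by (intro sum_mono) (simp add: norm_triangle_ineq mult_right_mono flip: distrib_right)

lemma tnorm_uminus [simp]: "tnorm \<rho> d (- f) = tnorm \<rho> d f"
  by (simp add: tnorm_def)

lemma tnorm_diff_le: "0 \<le> \<rho> \<Longrightarrow> tnorm \<rho> d (f - g) \<le> tnorm \<rho> d f + tnorm \<rho> d g"
  using tnorm_add_le[of \<rho> d f "- g"] by simp

lemma tnorm_sum_le: "0 \<le> \<rho> \<Longrightarrow> tnorm \<rho> d (\<Sum>i\<in>A. f i) \<le> (\<Sum>i\<in>A. tnorm \<rho> d (f i))"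
  by (induction A rule: infinite_finite_induct) (auto intro: order_trans[OF tnorm_add_le])

lemma tnorm_cong: "ord_ge (Suc d) (f - g) \<Longrightarrow> tnorm \<rho> d f = tnorm \<rho> d g"
  unfolding tnorm_def by (intro sum.cong refl) (simp add: ord_ge_nth_eq)

lemma tnorm_mult_le:
  fixes f g :: "(complex, 'n::finite) mfps"
  assumes "0 \<le> \<rho>"
  shows "tnorm \<rho> d (f * g) \<le> tnorm \<rho> d f * tnorm \<rho> d g"
proof -
  define D where "D = {Q :: nat ^ 'n. mdegree Q \<le> d}"
  have finD: "finite D" unfolding D_def by (rule finite_mdegree_le)
  define a where "a f Q = cmod (mfps_nth f Q) * \<rho> ^ mdegree Q" for f and Q :: "nat ^ 'n"
  have a0: "a f Q \<ge> 0" for f Q using assms by (simp add: a_def)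
  have "tnorm \<rho> d (f * g) \<le> (\<Sum>P\<in>D. \<Sum>p\<in>{(Q, R). Q + R = P}. a f (fst p) * a g (snd p))"
    unfolding tnorm_def D_def
  proof (rule sum_mono)
    fix P :: "nat ^ 'n"
    have "cmod (mfps_nth (f * g) P) \<le> (\<Sum>p\<in>{(Q, R). Q + R = P}. cmod (mfps_nth f (fst p) * mfps_nth g (snd p)))"
      unfolding mfps_nth_mult case_prod_unfold by (rule norm_sum)
    then have "cmod (mfps_nth (f * g) P) * \<rho> ^ mdegree P \<le>
        (\<Sum>p\<in>{(Q, R). Q + R = P}. cmod (mfps_nth f (fst p) * mfps_nth g (snd p))) * \<rho> ^ mdegree P"
      using assms by (simp add: mult_right_mono)
    also have "\<dots> = (\<Sum>p\<in>{(Q, R). Q + R = P}. a f (fst p) * a g (snd p))"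
      unfolding sum_distrib_right
      by (rule sum.cong) (auto simp: a_def norm_mult power_add)
    finally show "cmod (mfps_nth (f * g) P) * \<rho> ^ mdegree P \<le>
        (\<Sum>p\<in>{(Q, R). Q + R = P}. a f (fst p) * a g (snd p))" .
  qed
  also have "\<dots> = (\<Sum>(P, p)\<in>(SIGMA P:D. {(Q, R). Q + R = P}). a f (fst p) * a g (snd p))"
    by (rule sum.Sigma) (auto simp: finD finite_mindex_splits)
  also have "\<dots> = (\<Sum>p\<in>{(Q, R). Q + R \<in> D}. a f (fst p) * a g (snd p))"
    by (rule sum.reindex_bij_witness[where j = snd and i = "\<lambda>(Q, R). (Q + R, (Q, R))"]) auto
  also have "\<dots> \<le> (\<Sum>p\<in>D \<times> D. a f (fst p) * a g (snd p))"
    by (rule sum_mono2) (use finD a0 in \<open>auto simp: D_def\<close>)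
  also have "\<dots> = tnorm \<rho> d f * tnorm \<rho> d g"
    unfolding tnorm_def sum_product sum.cartesian_product D_def a_def
    by (simp add: case_prod_unfold)
  finally show ?thesis .
qed

lemma tnorm_const_mult: "tnorm \<rho> d (mfps_const c * f) = cmod c * tnorm \<rho> d f"
  by (simp add: tnorm_def norm_mult sum_distrib_left mult.assoc)

lemma tnorm_1 [simp]: "tnorm \<rho> d 1 = 1"
proof -
  have "tnorm \<rho> d (1 :: (complex, 'n::finite) mfps) = (\<Sum>P | mdegree (P :: nat ^ 'n) \<le> d. if P = 0 then 1 else 0)"
    unfolding tnorm_def by (rule sum.cong) (auto simp: one_mfps.rep_eq)
  then show ?thesis by (simp add: finite_mdegree_le)
qed

lemma tnorm_var_le:
  fixes i :: "'n::finite"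
  assumes "0 \<le> \<rho>" shows "tnorm \<rho> d (mfps_var i) \<le> \<rho>"
proof -
  have "tnorm \<rho> d (mfps_var i) =
      (\<Sum>P | mdegree (P :: nat ^ 'n) \<le> d. if P = axis i 1 then \<rho> else 0)"
    unfolding tnorm_def by (rule sum.cong) (auto simp: mfps_nth_var)
  then show ?thesis using assms by (simp add: finite_mdegree_le)
qed

lemma tnorm_power_le: "0 \<le> \<rho> \<Longrightarrow> tnorm \<rho> d (f ^ n) \<le> tnorm \<rho> d f ^ n"
proof (induction n)
  case (Suc n)
  then show ?case
    using tnorm_mult_le[of \<rho> d f "f ^ n"] mult_left_mono[of "tnorm \<rho> d (f ^ n)" _ "tnorm \<rho> d f"]
    by fastforce
qed simp

lemma tnorm_prod_le: "0 \<le> \<rho> \<Longrightarrow> tnorm \<rho> d (\<Prod>i\<in>A. f i) \<le> (\<Prod>i\<in>A. tnorm \<rho> d (f i))"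
proof (induction A rule: infinite_finite_induct)
  case (insert x A)
  then show ?case
    using tnorm_mult_le[of \<rho> d "f x" "prod f A"]
      mult_left_mono[of "tnorm \<rho> d (prod f A)" "\<Prod>i\<in>A. tnorm \<rho> d (f i)" "tnorm \<rho> d (f x)"]
    by simp
qed simp_all

lemma tnorm_compose_le:
  assumes \<rho>: "0 \<le> \<rho>" and H: "vord_ge (Suc 0) H" "\<And>k. tnorm \<rho> d (H $ k) \<le> \<sigma>"
  shows "tnorm \<rho> d (mfps_compose f H) \<le> tnorm \<sigma> d f"
proof -
  have mm: "tnorm \<rho> d (mmonom H Q) \<le> \<sigma> ^ mdegree Q" for Q
  proof -
    have "tnorm \<rho> d (mmonom H Q) \<le> (\<Prod>k\<in>UNIV. tnorm \<rho> d ((H $ k) ^ (Q $ k)))"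
      unfolding mmonom_def using \<rho> by (rule tnorm_prod_le)
    also have "\<dots> \<le> (\<Prod>k\<in>UNIV. \<sigma> ^ (Q $ k))"
    proof (intro prod_mono conjI)
      fix k
      have "tnorm \<rho> d (H $ k ^ Q $ k) \<le> tnorm \<rho> d (H $ k) ^ Q $ k" using \<rho> by (rule tnorm_power_le)
      also have "\<dots> \<le> \<sigma> ^ Q $ k" using \<rho> H(2) by (intro power_mono) auto
      finally show "tnorm \<rho> d (H $ k ^ Q $ k) \<le> \<sigma> ^ Q $ k" .
    qed (simp add: \<rho>)
    also have "\<dots> = \<sigma> ^ mdegree Q"
      by (simp add: mdegree_def power_sum)
    finally show ?thesis .
  qed
  have "tnorm \<rho> d (mfps_compose f H) =
      tnorm \<rho> d (\<Sum>Q | mdegree Q \<le> d. mfps_const (mfps_nth f Q) * mmonom H Q)"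
    by (rule tnorm_cong) (rule compose_partial_sum[OF H(1)])
  also have "\<dots> \<le> (\<Sum>Q | mdegree Q \<le> d. tnorm \<rho> d (mfps_const (mfps_nth f Q) * mmonom H Q))"
    using \<rho> by (rule tnorm_sum_le)
  also have "\<dots> \<le> tnorm \<sigma> d f"
    unfolding tnorm_def[of \<sigma>] tnorm_const_mult by (intro sum_mono mult_left_mono mm) simp
  finally show ?thesis .
qed

lemma tnorm_smult_by_le:
  fixes f :: "(complex, 'n::finite) mfps"
  assumes "0 \<le> \<rho>" "\<And>P. mdegree P \<le> d \<Longrightarrow> mfps_nth f P \<noteq> 0 \<Longrightarrow> cmod (m (intv P - a)) \<le> c"
  shows "tnorm \<rho> d (smult_by a m f) \<le> c * tnorm \<rho> d f"
  unfolding tnorm_def sum_distrib_left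
proof (rule sum_mono)
  fix P :: "nat ^ 'n" assume "P \<in> {P. mdegree P \<le> d}"
  then show "cmod (mfps_nth (smult_by a m f) P) * \<rho> ^ mdegree P \<le>
      c * (cmod (mfps_nth f P) * \<rho> ^ mdegree P)"
    using assms(2)[of P] assms(1)
    by (cases "mfps_nth f P = 0") (auto simp: norm_mult mult.assoc intro!: mult_right_mono)
qed

text \<open>The gain from shrinking the radius: a series of order \<open>n\<close> contracts by the \<open>n\<close>-th power. All losses,
in particular those due to small divisors and derivatives, are compensated by it.\<close>

lemma tnorm_shrink:
  fixes f :: "(complex, 'n::finite) mfps"
  assumes f: "ord_ge n f" and \<rho>: "0 \<le> \<rho>" and \<theta>: "0 \<le> \<theta>" "\<theta> \<le> 1"
  shows "tnorm (\<theta> * \<rho>) d f \<le> \<theta> ^ n * tnorm \<rho> d f"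
  unfolding tnorm_def sum_distrib_left
proof (rule sum_mono)
  fix P :: "nat ^ 'n"
  show "cmod (mfps_nth f P) * (\<theta> * \<rho>) ^ mdegree P \<le> \<theta> ^ n * (cmod (mfps_nth f P) * \<rho> ^ mdegree P)"
  proof (cases "mdegree P < n")
    case False
    then have "\<theta> ^ mdegree P \<le> \<theta> ^ n" using \<theta> by (intro power_decreasing) auto
    then have "\<theta> ^ mdegree P * (cmod (mfps_nth f P) * \<rho> ^ mdegree P) \<le>
        \<theta> ^ n * (cmod (mfps_nth f P) * \<rho> ^ mdegree P)"
      using \<rho> by (intro mult_right_mono) auto
    then show ?thesis by (simp add: power_mult_distrib ac_simps)
  qed (simp add: ord_geD[OF f])
qed

lemma vtnorm_add_le: "0 \<le> \<rho> \<Longrightarrow> vtnorm \<rho> d (v + w) \<le> vtnorm \<rho> d v + vtnorm \<rho> d w"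
  unfolding vtnorm_def sum.distrib[symmetric] by (intro sum_mono) (simp add: tnorm_add_le)

lemma tnorm_le_vtnorm: "0 \<le> \<rho> \<Longrightarrow> tnorm \<rho> d (w $ i) \<le> vtnorm \<rho> d w"
  unfolding vtnorm_def by (rule member_le_sum) auto

lemma vtnorm_vmult_by_le:
  assumes "0 \<le> \<rho>" "\<And>i P. mdegree P \<le> d \<Longrightarrow> mfps_nth (w $ i) P \<noteq> 0 \<Longrightarrow>
    cmod (m (intv P - axis i 1)) \<le> c"
  shows "vtnorm \<rho> d (vmult_by m w) \<le> c * vtnorm \<rho> d w"
  unfolding vtnorm_def sum_distrib_left using assms
  by (intro sum_mono) (simp add: tnorm_smult_by_le)

lemma tnorm_dird_le:
  assumes "0 \<le> \<rho>" shows "tnorm \<rho> d (dird f w) \<le> gnorm \<rho> d f * vtnorm \<rho> d w"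
proof -
  have "tnorm \<rho> d (dird f w) \<le> (\<Sum>j\<in>UNIV. tnorm \<rho> d (mfps_deriv j f * w $ j))"
    unfolding dird_def using assms by (rule tnorm_sum_le)
  also have "\<dots> \<le> (\<Sum>j\<in>UNIV. tnorm \<rho> d (mfps_deriv j f) * vtnorm \<rho> d w)"
    using assms by (intro sum_mono order_trans[OF tnorm_mult_le] mult_left_mono tnorm_le_vtnorm) auto
  finally show ?thesis by (simp add: gnorm_def sum_distrib_right)
qed

definition trunc :: "nat \<Rightarrow> (complex, 'n::finite) mfps \<Rightarrow> (complex, 'n) mfps"
  where "trunc m f = Abs_mfps (\<lambda>P. if mdegree P \<le> m then mfps_nth f P else 0)"

definition vtrunc :: "nat \<Rightarrow> 'n::finite fvf \<Rightarrow> 'n fvf"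
  where "vtrunc m w = (\<chi> i. trunc m (w $ i))"

lemma mfps_nth_trunc [simp]:
  "mfps_nth (trunc m f) P = (if mdegree P \<le> m then mfps_nth f P else 0)"
  by (simp add: trunc_def)

lemma vtrunc_nth [simp]: "vtrunc m w $ i = trunc m (w $ i)"
  by (simp add: vtrunc_def)

lemma vord_ge_vtrunc: "vord_ge d w \<Longrightarrow> vord_ge d (vtrunc m w)"
  by (simp add: vord_ge_def ord_ge_def)

lemma tnorm_trunc_le:
  assumes "0 \<le> \<rho>" shows "tnorm \<rho> d (trunc m f) \<le> tnorm \<rho> m f"
proof -
  have "tnorm \<rho> d (trunc m f) =
      (\<Sum>P | mdegree P \<le> d \<and> mdegree P \<le> m. cmod (mfps_nth f P) * \<rho> ^ mdegree P)"
    unfolding tnorm_def by (rule sum.mono_neutral_cong_right) (auto simp: finite_mdegree_le)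
  also have "\<dots> \<le> tnorm \<rho> m f"
    unfolding tnorm_def using assms by (intro sum_mono2 finite_mdegree_le) auto
  finally show ?thesis .
qed

lemma vtnorm_vtrunc_le: "0 \<le> \<rho> \<Longrightarrow> vtnorm \<rho> d (vtrunc m w) \<le> vtnorm \<rho> m w"
  unfolding vtnorm_def by (intro sum_mono) (simp add: tnorm_trunc_le)

lemma dnorm_le: "0 \<le> \<rho> \<Longrightarrow> dnorm \<rho> d f \<le> real d * tnorm \<rho> d f"
  unfolding dnorm_def tnorm_def sum_distrib_left by (intro sum_mono mult_right_mono) auto

lemma tnorm_le_dnorm:
  fixes f :: "(complex, 'n::finite) mfps"
  assumes "0 \<le> \<rho>" "ord_ge (Suc 0) f" shows "tnorm \<rho> d f \<le> dnorm \<rho> d f"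
  unfolding dnorm_def tnorm_def
proof (rule sum_mono)
  fix P :: "nat ^ 'n"
  let ?c = "cmod (mfps_nth f P) * \<rho> ^ mdegree P"
  show "?c \<le> real (mdegree P) * ?c"
  proof (cases "mdegree P = 0")
    case False
    then have "1 * ?c \<le> real (mdegree P) * ?c" using assms(1) by (intro mult_right_mono) auto
    then show ?thesis by simp
  qed (simp add: ord_geD[OF assms(2)])
qed

lemma gnorm_trunc_le:
  fixes f :: "(complex, 'n::finite) mfps"
  assumes \<rho>: "0 \<le> \<rho>"
  shows "\<rho> * gnorm \<rho> d (trunc m f) \<le> dnorm \<rho> m f"
proof -
  define D where "D = {Q :: nat ^ 'n. mdegree Q \<le> m}"
  have finD: "finite D" unfolding D_def by (rule finite_mdegree_le)
  define a where "a P = cmod (mfps_nth f P) * \<rho> ^ mdegree P" for P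
  have a0: "a P \<ge> 0" for P using \<rho> by (simp add: a_def)
  have 1: "\<rho> * tnorm \<rho> d (mfps_deriv j (trunc m f)) \<le> (\<Sum>P\<in>D. real (P $ j) * a P)" for j
  proof -
    let ?s = "\<lambda>P. P + axis j 1"
    have "\<rho> * tnorm \<rho> d (mfps_deriv j (trunc m f)) =
        (\<Sum>P | mdegree P \<le> d. if ?s P \<in> D then real (?s P $ j) * a (?s P) else 0)"
      unfolding tnorm_def sum_distrib_left
    proof (rule sum.cong, rule refl)
      fix P :: "nat ^ 'n"
      have sj: "?s P $ j = P $ j + 1" by (simp add: axis_def)
      show "\<rho> * (cmod (mfps_nth (mfps_deriv j (trunc m f)) P) * \<rho> ^ mdegree P) =
          (if ?s P \<in> D then real (?s P $ j) * a (?s P) else 0)"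
      proof (cases "?s P \<in> D")
        case True
        then have "mfps_nth (mfps_deriv j (trunc m f)) P = of_nat (P $ j + 1) * mfps_nth f (?s P)"
          by (simp only: mfps_nth_deriv mfps_nth_trunc D_def mem_Collect_eq if_True)
        moreover have "\<rho> ^ mdegree (?s P) = \<rho> * \<rho> ^ mdegree P" by simp
        ultimately show ?thesis
          using True by (simp only: a_def sj norm_mult norm_of_nat if_True ac_simps)
      next
        case False
        then have "mfps_nth (mfps_deriv j (trunc m f)) P = 0"
          by (simp only: mfps_nth_deriv mfps_nth_trunc D_def mem_Collect_eq if_False mult_zero_right)
        then show ?thesis using False by simp
      qed
    qed
    also have "\<dots> = (\<Sum>P | mdegree P \<le> d \<and> ?s P \<in> D. real (?s P $ j) * a (?s P))"
      by (subst sum.inter_filter[symmetric]) (simp_all add: finite_mdegree_le)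
    also have "\<dots> = (\<Sum>P\<in>?s ` {P. mdegree P \<le> d \<and> ?s P \<in> D}. real (P $ j) * a P)"
      by (subst sum.reindex) (auto simp: inj_on_def)
    also have "\<dots> \<le> (\<Sum>P\<in>D. real (P $ j) * a P)"
      by (intro sum_mono2 finD) (auto simp: a0)
    finally show ?thesis .
  qed
  have "\<rho> * gnorm \<rho> d (trunc m f) \<le> (\<Sum>j\<in>UNIV. \<Sum>P\<in>D. real (P $ j) * a P)"
    unfolding gnorm_def sum_distrib_left by (intro sum_mono 1)
  also have "\<dots> = dnorm \<rho> m f"
    by (subst sum.swap) (simp add: dnorm_def D_def a_def mdegree_def sum_distrib_right)
  finally show ?thesis .
qed

section \<open>The linearized equation in a block of degrees\<close>

text \<open>The vector \<open>w\<close> with \<open>dh = DH w\<close> is a fixed point, since \<open>DH\<close> is unipotent. Expanding the exact conjugacy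
equation at the truncated pair gives \<open>E = Ddh G + DH dG - DF(H) dh\<close> up to degree \<open>2 m\<close>. Here
\<open>DF(H) dh = DF(H) DH w\<close> is the derivative of \<open>F \<circ> H = E + DH G\<close> along \<open>w\<close>, and the derivative of
\<open>E\<close> along \<open>w\<close> is of higher order. The remaining second derivatives of \<open>H\<close> combine to a bracket.\<close>

lemma newton_block:
  fixes Fs h r :: "'n::finite fvf" and lam :: "complex ^ 'n"
  assumes F1: "vord_ge (Suc 0) Fs" and h: "vord_ge 2 h" and r: "vord_ge 2 r" and m: "m \<ge> 1"
    and conj: "\<And>i. dird ((idf + h) $ i) (fvf_diag lam + r) = mfps_compose (Fs $ i) (idf + h)"
  defines "H \<equiv> idf + vtrunc m h" and "G \<equiv> fvf_diag lam + vtrunc m r"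
    and "dh \<equiv> vtrunc (2 * m) h - vtrunc m h" and "dG \<equiv> vtrunc (2 * m) r - vtrunc m r"
  defines "E \<equiv> (\<chi> i. mfps_compose (Fs $ i) H - dird (H $ i) G)"
  obtains w where "\<And>k. dh $ k = dird (H $ k) w" "vord_ge (Suc m) E"
    "\<And>i. ord_ge (Suc (2 * m)) (E $ i - dird (H $ i) (\<chi> k. dird (w $ k) G - dird (G $ k) w + dG $ k))"
proof -
  have hm: "vord_ge 2 (vtrunc m h)" using h by (rule vord_ge_vtrunc)
  have H1: "vord_ge (Suc 0) H" unfolding H_def using hm by (rule vord_ge_idf_add)
  define Hx where "Hx = idf + h"
  define Gx where "Gx = fvf_diag lam + r"
  have Gx1: "vord_ge 1 Gx"
    using r ord_ge_mult_left[OF ord_ge_var]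
    unfolding Gx_def by (intro vord_ge_add) (auto simp: vord_ge_def intro: ord_ge_mono)
  have conj: "dird (Hx $ i) Gx = mfps_compose (Fs $ i) Hx" for i
    using assms(5) by (simp add: Hx_def Gx_def)
  have dh: "vord_ge (Suc m) dh"
    by (auto simp: vord_ge_def ord_ge_def dh_def)
  have dG: "vord_ge (Suc m) dG"
    by (auto simp: vord_ge_def ord_ge_def dG_def)
  have Hm: "vord_ge (Suc m) (Hx - H)"
    by (auto simp: vord_ge_def ord_ge_def Hx_def H_def)
  have Gm: "vord_ge (Suc m) (Gx - G)"
    by (auto simp: vord_ge_def ord_ge_def Gx_def G_def)
  have H2m: "vord_ge (Suc (2 * m)) (Hx - (H + dh))"
    by (auto simp: vord_ge_def ord_ge_def Hx_def H_def dh_def)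
  have G2m: "vord_ge (Suc (2 * m)) (Gx - (G + dG))"
    by (auto simp: vord_ge_def ord_ge_def Gx_def G_def dG_def)
  have Hdh: "vord_ge (Suc 0) (H + dh)"
    using H1 dh by (auto intro!: vord_ge_add intro: vord_ge_mono)
  have dird_near: "ord_ge (Suc d) (dird (Hx $ i) Gx - dird (T $ i) S)"
    if "vord_ge (Suc d) (Hx - T)" "vord_ge (Suc d) (Gx - S)" for d T S i
  proof -
    have "dird (Hx $ i) Gx - dird (T $ i) S = dird ((Hx - T) $ i) Gx + dird (T $ i) (Gx - S)"
      by (simp add: dird_diff_left dird_diff_right)
    moreover have "ord_ge (Suc d) (dird ((Hx - T) $ i) Gx)"
      by (rule ord_ge_dird'[OF vord_geD[OF that(1)] Gx1]) simp
    moreover have "ord_ge (Suc d) (dird (T $ i) (Gx - S))"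
      by (rule ord_ge_dird_right[OF that(2)])
    ultimately show ?thesis by (simp add: ord_ge_add)
  qed
  have E: "ord_ge (Suc m) (E $ i)" for i
  proof -
    have "ord_ge (Suc m + 0) (mfps_compose (Fs $ i) Hx - mfps_compose (Fs $ i) H)"
      by (rule compose_cong[OF H1 Hm _ vord_geD[OF F1]]) simp_all
    then have 1: "ord_ge (Suc m) (mfps_compose (Fs $ i) Hx - mfps_compose (Fs $ i) H)" by simp
    have "E $ i = (dird (Hx $ i) Gx - dird (H $ i) G)
        - (mfps_compose (Fs $ i) Hx - mfps_compose (Fs $ i) H)"
      by (simp add: E_def conj)
    then show ?thesis using dird_near[OF Hm Gm, of i] 1 by (simp add: ord_ge_diff)
  qed
  obtain w where w: "vord_ge (Suc m) w" "dh - (\<chi> k. dird (vtrunc m h $ k) w) = w"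
  proof (rule contraction_fixpoint[of "Suc m" "\<lambda>w. dh - (\<chi> k. dird (vtrunc m h $ k) w)"])
    fix w :: "'n fvf" assume "vord_ge (Suc m) w"
    then have "ord_ge (Suc m) (dird (vtrunc m h $ k) w)" for k by (rule ord_ge_dird_right)
    then show "vord_ge (Suc m) (dh - (\<chi> k. dird (vtrunc m h $ k) w))"
      using dh by (intro vord_ge_diff) (simp_all add: vord_ge_def)
  next
    fix w w' :: "'n fvf" and d assume "vord_ge d (w - w')"
    then have "ord_ge (Suc d) (dird (vtrunc m h $ k) (w' - w))" for k
      using ord_ge_dird'[of 1 "vtrunc m h $ k" d "w' - w" "Suc d"] vord_geD[OF hm, of k]
      by (simp add: numeral_2_eq_2 vord_ge_commute)
    then show "vord_ge (Suc d) (dh - (\<chi> k. dird (vtrunc m h $ k) w) - (dh - (\<chi> k. dird (vtrunc m h $ k) w')))"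
      by (simp add: vord_ge_def dird_diff_right)
  qed
  have dhw: "dh $ k = dird (H $ k) w" for k
  proof -
    have "w $ k = dh $ k - dird (vtrunc m h $ k) w" by (subst w(2)[symmetric]) simp
    then show ?thesis by (simp add: H_def dird_add_left)
  qed
  let ?V = "\<chi> k. dird (w $ k) G - dird (G $ k) w + dG $ k"
  have "ord_ge (Suc (2 * m)) (E $ i - dird (H $ i) ?V)" for i
  proof -
    define S where "S = (\<Sum>k\<in>UNIV. mfps_compose (mfps_deriv k (Fs $ i)) H * dh $ k)"
    have 1: "ord_ge (Suc (2 * m)) (mfps_compose (Fs $ i) Hx - mfps_compose (Fs $ i) (H + dh))"
      using compose_cong[OF Hdh H2m _ vord_geD[OF F1, of i]] by simp
    have "ord_ge (2 * Suc m) (mfps_compose (Fs $ i) (H + dh) - mfps_compose (Fs $ i) H - S)"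
      unfolding S_def by (rule compose_taylor[OF H1 dh]) simp
    then have 2: "ord_ge (Suc (2 * m)) (mfps_compose (Fs $ i) (H + dh) - mfps_compose (Fs $ i) H - S)"
      by (rule ord_ge_mono) simp
    have 3: "ord_ge (Suc (2 * m)) (dird (Hx $ i) Gx - dird ((H + dh) $ i) (G + dG))"
      by (rule dird_near[OF H2m G2m])
    have 4: "ord_ge (Suc (2 * m)) (dird (dh $ i) dG)"
      by (rule ord_ge_dird'[OF vord_geD[OF dh] dG]) simp
    have 5: "ord_ge (Suc (2 * m)) (dird (E $ i) w)"
      by (rule ord_ge_dird'[OF E w(1)]) simp
    have S: "S = dird (E $ i) w + dird (dird (H $ i) G) w"
    proof -
      have "S = dird (mfps_compose (Fs $ i) H) w"
        by (simp add: S_def dhw dird_compose[OF H1])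
      also have "mfps_compose (Fs $ i) H = E $ i + dird (H $ i) G" by (simp add: E_def)
      finally show ?thesis by (simp add: dird_add_left)
    qed
    have V: "dird (H $ i) ?V =
        dird (dh $ i) G - dird (dird (H $ i) G) w + dird (H $ i) dG"
    proof -
      have "?V =
          (\<chi> k. dird (w $ k) G - dird (G $ k) w) + dG" by (simp add: vec_eq_iff)
      then show ?thesis
        by (simp add: dird_add_right dhw flip: dird_commutator)
    qed
    have eq: "E $ i - dird (H $ i) ?V =
        dird (dh $ i) dG - dird (E $ i) w + (dird (Hx $ i) Gx - dird ((H + dh) $ i) (G + dG))
        - (mfps_compose (Fs $ i) Hx - mfps_compose (Fs $ i) (H + dh))
        - (mfps_compose (Fs $ i) (H + dh) - mfps_compose (Fs $ i) H - S)"
      unfolding V S conj by (simp add: E_def dird_add_left dird_add_right)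
    show ?thesis
      unfolding eq by (rule ord_ge_diff[OF ord_ge_diff[OF ord_ge_add[OF ord_ge_diff[OF 4 5] 3] 1] 2])
  qed
  then show ?thesis using that[OF dhw] E by (simp add: vord_ge_def)
qed

lemma M_plus_subset_N: "M_plus lam \<subseteq> N_all"
proof
  fix Q :: "int ^ 'a" assume "Q \<in> M_plus lam"
  then have "0 \<le> Q $ i" for i by (simp add: M_plus_def)
  moreover have "- 1 \<le> Q $ i" for i using calculation[of i] by linarith
  ultimately show "Q \<in> N_all" by (auto simp: N_all_def N_comp_def)
qed

lemma invariant_multiplier_of_pairing:
  "invariant_multiplier lam (\<lambda>Q. \<phi> (pairing Q lam))"
  by (auto simp: invariant_multiplier_def pairing_add M_plus_def)

lemma special_field_nth:
  "mfps_nth (special_field p L g $ k) P =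
    (if P $ k = 0 then 0 else \<Sum>j=1..p. L j $ k * mfps_nth (g j) (P - axis k 1))"
proof -
  have "special_field p L g $ k = (\<Sum>j=1..p. mfps_const (L j $ k) * (mfps_var k * g j))"
    unfolding special_field_def fvf_diag_nth vec_lambda_beta by (simp only: ac_simps)
  then show ?thesis
    by (simp add: mfps_nth_sum mfps_nth_var_mult)
qed

text \<open>The derivatives falling on \<open>w\<close> and on the linear factors combine to homological operators; those
falling on the coefficients \<open>g j\<close> remain as multiples of the diagonal fields.\<close>

lemma bracket_special_field:
  "dird (w $ k) (special_field p L g) - dird (special_field p L g $ k) w =
    (\<Sum>j=1..p. g j * smult_by (axis k 1) (\<lambda>Q. pairing Q (L j)) (w $ k)) -
    (\<Sum>j=1..p. mfps_const (L j $ k) * (mfps_var k * dird (g j) w))"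
proof -
  have "dird (special_field p L g $ k) w =
      (\<Sum>j=1..p. mfps_const (L j $ k) * (mfps_var k * dird (g j) w) + g j * (mfps_const (L j $ k) * w $ k))"
    by (simp add: special_field_def dird_sum_left dird_mult_left ac_simps)
  then show ?thesis
    by (simp add: dird_special_field lie_diag[symmetric] sum.distrib right_diff_distrib sum_subtractf)
qed

text \<open>All ingredients commute with projection to resonant or nonresonant terms, so the equation splits. In
the nonresonant part the constants \<open>\<gamma> j\<close> contribute \<open>u = \<Lambda> wn\<close>, with \<open>\<Lambda>\<close> the multiplier of symbol
\<open>pairing Q lam\<close>, and the rest is expressed by \<open>u\<close> through the symbols \<open>q j\<close>,
which the hull condition bounds. The second
equation is obtained by applying \<open>dird (gh i)\<close> to the first: the multiples of the diagonal fields drop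
out, because \<open>gh i\<close> is a first integral of each of them. In the resonant part the homological
operators vanish.\<close>

lemma bracket_split:
  fixes lam :: "complex ^ 'n::finite"
  assumes hull: "\<forall>j\<in>{1..p}. \<forall>Q\<in>N_all. pairing Q lam = 0 \<longrightarrow> pairing Q (L j) = 0"
    and gh: "\<And>j. has_weight lam 0 (gh j)"
    and lam: "\<And>k. (\<Sum>j=1..p. \<gamma> j * L j $ k) = lam $ k"
    and dG: "resonant lam dG"
    and V: "\<And>k. V $ k = dird (w $ k) (special_field p L (\<lambda>j. mfps_const (\<gamma> j) + gh j))
      - dird (special_field p L (\<lambda>j. mfps_const (\<gamma> j) + gh j) $ k) w + dG $ k"
  defines "Vn \<equiv> vmult_by (nonres lam) V" and "wn \<equiv> vmult_by (nonres lam) w"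
    and "wr \<equiv> vmult_by (res lam) w"
  defines "u \<equiv> vmult_by (\<lambda>Q. pairing Q lam) wn"
    and "q \<equiv> \<lambda>j Q. pairing Q (L j) / pairing Q lam"
  shows "u $ k = Vn $ k + (\<Sum>j=1..p. mfps_const (L j $ k) * (mfps_var k * dird (gh j) wn))
      - (\<Sum>j=1..p. gh j * smult_by (axis k 1) (q j) (u $ k))" (is ?eq_u)
    and "dird (gh i) u = dird (gh i) Vn - (\<Sum>j=1..p. gh j * smult_by 0 (q j) (dird (gh i) u))" (is ?eq_b)
    and "smult_by 0 (\<lambda>Q. pairing Q lam) (dird (gh i) wn) = dird (gh i) u" (is ?eq_a)
    and "dird (gh i) wn = smult_by 0 (nonres lam) (dird (gh i) w)" (is ?eq_n)
    and "vmult_by (res lam) V $ k =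
      dG $ k - (\<Sum>j=1..p. mfps_const (L j $ k) * (mfps_var k * dird (gh j) wr))" (is ?eq_r)
proof -
  have inv: "invariant_multiplier lam (nonres lam)" "invariant_multiplier lam (res lam)"
    "invariant_multiplier lam (\<lambda>Q. pairing Q lam)"
    using invariant_multiplier_of_pairing[of lam "\<lambda>z. if z = 0 then 0 else 1"]
      invariant_multiplier_of_pairing[of lam "\<lambda>z. if z = 0 then 1 else 0"]
      invariant_multiplier_of_pairing[of lam "\<lambda>z. z"]
    by (simp_all add: nonres_def[abs_def] res_def[abs_def])
  have L0: "pairing Q (L j) = 0" "pairing Q lam = 0" if "j \<in> {1..p}" "Q \<in> M_plus lam" for j Q
  proof -
    show "pairing Q lam = 0" using that(2) by (simp add: M_plus_def)
    then show "pairing Q (L j) = 0" using hull that M_plus_subset_N by blast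
  qed
  have inv_q: "invariant_multiplier lam (q j)" if "j \<in> {1..p}" for j
    using L0[OF that] by (auto simp: invariant_multiplier_def q_def pairing_add)
  let ?g = "\<lambda>j. mfps_const (\<gamma> j) + gh j"
  have dg: "dird (?g j) w = dird (gh j) w" for j w by (simp add: dird_add_left)
  have g: "has_weight lam 0 (?g j)" for j
    using gh[of j] by (auto simp: has_weight_def mfps_nth_const split: if_splits)
  have Vk: "V $ k = (\<Sum>j=1..p. ?g j * smult_by (axis k 1) (\<lambda>Q. pairing Q (L j)) (w $ k)) -
      (\<Sum>j=1..p. mfps_const (L j $ k) * (mfps_var k * dird (gh j) w)) + dG $ k" for k
    unfolding V bracket_special_field dg ..
  have swap: "smult_by a m (smult_by a m' f) = smult_by a m' (smult_by a m f)" for a m m' and f :: "(complex, 'n) mfps"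
    by (simp add: smult_by_comp mult.commute)
  have project: "vmult_by m V $ k =
      (\<Sum>j=1..p. ?g j * smult_by (axis k 1) (\<lambda>Q. pairing Q (L j)) (vmult_by m w $ k)) -
      (\<Sum>j=1..p. mfps_const (L j $ k) * (mfps_var k * dird (gh j) (vmult_by m w))) +
      vmult_by m dG $ k" if "invariant_multiplier lam m" for m k
    using that
    by (simp add: Vk smult_by_add smult_by_diff smult_by_sum smult_by_scale[OF g] smult_by_const_mult
        smult_by_var_mult smult_by_dird[OF gh] swap[of _ m])
  have dGn: "vmult_by (nonres lam) dG $ k = 0" for k
    using dG by (intro mfps_eqI) (auto simp: resonant_def has_weight_def nonres_def pairing_diff)
  have dGr: "vmult_by (res lam) dG $ k = dG $ k" for k
    using dG by (intro mfps_eqI) (auto simp: resonant_def has_weight_def res_def pairing_diff)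
  have Lq: "smult_by (axis k 1) (\<lambda>Q. pairing Q (L j)) (wn $ k) = smult_by (axis k 1) (q j) (u $ k)" for k j
    by (rule mfps_eqI) (simp add: u_def wn_def q_def nonres_def)
  have lam_u: "(\<Sum>j=1..p. mfps_const (\<gamma> j) * smult_by (axis k 1) (\<lambda>Q. pairing Q (L j)) f) =
      smult_by (axis k 1) (\<lambda>Q. pairing Q lam) f" for k f
  proof (rule mfps_eqI)
    fix P
    have lamv: "lam = (\<Sum>j=1..p. \<gamma> j *s L j)"
      using lam by (auto simp: vec_eq_iff)
    have "pairing Q lam = (\<Sum>j=1..p. \<gamma> j * pairing Q (L j))" for Q
      by (subst lamv) (rule pairing_sum_right)
    then show "mfps_nth (\<Sum>j=1..p. mfps_const (\<gamma> j) * smult_by (axis k 1) (\<lambda>Q. pairing Q (L j)) f) P =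
        mfps_nth (smult_by (axis k 1) (\<lambda>Q. pairing Q lam) f) P"
      by (simp add: mfps_nth_sum sum_distrib_right mult.assoc)
  qed
  have u_eq: "u $ k = Vn $ k + (\<Sum>j=1..p. mfps_const (L j $ k) * (mfps_var k * dird (gh j) wn))
      - (\<Sum>j=1..p. gh j * smult_by (axis k 1) (q j) (u $ k))" for k
  proof -
    have "Vn $ k = u $ k + (\<Sum>j=1..p. gh j * smult_by (axis k 1) (q j) (u $ k))
        - (\<Sum>j=1..p. mfps_const (L j $ k) * (mfps_var k * dird (gh j) wn))"
      unfolding Vn_def project[OF inv(1)] dGn wn_def[symmetric] distrib_right sum.distrib lam_u
      unfolding Lq by (simp add: u_def)
    then show ?thesis by simp
  qed
  then show ?eq_u .
  show ?eq_a
    unfolding u_def by (rule smult_by_dird[OF gh inv(3)])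
  show ?eq_n
    unfolding wn_def by (rule smult_by_dird[OF gh inv(1), symmetric])
  show ?eq_b
  proof -
    have z: "dird (gh i) (fvf_diag (L j)) = 0" if "j \<in> {1..p}" for j
    proof (rule mfps_eqI)
      fix P show "mfps_nth (dird (gh i) (fvf_diag (L j))) P = mfps_nth 0 P"
        using L0(1)[OF that has_weight_0_M_plus[OF gh, of i P]]
        by (cases "mfps_nth (gh i) P = 0") (auto simp: dird_diag)
    qed
    have "u = Vn + (\<Sum>j=1..p. (\<chi> k. dird (gh j) wn * fvf_diag (L j) $ k))
        - (\<Sum>j=1..p. (\<chi> k. gh j * vmult_by (q j) u $ k))"
    proof -
      have T: "mfps_const (L j $ k) * (mfps_var k * dird (gh j) wn) = dird (gh j) wn * fvf_diag (L j) $ k" for j k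
        unfolding fvf_diag_nth by (simp only: ac_simps)
      have "u $ k = Vn $ k + (\<Sum>j=1..p. dird (gh j) wn * fvf_diag (L j) $ k)
          - (\<Sum>j=1..p. gh j * vmult_by (q j) u $ k)" for k
        using u_eq[of k] by (simp only: T vmult_by_nth)
      then show ?thesis
        unfolding vec_eq_iff
        by (simp only: sum_component vector_add_component vector_minus_component vec_lambda_beta) blast
    qed
    then have "dird (gh i) u = dird (gh i) (Vn + (\<Sum>j=1..p. (\<chi> k. dird (gh j) wn * fvf_diag (L j) $ k))
        - (\<Sum>j=1..p. (\<chi> k. gh j * vmult_by (q j) u $ k)))"
      by (rule arg_cong)
    also have "\<dots> = dird (gh i) Vn + (\<Sum>j=1..p. dird (gh j) wn * dird (gh i) (fvf_diag (L j)))
        - (\<Sum>j=1..p. gh j * dird (gh i) (vmult_by (q j) u))"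
      by (simp only: dird_add_right dird_diff_right dird_sum_right dird_scale_right)
    also have "\<dots> = dird (gh i) Vn - (\<Sum>j=1..p. gh j * smult_by 0 (q j) (dird (gh i) u))"
      using z inv_q by (simp add: smult_by_dird[OF gh])
    finally show ?thesis .
  qed
  show ?eq_r
  proof -
    have "smult_by (axis k 1) (\<lambda>Q. pairing Q (L j)) (wr $ k) = 0" if "j \<in> {1..p}" for j
    proof (rule mfps_eqI)
      fix P
      have "pairing (intv P - axis k 1) lam = 0 \<Longrightarrow> pairing (intv P - axis k 1) (L j) = 0"
        using hull that intv_minus_axis_in_N by blast
      then show "mfps_nth (smult_by (axis k 1) (\<lambda>Q. pairing Q (L j)) (wr $ k)) P = mfps_nth 0 P"
        by (simp add: wr_def res_def)
    qed
    then show ?thesis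
      unfolding project[OF inv(2)] dGr wr_def[symmetric] by simp
  qed
qed

section \<open>Estimates in a block of degrees\<close>

lemma Q_norm_intv: "Q_norm (intv P) = int (mdegree P)"
  by (simp add: Q_norm_def intv_def mdegree_def sum_nonneg)

lemma Q_norm_intv_minus_axis: "Q_norm (intv P - axis i 1) = \<bar>int (mdegree P) - 1\<bar>"
proof -
  have "(\<Sum>k\<in>UNIV. axis i 1 $ k :: int) = (\<Sum>k\<in>UNIV. if k = i then 1 else 0)"
    by (rule sum.cong) (auto simp: axis_def)
  then have "(\<Sum>k\<in>UNIV. axis i 1 $ k :: int) = 1" by simp
  then show ?thesis by (simp add: Q_norm_def intv_def mdegree_def sum_subtractf)
qed

lemma tnorm_cmult_var_le:
  assumes "0 \<le> \<rho>"
  shows "tnorm \<rho> d (mfps_const a * (mfps_var k * f)) \<le> cmod a * (\<rho> * tnorm \<rho> d f)"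
proof -
  have "tnorm \<rho> d (mfps_var k * f) \<le> tnorm \<rho> d (mfps_var k) * tnorm \<rho> d f"
    using assms by (rule tnorm_mult_le)
  also have "\<dots> \<le> \<rho> * tnorm \<rho> d f"
    using assms by (intro mult_right_mono tnorm_var_le) auto
  finally show ?thesis unfolding tnorm_const_mult by (rule mult_left_mono) simp
qed

lemma vtnorm_tail_le:
  assumes \<rho>: "0 \<le> \<rho>" and L: "\<And>j. j \<in> {1..p} \<Longrightarrow> (\<Sum>k\<in>UNIV. cmod (L j $ k)) \<le> \<Lambda>"
  shows "(\<Sum>k\<in>UNIV. tnorm \<rho> d (\<Sum>j=1..p. mfps_const (L j $ k) * (mfps_var k * a j)))
    \<le> \<Lambda> * (\<Sum>j=1..p. \<rho> * tnorm \<rho> d (a j))"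
proof -
  have "(\<Sum>k\<in>UNIV. tnorm \<rho> d (\<Sum>j=1..p. mfps_const (L j $ k) * (mfps_var k * a j)))
      \<le> (\<Sum>k\<in>UNIV. \<Sum>j=1..p. cmod (L j $ k) * (\<rho> * tnorm \<rho> d (a j)))"
    using \<rho> by (intro sum_mono order_trans[OF tnorm_sum_le] tnorm_cmult_var_le)
  also have "\<dots> = (\<Sum>j=1..p. (\<Sum>k\<in>UNIV. cmod (L j $ k)) * (\<rho> * tnorm \<rho> d (a j)))"
    by (subst sum.swap) (simp add: sum_distrib_right)
  also have "\<dots> \<le> (\<Sum>j=1..p. \<Lambda> * (\<rho> * tnorm \<rho> d (a j)))"
    using \<rho> by (intro sum_mono mult_right_mono L) auto
  finally show ?thesis by (simp add: sum_distrib_left)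
qed

lemma vtnorm_dird_le:
  assumes "0 \<le> \<rho>"
  shows "(\<Sum>k\<in>UNIV. tnorm \<rho> d (dird (h $ k) w)) \<le> (\<Sum>k\<in>UNIV. gnorm \<rho> d (h $ k)) * vtnorm \<rho> d w"
  unfolding sum_distrib_right using assms by (intro sum_mono tnorm_dird_le)

text \<open>The equations for \<open>u\<close> and \<open>dird (gh i) u\<close> have the form \<open>y = z + perturbation\<close> with a perturbation of
norm at most half that of \<open>y\<close>, so \<open>y\<close> is bounded by twice \<open>z\<close>. One small divisor enters in passing from
\<open>dird (gh i) u\<close> to \<open>dird (gh i) wn\<close> and one in passing from \<open>u\<close> to \<open>wn\<close>. The factors \<open>m\<close> come from the
gradients of the \<open>gh j\<close>.\<close>

lemma block_estimate:
  fixes lam :: "complex ^ 'n::finite"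
  assumes c: "0 < c"
    and hull: "\<And>j Q. j \<in> {1..p} \<Longrightarrow> Q \<in> N_all \<Longrightarrow> cmod (pairing Q (L j)) \<le> c * cmod (pairing Q lam)"
    and gh: "\<And>j. has_weight lam 0 (gh j)"
    and lam: "\<And>k. (\<Sum>j=1..p. \<gamma> j * L j $ k) = lam $ k"
    and dG: "resonant lam dG"
    and V: "\<And>k. V $ k = dird (w $ k) (special_field p L (\<lambda>j. mfps_const (\<gamma> j) + gh j))
      - dird (special_field p L (\<lambda>j. mfps_const (\<gamma> j) + gh j) $ k) w + dG $ k"
    and \<rho>: "0 \<le> \<rho>" and d: "d \<ge> 1" and m: "(m::nat) \<ge> 1"
    and hm: "(\<Sum>k\<in>UNIV. gnorm \<rho> d (hm $ k)) \<le> 1 / 2"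
    and E: "\<And>i. ord_ge (Suc d) (E $ i - dird ((idf + hm) $ i) V)"
    and v: "\<And>k. v $ k = dird ((idf + hm) $ k) w" and v_nonres: "vmult_by (res lam) v = 0"
    and \<tau>: "\<And>j. j \<in> {1..p} \<Longrightarrow> tnorm \<rho> d (gh j) \<le> \<tau> j"
    and \<tau>': "\<And>j. j \<in> {1..p} \<Longrightarrow> \<rho> * gnorm \<rho> d (gh j) \<le> real m * \<tau> j"
    and \<tau>_sum: "c * (\<Sum>j=1..p. \<tau> j) \<le> 1 / 2"
    and \<Lambda>: "\<And>j. j \<in> {1..p} \<Longrightarrow> (\<Sum>k\<in>UNIV. cmod (L j $ k)) \<le> \<Lambda>" "0 \<le> \<Lambda>"
    and \<Omega>: "1 \<le> \<Omega>" "\<forall>Q\<in>N_all. Q_norm Q \<le> int d \<longrightarrow> pairing Q lam \<noteq> 0 \<longrightarrow>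
      1 \<le> \<Omega> * cmod (pairing Q lam)"
  defines "C \<equiv> 12 * (1 + \<Lambda> / c) ^ 2"
  shows "vtnorm \<rho> d v \<le> C * real m ^ 2 * \<Omega> ^ 2 * vtnorm \<rho> d E"
    and "vtnorm \<rho> d dG \<le> C * real m ^ 2 * \<Omega> ^ 2 * vtnorm \<rho> d E"
proof -
  define e where "e = vtnorm \<rho> d E"
  define \<kappa> where "\<kappa> = \<Lambda> / c"
  have e0: "e \<ge> 0" using \<rho> by (simp add: e_def)
  have \<kappa>0: "\<kappa> \<ge> 0" using c \<Lambda>(2) by (simp add: \<kappa>_def)
  define Vn where "Vn = vmult_by (nonres lam) V"
  define wn where "wn = vmult_by (nonres lam) w"
  define wr where "wr = vmult_by (res lam) w"
  define u where "u = vmult_by (\<lambda>Q. pairing Q lam) wn"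
  define q where "q = (\<lambda>j Q. pairing Q (L j) / pairing Q lam)"
  have q_eq: "q j = (\<lambda>Q. pairing Q (L j) / pairing Q lam)" for j
    by (simp add: q_def)
  have hull0: "\<forall>j\<in>{1..p}. \<forall>Q\<in>N_all. pairing Q lam = 0 \<longrightarrow> pairing Q (L j) = 0"
    using hull by fastforce
  note split = bracket_split[OF hull0 gh lam dG V, folded Vn_def wn_def wr_def, folded u_def, folded q_eq]
  have q: "cmod (q j Q) \<le> c" if "j \<in> {1..p}" "Q \<in> N_all" for j Q
    using hull[OF that] c by (cases "pairing Q lam = 0") (simp_all add: q_def norm_divide divide_le_eq)
  have hm_dird: "(\<Sum>k\<in>UNIV. tnorm \<rho> d (dird (hm $ k) y)) \<le> vtnorm \<rho> d y / 2" for y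
    using vtnorm_dird_le[OF \<rho>, of d hm y] mult_right_mono[OF hm vtnorm_nonneg[OF \<rho>, of d y]] by simp
  have Qd: "Q_norm (intv P - axis i 1) \<le> int d" "Q_norm (intv P) \<le> int d"
    if "mdegree P \<le> d" for P and i :: 'n
    using that d by (auto simp: Q_norm_intv Q_norm_intv_minus_axis)
  have nV: "vtnorm \<rho> d V \<le> 2 * e"
  proof -
    have "vtnorm \<rho> d V \<le> (\<Sum>k\<in>UNIV. tnorm \<rho> d (E $ k) + tnorm \<rho> d (dird (hm $ k) V))"
      unfolding vtnorm_def
    proof (rule sum_mono)
      fix k
      have "V $ k = dird ((idf + hm) $ k) V - dird (hm $ k) V" by (simp add: dird_add_left)
      then have "tnorm \<rho> d (V $ k) = tnorm \<rho> d (dird ((idf + hm) $ k) V - dird (hm $ k) V)"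
        by (rule arg_cong)
      then show "tnorm \<rho> d (V $ k) \<le> tnorm \<rho> d (E $ k) + tnorm \<rho> d (dird (hm $ k) V)"
        using tnorm_diff_le[OF \<rho>] unfolding tnorm_cong[OF E] by (simp only:)
    qed
    also have "\<dots> \<le> e + vtnorm \<rho> d V / 2"
      using hm_dird[of V] by (simp add: sum.distrib e_def vtnorm_def)
    finally show ?thesis by simp
  qed
  have nVn: "vtnorm \<rho> d Vn \<le> 2 * e"
  proof -
    have "vtnorm \<rho> d Vn \<le> 1 * vtnorm \<rho> d V"
      unfolding Vn_def using \<rho> by (rule vtnorm_vmult_by_le) (simp add: nonres_def)
    then show ?thesis using nV by simp
  qed
  have scaled: "tnorm \<rho> d (\<Sum>j=1..p. gh j * smult_by a (q j) f) \<le> tnorm \<rho> d f / 2"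
    if "\<And>P. mdegree P \<le> d \<Longrightarrow> intv P - a \<in> N_all" for a f
  proof -
    have "tnorm \<rho> d (\<Sum>j=1..p. gh j * smult_by a (q j) f) \<le> (\<Sum>j=1..p. \<tau> j * (c * tnorm \<rho> d f))"
    proof (intro order_trans[OF tnorm_sum_le[OF \<rho>]] sum_mono)
      fix j assume j: "j \<in> {1..p}"
      have "tnorm \<rho> d (smult_by a (q j) f) \<le> c * tnorm \<rho> d f"
        using that by (intro tnorm_smult_by_le[OF \<rho>] q j)
      then have "tnorm \<rho> d (gh j) * tnorm \<rho> d (smult_by a (q j) f) \<le> \<tau> j * (c * tnorm \<rho> d f)"
        using \<rho> c order_trans[OF tnorm_nonneg[OF \<rho>] \<tau>[OF j]] by (intro mult_mono \<tau> j) auto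
      then show "tnorm \<rho> d (gh j * smult_by a (q j) f) \<le> \<tau> j * (c * tnorm \<rho> d f)"
        using tnorm_mult_le[OF \<rho>] by (rule order_trans[rotated])
    qed
    also have "\<dots> = (c * (\<Sum>j=1..p. \<tau> j)) * tnorm \<rho> d f"
      by (simp add: sum_distrib_right sum_distrib_left ac_simps)
    also have "\<dots> \<le> 1 / 2 * tnorm \<rho> d f"
      using \<tau>_sum \<rho> by (intro mult_right_mono) auto
    finally show ?thesis by simp
  qed
  \<comment> \<open>the division by small divisors, set to \<open>0\<close> at resonant indices\<close>
  define iv where "iv Q = (if pairing Q lam = 0 then 0 else 1 / pairing Q lam)" for Q
  have inv_le: "cmod (iv Q) \<le> \<Omega>" if "Q \<in> N_all" "Q_norm Q \<le> int d" for Q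
    using \<Omega>(2)[rule_format, OF that] \<Omega>(1) by (auto simp: iv_def norm_divide divide_le_eq)
  have na: "tnorm \<rho> d (dird (gh i) wn) \<le> 4 * e * \<Omega> * gnorm \<rho> d (gh i)" for i
  proof -
    let ?b = "dird (gh i) u"
    have "tnorm \<rho> d ?b \<le> tnorm \<rho> d (dird (gh i) Vn) + tnorm \<rho> d ?b / 2"
    proof -
      have "tnorm \<rho> d (\<Sum>j=1..p. gh j * smult_by 0 (q j) ?b) \<le> tnorm \<rho> d ?b / 2"
        by (rule scaled) (simp add: intv_in_N)
      moreover have "tnorm \<rho> d ?b = tnorm \<rho> d (dird (gh i) Vn - (\<Sum>j=1..p. gh j * smult_by 0 (q j) ?b))"
        using split(2)[of i] by (rule arg_cong)
      moreover note tnorm_diff_le[OF \<rho>, of d "dird (gh i) Vn" "\<Sum>j=1..p. gh j * smult_by 0 (q j) ?b"]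
      ultimately show ?thesis by linarith
    qed
    also have "tnorm \<rho> d (dird (gh i) Vn) \<le> gnorm \<rho> d (gh i) * (2 * e)"
      using tnorm_dird_le[OF \<rho>] mult_left_mono[OF nVn gnorm_nonneg[OF \<rho>]] by (rule order_trans)
    finally have b: "tnorm \<rho> d ?b \<le> 4 * e * gnorm \<rho> d (gh i)" by (simp add: algebra_simps)
    have "dird (gh i) wn = smult_by 0 iv ?b"
      unfolding split(3)[symmetric] split(4) smult_by_comp
      by (rule mfps_eqI) (simp add: nonres_def iv_def)
    moreover have "tnorm \<rho> d (smult_by 0 iv ?b) \<le> \<Omega> * tnorm \<rho> d ?b"
      by (rule tnorm_smult_by_le[OF \<rho>]) (unfold diff_zero, rule inv_le[OF intv_in_N Qd(2)])
    ultimately have "tnorm \<rho> d (dird (gh i) wn) \<le> \<Omega> * tnorm \<rho> d ?b" by (simp only:)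
    also have "\<dots> \<le> \<Omega> * (4 * e * gnorm \<rho> d (gh i))" using b \<Omega>(1) by (intro mult_left_mono) auto
    finally show ?thesis by (simp add: ac_simps)
  qed
  have \<tau>_sum': "\<Lambda> * (\<Sum>j=1..p. real m * \<tau> j) \<le> real m * \<kappa> / 2"
  proof -
    have "\<Lambda> * (\<Sum>j=1..p. real m * \<tau> j) = (real m * \<kappa>) * (c * (\<Sum>j=1..p. \<tau> j))"
      using c by (simp add: \<kappa>_def sum_distrib_left field_simps)
    also have "\<dots> \<le> (real m * \<kappa>) * (1 / 2)"
      using \<kappa>0 by (intro mult_left_mono \<tau>_sum) auto
    finally show ?thesis by simp
  qed
  have nu: "vtnorm \<rho> d u \<le> 4 * e * (1 + \<Omega> * \<kappa> * real m)"
  proof -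
    let ?T = "\<lambda>k. \<Sum>j=1..p. mfps_const (L j $ k) * (mfps_var k * dird (gh j) wn)"
    have "tnorm \<rho> d (u $ k) \<le> tnorm \<rho> d (Vn $ k) + tnorm \<rho> d (?T k) + tnorm \<rho> d (u $ k) / 2" for k
    proof -
      have "tnorm \<rho> d (u $ k) = tnorm \<rho> d (Vn $ k + ?T k - (\<Sum>j=1..p. gh j * smult_by (axis k 1) (q j) (u $ k)))"
        using split(1)[of k] by (rule arg_cong)
      also have "\<dots> \<le> (tnorm \<rho> d (Vn $ k) + tnorm \<rho> d (?T k)) + tnorm \<rho> d (u $ k) / 2"
        by (intro order_trans[OF tnorm_diff_le[OF \<rho>]] add_mono tnorm_add_le[OF \<rho>] scaled
            intv_minus_axis_in_N)
      finally show ?thesis .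
    qed
    then have "vtnorm \<rho> d u \<le> (\<Sum>k\<in>UNIV. tnorm \<rho> d (Vn $ k) + tnorm \<rho> d (?T k) + tnorm \<rho> d (u $ k) / 2)"
      unfolding vtnorm_def by (rule sum_mono)
    also have "\<dots> = vtnorm \<rho> d Vn + (\<Sum>k\<in>UNIV. tnorm \<rho> d (?T k)) + vtnorm \<rho> d u / 2"
      by (simp add: vtnorm_def sum.distrib sum_divide_distrib)
    finally have "vtnorm \<rho> d u \<le> 2 * vtnorm \<rho> d Vn + 2 * (\<Sum>k\<in>UNIV. tnorm \<rho> d (?T k))" by simp
    also have "(\<Sum>k\<in>UNIV. tnorm \<rho> d (?T k)) \<le> \<Lambda> * (\<Sum>j=1..p. \<rho> * tnorm \<rho> d (dird (gh j) wn))"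
      using \<rho> \<Lambda>(1) by (rule vtnorm_tail_le)
    also have "\<dots> \<le> \<Lambda> * (\<Sum>j=1..p. 4 * e * \<Omega> * (real m * \<tau> j))"
    proof (intro mult_left_mono sum_mono \<Lambda>(2))
      fix j assume j: "j \<in> {1..p}"
      have "\<rho> * tnorm \<rho> d (dird (gh j) wn) \<le> \<rho> * (4 * e * \<Omega> * gnorm \<rho> d (gh j))"
        using \<rho> by (intro mult_left_mono na)
      also have "\<dots> = 4 * e * \<Omega> * (\<rho> * gnorm \<rho> d (gh j))" by (simp add: ac_simps)
      also have "\<dots> \<le> 4 * e * \<Omega> * (real m * \<tau> j)"
        using e0 \<Omega>(1) by (intro mult_left_mono \<tau>' j) auto
      finally show "\<rho> * tnorm \<rho> d (dird (gh j) wn) \<le> 4 * e * \<Omega> * (real m * \<tau> j)" .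
    qed
    also have "\<dots> = 4 * e * \<Omega> * (\<Lambda> * (\<Sum>j=1..p. real m * \<tau> j))"
      by (simp add: sum_distrib_left ac_simps)
    also have "\<dots> \<le> 4 * e * \<Omega> * (real m * \<kappa> / 2)"
      using e0 \<Omega>(1) by (intro mult_left_mono \<tau>_sum') auto
    finally show ?thesis using nVn by (simp add: algebra_simps)
  qed
  \<comment> \<open>the common bound for both parts of \<open>w\<close>: two factors \<open>\<Omega>\<close> for the two small divisors\<close>
  define W where "W = 4 * e * \<Omega> ^ 2 * real m * (1 + \<kappa>)"
  have W0: "W \<ge> 0" using e0 \<Omega>(1) \<kappa>0 by (simp add: W_def)
  have nwn: "vtnorm \<rho> d wn \<le> W"
  proof -
    have "wn = vmult_by iv u"
      by (intro vec_eq_iff[THEN iffD2] allI mfps_eqI) (simp add: u_def wn_def nonres_def iv_def)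
    moreover have "vtnorm \<rho> d (vmult_by iv u) \<le> \<Omega> * vtnorm \<rho> d u"
      by (rule vtnorm_vmult_by_le[OF \<rho>]) (rule inv_le[OF intv_minus_axis_in_N Qd(1)])
    ultimately have "vtnorm \<rho> d wn \<le> \<Omega> * vtnorm \<rho> d u" by (simp only:)
    also have "\<dots> \<le> \<Omega> * (4 * e * (1 + \<Omega> * \<kappa> * real m))"
      using nu \<Omega>(1) by (intro mult_left_mono) auto
    also have "\<dots> \<le> \<Omega> * (4 * e * (\<Omega> * real m * (1 + \<kappa>)))"
    proof (intro mult_left_mono)
      have "1 * 1 \<le> \<Omega> * real m" using \<Omega>(1) m by (intro mult_mono) auto
      then show "1 + \<Omega> * \<kappa> * real m \<le> \<Omega> * real m * (1 + \<kappa>)" by (simp add: algebra_simps)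
    qed (use e0 \<Omega>(1) in auto)
    finally show ?thesis by (simp add: W_def power2_eq_square ac_simps)
  qed
  have nw: "vtnorm \<rho> d w \<le> vtnorm \<rho> d wr + vtnorm \<rho> d wn"
  proof -
    have "w = wr + wn" by (simp add: vec_eq_iff wr_def wn_def res_add_nonres)
    then have "vtnorm \<rho> d w = vtnorm \<rho> d (wr + wn)" by (rule arg_cong)
    then show ?thesis using vtnorm_add_le[OF \<rho>] by (simp only:)
  qed
  have nwr: "vtnorm \<rho> d wr \<le> vtnorm \<rho> d w / 2"
  proof -
    have "tnorm \<rho> d (wr $ k) \<le> tnorm \<rho> d (dird (hm $ k) w)" for k
    proof -
      have "vmult_by (res lam) v $ k = 0" using v_nonres by simp
      then have "wr $ k + smult_by (axis k 1) (res lam) (dird (hm $ k) w) = 0"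
        by (simp add: v dird_add_left smult_by_add wr_def)
      then have "wr $ k = - smult_by (axis k 1) (res lam) (dird (hm $ k) w)"
        by (simp only: eq_neg_iff_add_eq_0)
      then have "tnorm \<rho> d (wr $ k) = tnorm \<rho> d (smult_by (axis k 1) (res lam) (dird (hm $ k) w))"
        by simp
      also have "\<dots> \<le> 1 * tnorm \<rho> d (dird (hm $ k) w)"
        using \<rho> by (rule tnorm_smult_by_le) (simp add: res_def)
      finally show ?thesis by simp
    qed
    then have "vtnorm \<rho> d wr \<le> (\<Sum>k\<in>UNIV. tnorm \<rho> d (dird (hm $ k) w))"
      unfolding vtnorm_def by (rule sum_mono)
    then show ?thesis using hm_dird[of w] by simp
  qed
  have wr: "vtnorm \<rho> d wr \<le> W" and w: "vtnorm \<rho> d w \<le> 2 * W" using nw nwr nwn by linarith+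
  have m2: "real m \<le> real m ^ 2" using m by (simp add: power2_eq_square)
  have "vtnorm \<rho> d v \<le> (\<Sum>k\<in>UNIV. tnorm \<rho> d (w $ k) + tnorm \<rho> d (dird (hm $ k) w))"
    unfolding vtnorm_def v using tnorm_add_le[OF \<rho>] by (intro sum_mono) (simp add: dird_add_left)
  also have "\<dots> \<le> 3 * W"
    using hm_dird[of w] w by (simp add: sum.distrib flip: vtnorm_def)
  also have "3 * W \<le> C * real m ^ 2 * \<Omega> ^ 2 * e"
  proof -
    have "(1 + \<kappa>) * real m \<le> (1 + \<kappa>) ^ 2 * real m ^ 2"
      using \<kappa>0 m2 by (intro mult_mono) (simp_all add: power2_eq_square)
    then have "12 * e * \<Omega> ^ 2 * ((1 + \<kappa>) * real m) \<le> 12 * e * \<Omega> ^ 2 * ((1 + \<kappa>) ^ 2 * real m ^ 2)"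
      using e0 by (intro mult_left_mono) auto
    then show ?thesis by (simp add: W_def C_def \<kappa>_def ac_simps)
  qed
  finally show "vtnorm \<rho> d v \<le> C * real m ^ 2 * \<Omega> ^ 2 * vtnorm \<rho> d E" by (simp only: e_def)
  let ?T = "\<lambda>k. \<Sum>j=1..p. mfps_const (L j $ k) * (mfps_var k * dird (gh j) wr)"
  have "vtnorm \<rho> d dG \<le> (\<Sum>k\<in>UNIV. tnorm \<rho> d (vmult_by (res lam) V $ k) + tnorm \<rho> d (?T k))"
    unfolding vtnorm_def
  proof (rule sum_mono)
    fix k
    have "dG $ k = vmult_by (res lam) V $ k + ?T k" using split(5)[of k] by simp
    then have "tnorm \<rho> d (dG $ k) = tnorm \<rho> d (vmult_by (res lam) V $ k + ?T k)" by (rule arg_cong)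
    then show "tnorm \<rho> d (dG $ k) \<le> tnorm \<rho> d (vmult_by (res lam) V $ k) + tnorm \<rho> d (?T k)"
      using tnorm_add_le[OF \<rho>] by (simp only:)
  qed
  also have "\<dots> = vtnorm \<rho> d (vmult_by (res lam) V) + (\<Sum>k\<in>UNIV. tnorm \<rho> d (?T k))"
    by (simp add: sum.distrib vtnorm_def)
  also have "vtnorm \<rho> d (vmult_by (res lam) V) \<le> 1 * vtnorm \<rho> d V"
    using \<rho> by (rule vtnorm_vmult_by_le) (simp add: res_def)
  also have "(\<Sum>k\<in>UNIV. tnorm \<rho> d (?T k)) \<le> \<Lambda> * (\<Sum>j=1..p. \<rho> * tnorm \<rho> d (dird (gh j) wr))"
    using \<rho> \<Lambda>(1) by (rule vtnorm_tail_le)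
  also have "\<dots> \<le> \<Lambda> * (\<Sum>j=1..p. (real m * \<tau> j) * W)"
  proof (intro mult_left_mono sum_mono \<Lambda>(2))
    fix j assume j: "j \<in> {1..p}"
    have "\<rho> * tnorm \<rho> d (dird (gh j) wr) \<le> \<rho> * (gnorm \<rho> d (gh j) * vtnorm \<rho> d wr)"
      using \<rho> by (intro mult_left_mono tnorm_dird_le)
    also have "\<dots> = (\<rho> * gnorm \<rho> d (gh j)) * vtnorm \<rho> d wr" by simp
    also have "\<dots> \<le> (real m * \<tau> j) * W"
      using \<rho> wr order_trans[OF _ \<tau>'[OF j], of 0] by (intro mult_mono \<tau>' j) auto
    finally show "\<rho> * tnorm \<rho> d (dird (gh j) wr) \<le> (real m * \<tau> j) * W" .
  qed
  also have "\<dots> = (\<Lambda> * (\<Sum>j=1..p. real m * \<tau> j)) * W" by (simp add: sum_distrib_right)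
  also have "\<dots> \<le> (real m * \<kappa> / 2) * W" using W0 \<tau>_sum' by (intro mult_right_mono)
  finally have "vtnorm \<rho> d dG \<le> 2 * e + (real m * \<kappa> / 2) * W" using nV by simp
  also have "\<dots> \<le> C * real m ^ 2 * \<Omega> ^ 2 * e"
  proof -
    define M where "M = real m ^ 2 * \<Omega> ^ 2"
    have "1 * 1 \<le> M" unfolding M_def using m \<Omega>(1) by (intro mult_mono) auto
    then have "2 * e * 1 \<le> 2 * e * M" using e0 by (intro mult_left_mono) auto
    moreover have "(real m * \<kappa> / 2) * W = 2 * e * M * (\<kappa> * (1 + \<kappa>))"
      by (simp add: W_def M_def power2_eq_square)
    moreover have "2 * e * M * (1 + \<kappa> * (1 + \<kappa>)) = 2 * e * M + 2 * e * M * (\<kappa> * (1 + \<kappa>))"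
      by (simp only: distrib_left[of "2 * e * M"] mult_1_right)
    ultimately have "2 * e + (real m * \<kappa> / 2) * W \<le> 2 * e * M * (1 + \<kappa> * (1 + \<kappa>))"
      by linarith
    also have "\<dots> \<le> 2 * e * M * (6 * (1 + \<kappa>) ^ 2)"
    proof (rule mult_left_mono)
      have "0 \<le> \<kappa> * \<kappa>" using \<kappa>0 by simp
      then show "1 + \<kappa> * (1 + \<kappa>) \<le> 6 * (1 + \<kappa>) ^ 2"
        using \<kappa>0 by (simp add: power2_eq_square algebra_simps)
      show "0 \<le> 2 * e * M" using e0 by (simp add: M_def)
    qed
    finally show ?thesis by (simp add: C_def M_def \<kappa>_def ac_simps)
  qed
  finally show "vtnorm \<rho> d dG \<le> C * real m ^ 2 * \<Omega> ^ 2 * vtnorm \<rho> d E" by (simp only: e_def)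
qed

text \<open>Linear independence of the \<open>L j\<close> makes each coefficient a linear function of the combination. This is
how a bound for the normal form yields bounds for the series \<open>g j\<close>.\<close>

lemma independent_coefficients_bounded:
  fixes L :: "nat \<Rightarrow> complex ^ 'n::finite"
  assumes inj: "inj_on L {1..p}" and indep: "vec.independent (L ` {1..p})"
  obtains K where "0 \<le> K" "\<And>\<beta> j. j \<in> {1..p} \<Longrightarrow>
    cmod (\<beta> j) \<le> K * (\<Sum>k\<in>UNIV. cmod (\<Sum>i=1..p. \<beta> i * L i $ k))"
proof -
  let ?s = "\<lambda>\<beta>. \<Sum>k\<in>UNIV. cmod (\<Sum>i=1..p. \<beta> i * L i $ k)"
  have "\<exists>K\<ge>0. \<forall>\<beta>. cmod (\<beta> j) \<le> K * ?s \<beta>"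
    if j: "j \<in> {1..p}" for j
  proof -
    obtain f where lin: "Vector_Spaces.linear (*s) (*s) f"
      and f: "\<And>x. x \<in> L ` {1..p} \<Longrightarrow> f x = (if x = L j then 1 else 0 :: complex ^ 'n)"
      using vec.linear_independent_extend[OF indep, of "\<lambda>x. if x = L j then 1 else 0"] by blast
    interpret f: Vector_Spaces.linear "(*s)" "(*s)" f by (rule lin)
    obtain i0 :: 'n where True by blast
    define K where "K = (\<Sum>k\<in>UNIV. cmod (matrix f $ i0 $ k))"
    have "cmod (\<beta> j) \<le> K * ?s \<beta>" for \<beta>
    proof -
      define v where "v = (\<Sum>i=1..p. \<beta> i *s L i)"
      have vk: "v $ k = (\<Sum>i=1..p. \<beta> i * L i $ k)" for k by (simp add: v_def)
      have "f v = (\<Sum>i=1..p. \<beta> i *s f (L i))" by (simp add: v_def f.sum f.scale)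
      also have "\<dots> = (\<Sum>i=1..p. if i = j then \<beta> j *s 1 else 0)"
        using inj j by (intro sum.cong refl) (auto simp: f inj_on_eq_iff)
      also have "\<dots> = \<beta> j *s 1" using j by simp
      finally have "\<beta> j = f v $ i0" by simp
      also have "\<dots> = (\<Sum>k\<in>UNIV. matrix f $ i0 $ k * v $ k)"
        by (simp add: matrix_vector_mult_def flip: matrix_works[OF lin])
      finally have "cmod (\<beta> j) \<le> (\<Sum>k\<in>UNIV. cmod (matrix f $ i0 $ k * v $ k))"
        by (simp add: norm_sum)
      also have "\<dots> \<le> (\<Sum>k\<in>UNIV. cmod (matrix f $ i0 $ k) * (\<Sum>l\<in>UNIV. cmod (v $ l)))"
        unfolding norm_mult by (intro sum_mono mult_left_mono member_le_sum) auto
      finally show ?thesis by (simp add: K_def vk sum_distrib_right)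
    qed
    moreover have "K \<ge> 0" unfolding K_def by (intro sum_nonneg) simp
    ultimately show ?thesis by blast
  qed
  then have "\<forall>j\<in>{1..p}. \<exists>K. K \<ge> 0 \<and> (\<forall>\<beta>. cmod (\<beta> j) \<le> K * ?s \<beta>)"
    by blast
  from bchoice[OF this] obtain K where K: "\<And>j. j \<in> {1..p} \<Longrightarrow> K j \<ge> 0" "\<And>j \<beta>. j \<in> {1..p} \<Longrightarrow>
      cmod (\<beta> j) \<le> K j * ?s \<beta>"
    by blast
  show ?thesis
  proof
    show "0 \<le> (\<Sum>j=1..p. K j)" using K(1) by (rule sum_nonneg)
    fix \<beta> :: "nat \<Rightarrow> complex" and j assume j: "j \<in> {1..p}"
    have "K j \<le> (\<Sum>j=1..p. K j)" using j K(1) by (intro member_le_sum) auto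
    then have "K j * ?s \<beta> \<le>
        (\<Sum>j=1..p. K j) * ?s \<beta>"
      by (intro mult_right_mono sum_nonneg) auto
    then show "cmod (\<beta> j) \<le> (\<Sum>j=1..p. K j) * ?s \<beta>"
      using K(2)[OF j] by (rule order_trans[rotated])
  qed
qed

lemma special_linear_part:
  assumes "fvf_diag lam + r = special_field p L g" "vord_ge 2 r"
  shows "(\<Sum>j=1..p. mfps_nth (g j) 0 * L j $ k) = lam $ k"
proof -
  have "mfps_nth (r $ k) (axis k 1) = 0"
    using ord_geD[OF vord_geD[OF assms(2)], of "axis k 1" k] by simp
  moreover have "mfps_nth ((fvf_diag lam + r) $ k) (axis k 1) = mfps_nth (special_field p L g $ k) (axis k 1)"
    by (simp only: assms(1))
  moreover have "axis k (Suc 0) $ k = Suc 0" by (simp add: axis_def)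
  ultimately have "(\<Sum>j=1..p. L j $ k * mfps_nth (g j) 0) = lam $ k"
    by (simp add: special_field_nth mfps_nth_var)
  then show ?thesis by (simp only: mult.commute)
qed

text \<open>The coefficients of the \<open>g j\<close> at \<open>P\<close> are read off from the coefficients of \<open>r $ k\<close> at \<open>P + axis k 1\<close>, hence
the factor \<open>\<rho>\<close> and the cut-off at degree \<open>m - 1\<close>.\<close>

lemma special_coeff_bound:
  fixes r :: "'n::finite fvf"
  assumes eq: "fvf_diag lam + r = special_field p L g" and r: "vord_ge 2 r"
    and K: "0 \<le> K" "\<And>\<beta> j. j \<in> {1..p} \<Longrightarrow>
      cmod (\<beta> j) \<le> K * (\<Sum>k\<in>UNIV. cmod (\<Sum>i=1..p. \<beta> i * L i $ k))"
    and \<rho>: "0 \<le> \<rho>" and m: "m \<ge> 1" and j: "j \<in> {1..p}"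
  shows "\<rho> * tnorm \<rho> (m - 1) (g j - mfps_const (mfps_nth (g j) 0)) \<le> K * vtnorm \<rho> m r"
proof -
  define gh where "gh j = g j - mfps_const (mfps_nth (g j) 0)" for j
  have coeff: "(\<Sum>i=1..p. mfps_nth (gh i) P * L i $ k) = mfps_nth (r $ k) (P + axis k 1)" for P k
  proof (cases "P = 0")
    case True
    have "mfps_nth (r $ k) (axis k 1) = 0"
      using ord_geD[OF vord_geD[OF r], of "axis k 1" k] by simp
    then show ?thesis using True by (simp add: gh_def mfps_nth_const)
  next
    case False
    have "mfps_nth ((fvf_diag lam + r) $ k) (P + axis k 1) =
        mfps_nth (special_field p L g $ k) (P + axis k 1)" by (simp only: eq)
    moreover have "(P + axis k 1) $ k \<noteq> 0" by (simp add: axis_def)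
    ultimately show ?thesis
      using False by (simp add: special_field_nth mfps_nth_var gh_def mfps_nth_const mult.commute)
  qed
  have "\<rho> * tnorm \<rho> (m - 1) (gh j) =
      (\<Sum>P | mdegree P \<le> m - 1. cmod (mfps_nth (gh j) P) * \<rho> ^ (mdegree P + 1))"
    by (simp add: tnorm_def sum_distrib_left ac_simps)
  also have "\<dots> \<le> (\<Sum>P | mdegree P \<le> m - 1.
      (K * (\<Sum>k\<in>UNIV. cmod (mfps_nth (r $ k) (P + axis k 1)))) * \<rho> ^ (mdegree P + 1))"
  proof (intro sum_mono mult_right_mono)
    fix P
    show "cmod (mfps_nth (gh j) P) \<le> K * (\<Sum>k\<in>UNIV. cmod (mfps_nth (r $ k) (P + axis k 1)))"
      using K(2)[OF j, of "\<lambda>i. mfps_nth (gh i) P"] by (simp only: coeff)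
  qed (use \<rho> in simp)
  also have "\<dots> = K * (\<Sum>k\<in>UNIV. \<Sum>P | mdegree P \<le> m - 1.
      cmod (mfps_nth (r $ k) (P + axis k 1)) * \<rho> ^ mdegree (P + axis k 1))"
    by (subst sum.swap) (simp add: sum_distrib_left sum_distrib_right mult.assoc)
  also have "\<dots> \<le> K * vtnorm \<rho> m r"
    unfolding vtnorm_def
  proof (intro mult_left_mono sum_mono K(1))
    fix k :: 'n
    let ?s = "\<lambda>P. P + axis k 1 :: nat ^ 'n"
    have "(\<Sum>P | mdegree P \<le> m - 1. cmod (mfps_nth (r $ k) (?s P)) * \<rho> ^ mdegree (?s P)) =
        (\<Sum>P \<in> ?s ` {P. mdegree P \<le> m - 1}. cmod (mfps_nth (r $ k) P) * \<rho> ^ mdegree P)"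
      by (subst sum.reindex) (auto simp: inj_on_def)
    also have "\<dots> \<le> tnorm \<rho> m (r $ k)"
      unfolding tnorm_def using \<rho> m by (intro sum_mono2 finite_mdegree_le) auto
    finally show "(\<Sum>P | mdegree P \<le> m - 1. cmod (mfps_nth (r $ k) (?s P)) * \<rho> ^ mdegree (?s P))
        \<le> tnorm \<rho> m (r $ k)" .
  qed
  finally show ?thesis by (simp add: gh_def)
qed

lemma special_field_trunc:
  assumes eq: "fvf_diag lam + r = special_field p L g" and m: "m \<ge> 1"
  shows "fvf_diag lam + vtrunc m r = special_field p L (\<lambda>j. mfps_const (mfps_nth (g j) 0)
    + trunc (m - 1) (g j - mfps_const (mfps_nth (g j) 0)))" (is "_ = special_field p L ?g")
proof (unfold vec_eq_iff, intro allI mfps_eqI)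
  fix k P
  have eqP: "mfps_nth ((fvf_diag lam + r) $ k) P = mfps_nth (special_field p L g $ k) P"
    by (simp only: eq)
  have trunc: "mfps_nth (?g j) Q = (if mdegree Q \<le> m - 1 then mfps_nth (g j) Q else 0)" for j Q
    by (auto simp: mfps_nth_const)
  show "mfps_nth ((fvf_diag lam + vtrunc m r) $ k) P = mfps_nth (special_field p L ?g $ k) P"
  proof (cases "P $ k = 0")
    case True
    then have "P \<noteq> axis k 1" by (auto simp: axis_def)
    then show ?thesis using eqP True by (simp add: special_field_nth mfps_nth_var)
  next
    case False
    then obtain R where P: "P = R + axis k 1" using obtain_minus_axis by blast
    show ?thesis
    proof (cases "mdegree P \<le> m")
      case True
      then have "mdegree R \<le> m - 1" using m by (simp add: P)
      then show ?thesis
        using eqP True False unfolding special_field_nth trunc by (simp add: P)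
    next
      case far: False
      then have "\<not> mdegree R \<le> m - 1" "P \<noteq> axis k 1" using m by (auto simp: P)
      then show ?thesis
        using False far unfolding special_field_nth trunc by (simp add: P mfps_nth_var)
    qed
  qed
qed

lemma vord_ge_2D: "vord_ge 2 h \<Longrightarrow> ord_ge (Suc 0) (h $ i)"
  using vord_geD[of 2 h i] by (rule ord_ge_mono) auto

text \<open>Divided by \<open>\<rho>\<close>, both terms are scale invariant: the first bounds the Jacobian of \<open>h\<close>, the second
the nonlinear part of the normal form relative to its linear part. The weight \<open>\<mu>\<close> will be so large
that a size of at most \<open>1/2\<close> makes the perturbations in the block estimate small.\<close>

definition block_size :: "real \<Rightarrow> real \<Rightarrow> nat \<Rightarrow> 'n::finite fvf \<Rightarrow> 'n fvf \<Rightarrow> real"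
  where "block_size \<mu> \<rho> m h r = ((\<Sum>i\<in>UNIV. dnorm \<rho> m (h $ i)) + \<mu> * vtnorm \<rho> m r) / \<rho>"

lemma sum_degree_split:
  fixes a :: "nat ^ 'n::finite \<Rightarrow> real"
  assumes "m \<le> m'"
  shows "(\<Sum>P | mdegree P \<le> m'. a P) =
    (\<Sum>P | mdegree P \<le> m. a P) + (\<Sum>P | mdegree P \<le> m'. if mdegree P \<le> m then 0 else a P)"
proof -
  have "(\<Sum>P | mdegree P \<le> m. a P) = (\<Sum>P | mdegree P \<le> m'. if mdegree P \<le> m then a P else 0)"
    by (rule sum.mono_neutral_cong_left) (use assms in \<open>auto simp: finite_mdegree_le\<close>)
  moreover have "(\<Sum>P | mdegree P \<le> m'. a P) = (\<Sum>P | mdegree P \<le> m'. if mdegree P \<le> m then a P else 0)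
      + (\<Sum>P | mdegree P \<le> m'. if mdegree P \<le> m then 0 else a P)"
    unfolding sum.distrib[symmetric] by (rule sum.cong) auto
  ultimately show ?thesis by simp
qed

lemma tnorm_split: "m \<le> m' \<Longrightarrow> tnorm \<rho> m' f = tnorm \<rho> m f + tnorm \<rho> m' (trunc m' f - trunc m f)"
  unfolding tnorm_def by (subst sum_degree_split[of m m']) (auto intro!: sum.cong)

lemma dnorm_split: "m \<le> m' \<Longrightarrow> dnorm \<rho> m' f = dnorm \<rho> m f + dnorm \<rho> m' (trunc m' f - trunc m f)"
  unfolding dnorm_def by (subst sum_degree_split[of m m']) (auto intro!: sum.cong)

lemma dnorm_nonneg [simp]: "0 \<le> \<rho> \<Longrightarrow> 0 \<le> dnorm \<rho> d f"
  unfolding dnorm_def by (intro sum_nonneg) simp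

lemma dnorm_shrink:
  fixes f :: "(complex, 'n::finite) mfps"
  assumes f: "ord_ge (Suc 0) f" and \<rho>: "0 \<le> \<rho>" and \<theta>: "0 \<le> \<theta>" "\<theta> \<le> 1"
  shows "dnorm (\<theta> * \<rho>) d f \<le> \<theta> * dnorm \<rho> d f"
  unfolding dnorm_def sum_distrib_left
proof (rule sum_mono)
  fix P :: "nat ^ 'n"
  let ?a = "real (mdegree P) * (cmod (mfps_nth f P) * \<rho> ^ mdegree P)"
  show "real (mdegree P) * (cmod (mfps_nth f P) * (\<theta> * \<rho>) ^ mdegree P) \<le> \<theta> * ?a"
  proof (cases "mdegree P = 0")
    case False
    then have "\<theta> ^ mdegree P \<le> \<theta> ^ 1" using \<theta> by (intro power_decreasing) auto
    then have "\<theta> ^ mdegree P * ?a \<le> \<theta> ^ 1 * ?a" using \<rho> by (intro mult_right_mono) auto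
    then show ?thesis by (simp add: power_mult_distrib ac_simps)
  qed simp
qed

lemma block_size_shrink:
  assumes h: "vord_ge 2 h" and r: "vord_ge 2 r" and \<rho>: "0 < \<rho>" and \<theta>: "0 < \<theta>" "\<theta> \<le> 1" and \<mu>: "0 \<le> \<mu>"
  shows "block_size \<mu> (\<theta> * \<rho>) m h r \<le> block_size \<mu> \<rho> m h r"
proof -
  let ?h = "\<Sum>i\<in>UNIV. dnorm \<rho> m (h $ i)" and ?h' = "\<Sum>i\<in>UNIV. dnorm (\<theta> * \<rho>) m (h $ i)"
  have 1: "?h' \<le> \<theta> * ?h"
    unfolding sum_distrib_left using \<rho> \<theta> by (intro sum_mono dnorm_shrink vord_ge_2D[OF h]) auto
  have 2: "vtnorm (\<theta> * \<rho>) m r \<le> \<theta> * vtnorm \<rho> m r"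
    unfolding vtnorm_def sum_distrib_left
  proof (rule sum_mono)
    fix i
    have "ord_ge 1 (r $ i)" using vord_geD[OF r, of i] by (rule ord_ge_mono) simp
    then show "tnorm (\<theta> * \<rho>) m (r $ i) \<le> \<theta> * tnorm \<rho> m (r $ i)"
      using tnorm_shrink[of 1 "r $ i" \<rho> \<theta> m] \<rho> \<theta> by simp
  qed
  have "?h' + \<mu> * vtnorm (\<theta> * \<rho>) m r \<le>
      \<theta> * (?h + \<mu> * vtnorm \<rho> m r)"
    using add_mono[OF 1 mult_left_mono[OF 2 \<mu>]] by (simp add: distrib_left ac_simps)
  then have "block_size \<mu> (\<theta> * \<rho>) m h r \<le> \<theta> * (?h + \<mu> * vtnorm \<rho> m r) / (\<theta> * \<rho>)"
    unfolding block_size_def using \<rho> \<theta> by (intro divide_right_mono) auto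
  also have "\<dots> = block_size \<mu> \<rho> m h r"
    unfolding block_size_def using \<theta> by simp
  finally show ?thesis .
qed

text \<open>When the radius shrinks by the factor \<open>\<theta>\<close>, passing from degree \<open>m\<close> to \<open>2 m\<close> costs at most the last summand.
The parameter \<open>\<Omega>\<close> stands for a bound of the inverse small divisors in the block.\<close>

definition block_growth_bound ::
    "complex ^ 'n \<Rightarrow> 'n::finite fvf \<Rightarrow> 'n fvf \<Rightarrow> real \<Rightarrow> real \<Rightarrow> real \<Rightarrow> bool"
  where "block_growth_bound lam h r R \<mu> C \<longleftrightarrow>
    (\<forall>m \<rho> \<theta> \<Omega>. m \<ge> 1 \<longrightarrow> 0 < \<rho> \<longrightarrow> 2 * \<rho> \<le> R \<longrightarrow> 0 < \<theta> \<longrightarrow> \<theta> \<le> 1 \<longrightarrow> 1 \<le> \<Omega> \<longrightarrow>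
      (\<forall>Q\<in>N_all. Q_norm Q \<le> int (2 * m) \<longrightarrow> pairing Q lam \<noteq> 0 \<longrightarrow> 1 \<le> \<Omega> * cmod (pairing Q lam)) \<longrightarrow>
      block_size \<mu> \<rho> m h r \<le> 1 / 2 \<longrightarrow>
      block_size \<mu> (\<theta> * \<rho>) (2 * m) h r \<le>
        block_size \<mu> \<rho> m h r + C * real m ^ 3 * \<Omega> ^ 2 * \<theta> ^ m)"

text \<open>The error \<open>E\<close> is estimated at radius \<open>\<rho>\<close> by a multiple of \<open>\<rho>\<close>, from bounds on \<open>Fs\<close>, on the
Jacobian and on the normal form, and then transferred to the smaller radius, where the block estimate
applies.\<close>

lemma block_growth:
  fixes Fs h r :: "'n::finite fvf" and lam :: "complex ^ 'n"
  assumes F1: "vord_ge (Suc 0) Fs" and h: "vord_ge 2 h" and r: "vord_ge 2 r"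
    and conj: "\<And>i. dird ((idf + h) $ i) (fvf_diag lam + r) = mfps_compose (Fs $ i) (idf + h)"
    and h_nonres: "vmult_by (res lam) h = 0" and r_res: "resonant lam r"
    and special: "fvf_diag lam + r = special_field p L g" and g: "\<And>j. has_weight lam 0 (g j)"
    and c: "0 < c"
    and hull: "\<And>j Q. j \<in> {1..p} \<Longrightarrow> Q \<in> N_all \<Longrightarrow> cmod (pairing Q (L j)) \<le> c * cmod (pairing Q lam)"
    and indep: "inj_on L {1..p}" "vec.independent (L ` {1..p})"
    and R: "0 < R" and CF: "\<And>d. vtnorm R d Fs \<le> CF"
  obtains \<mu> C where "0 \<le> \<mu>" "0 < C" "block_growth_bound lam h r R \<mu> C"
proof -
  obtain K where K: "0 \<le> K" "\<And>\<beta> j. j \<in> {1..p} \<Longrightarrow>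
      cmod (\<beta> j) \<le> K * (\<Sum>k\<in>UNIV. cmod (\<Sum>i=1..p. \<beta> i * L i $ k))"
    using independent_coefficients_bounded[OF indep] by blast
  define \<Lambda> where "\<Lambda> = (\<Sum>j=1..p. \<Sum>k\<in>UNIV. cmod (L j $ k))"
  have \<Lambda>: "(\<Sum>k\<in>UNIV. cmod (L j $ k)) \<le> \<Lambda>" if "j \<in> {1..p}" for j
    unfolding \<Lambda>_def using that
    by (intro member_le_sum[where f = "\<lambda>j. \<Sum>k\<in>UNIV. cmod (L j $ k)"] sum_nonneg) auto
  have \<Lambda>0: "\<Lambda> \<ge> 0" unfolding \<Lambda>_def by (intro sum_nonneg) auto
  have CF0: "CF \<ge> 0" using order_trans[OF vtnorm_nonneg[of R 0 Fs] CF[of 0]] R by simp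
  \<comment> \<open>the first summand makes the sum of the \<open>\<tau>\<close> below small, the second gives \<open>\<mu> \<ge> 1\<close>\<close>
  define \<mu> where "\<mu> = c * real p * K + 1"
  have \<mu>: "\<mu> \<ge> 1" using c K(1) by (simp add: \<mu>_def)
  let ?lam = "\<Sum>i\<in>UNIV. cmod (lam $ i)"
  define CE where "CE = 2 * CF / R + 2 * (?lam + 1)"
  have CE: "CE > 0"
    using CF0 R sum_nonneg[of UNIV "\<lambda>i. cmod (lam $ i)"] by (simp add: CE_def add_nonneg_pos)
  define C1 where "C1 = 12 * (1 + \<Lambda> / c) ^ 2"
  have "0 < 1 + \<Lambda> / c" using \<Lambda>0 c by (intro add_pos_nonneg) auto
  then have C1: "C1 > 0" by (simp add: C1_def)
  define C where "C = (2 + \<mu>) * C1 * CE"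
  have C: "C > 0" using \<mu> C1 CE by (simp add: C_def)
  define gh where "gh m j = trunc (m - 1) (g j - mfps_const (mfps_nth (g j) 0))" for m j
  have gh: "has_weight lam 0 (gh m j)" for m j
    using g[of j] by (auto simp: has_weight_def gh_def mfps_nth_const split: if_splits)
  have main: "block_size \<mu> (\<theta> * \<rho>) (2 * m) h r \<le> block_size \<mu> \<rho> m h r + C * real m ^ 3 * \<Omega> ^ 2 * \<theta> ^ m"
    if m: "m \<ge> 1" and \<rho>: "0 < \<rho>" "2 * \<rho> \<le> R" and \<theta>: "0 < \<theta>" "\<theta> \<le> 1" and \<Omega>: "1 \<le> \<Omega>"
      "\<forall>Q\<in>N_all. Q_norm Q \<le> int (2 * m) \<longrightarrow> pairing Q lam \<noteq> 0 \<longrightarrow> 1 \<le> \<Omega> * cmod (pairing Q lam)"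
      and size: "block_size \<mu> \<rho> m h r \<le> 1 / 2" for m \<rho> \<theta> \<Omega>
  proof -
    let ?d = "2 * m"
    define \<sigma> where "\<sigma> = \<theta> * \<rho>"
    have \<sigma>: "0 < \<sigma>" using \<rho> \<theta> by (simp add: \<sigma>_def)
    define hm where "hm = vtrunc m h"
    define H where "H = idf + hm"
    define G where "G = fvf_diag lam + vtrunc m r"
    define dh where "dh = vtrunc ?d h - hm"
    define dG where "dG = vtrunc ?d r - vtrunc m r"
    define E where "E = (\<chi> i. mfps_compose (Fs $ i) H - dird (H $ i) G)"
    obtain w where w: "\<And>k. dh $ k = dird (H $ k) w" "vord_ge (Suc m) E"
      "\<And>i. ord_ge (Suc ?d) (E $ i - dird (H $ i) (\<chi> k. dird (w $ k) G - dird (G $ k) w + dG $ k))"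
      by (rule newton_block[OF F1 h r m conj, folded hm_def, folded H_def G_def dh_def dG_def, folded E_def])
        (rule that)
    have size_bounds: "(\<Sum>i\<in>UNIV. gnorm \<rho>' d (hm $ i)) \<le> 1 / 2" "\<mu> * vtnorm \<rho>' m r \<le> \<rho>' / 2"
      if \<rho>': "0 < \<rho>'" and s: "block_size \<mu> \<rho>' m h r \<le> 1 / 2" for \<rho>' d
    proof -
      let ?h = "\<Sum>i\<in>UNIV. dnorm \<rho>' m (h $ i)" and ?g = "\<Sum>i\<in>UNIV. gnorm \<rho>' d (hm $ i)"
      have s': "?h + \<mu> * vtnorm \<rho>' m r \<le> \<rho>' / 2"
        using s \<rho>' by (simp add: block_size_def divide_le_eq)
      moreover have "0 \<le> \<mu> * vtnorm \<rho>' m r" using \<mu> \<rho>' by simp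
      moreover have "\<rho>' * ?g \<le> ?h"
        unfolding sum_distrib_left hm_def vtrunc_nth using \<rho>' by (intro sum_mono gnorm_trunc_le) simp
      ultimately have "\<rho>' * ?g \<le> \<rho>' * (1 / 2)" by linarith
      then show "?g \<le> 1 / 2"
        using \<rho>' by (simp only: mult_le_cancel_left_pos)
      have "0 \<le> ?h" using \<rho>' by (intro sum_nonneg) simp
      then show "\<mu> * vtnorm \<rho>' m r \<le> \<rho>' / 2" using s' by linarith
    qed
    have size': "block_size \<mu> \<sigma> m h r \<le> block_size \<mu> \<rho> m h r"
      unfolding \<sigma>_def using h r \<rho> \<theta> \<mu> by (intro block_size_shrink) auto
    then have size'': "block_size \<mu> \<sigma> m h r \<le> 1 / 2" using size by linarith
    have nE: "vtnorm \<rho> ?d E \<le> CE * \<rho>"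
    proof -
      have r1: "vtnorm \<rho> m r \<le> \<rho>"
      proof -
        have "1 * vtnorm \<rho> m r \<le> \<mu> * vtnorm \<rho> m r" using \<mu> \<rho> by (intro mult_right_mono) auto
        then show ?thesis using size_bounds(2)[OF \<rho>(1) size] \<rho> by linarith
      qed
      have Hk: "tnorm \<rho> ?d (H $ k) \<le> 2 * \<rho>" for k
      proof -
        have "tnorm \<rho> ?d (H $ k) \<le> tnorm \<rho> ?d (mfps_var k) + tnorm \<rho> ?d (trunc m (h $ k))"
          unfolding H_def hm_def vector_add_component idf_nth vtrunc_nth
          by (rule tnorm_add_le[OF less_imp_le[OF \<rho>(1)]])
        also have "\<dots> \<le> \<rho> + tnorm \<rho> m (h $ k)"
          using \<rho> by (intro add_mono tnorm_var_le tnorm_trunc_le) auto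
        also have "tnorm \<rho> m (h $ k) \<le> dnorm \<rho> m (h $ k)"
          using \<rho> by (intro tnorm_le_dnorm vord_ge_2D[OF h]) simp
        also have "\<dots> \<le> (\<Sum>i\<in>UNIV. dnorm \<rho> m (h $ i))"
          using \<rho> by (intro member_le_sum) auto
        also have "\<dots> \<le> (\<Sum>i\<in>UNIV. dnorm \<rho> m (h $ i)) + \<mu> * vtnorm \<rho> m r" using \<mu> \<rho> by simp
        also have "\<dots> \<le> \<rho> / 2" using size \<rho> by (simp add: block_size_def divide_le_eq)
        finally show ?thesis using \<rho> by simp
      qed
      have H1: "vord_ge (Suc 0) H"
        unfolding H_def hm_def by (intro vord_ge_idf_add vord_ge_vtrunc h)
      have "(\<Sum>i\<in>UNIV. tnorm \<rho> ?d (mfps_compose (Fs $ i) H)) \<le> (\<Sum>i\<in>UNIV. tnorm (2 * \<rho>) ?d (Fs $ i))"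
        using \<rho> by (intro sum_mono tnorm_compose_le H1 Hk) simp
      also have "\<dots> \<le> (\<Sum>i\<in>UNIV. (2 * \<rho> / R) * tnorm R ?d (Fs $ i))"
      proof (rule sum_mono)
        fix i
        show "tnorm (2 * \<rho>) ?d (Fs $ i) \<le> (2 * \<rho> / R) * tnorm R ?d (Fs $ i)"
          using tnorm_shrink[OF vord_geD[OF F1, of i], of R "2 * \<rho> / R" ?d] \<rho> R by simp
      qed
      also have "\<dots> = (2 * \<rho> / R) * vtnorm R ?d Fs" by (simp add: vtnorm_def sum_distrib_left)
      also have "\<dots> \<le> (2 * \<rho> / R) * CF" using \<rho> R by (intro mult_left_mono CF) auto
      finally have 1: "(\<Sum>i\<in>UNIV. tnorm \<rho> ?d (mfps_compose (Fs $ i) H)) \<le> (2 * \<rho> / R) * CF" .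
      have nG: "vtnorm \<rho> ?d G \<le> (?lam + 1) * \<rho>"
      proof -
        have "vtnorm \<rho> ?d G \<le> vtnorm \<rho> ?d (fvf_diag lam) + vtnorm \<rho> ?d (vtrunc m r)"
          unfolding G_def using \<rho> by (intro vtnorm_add_le) simp
        also have "vtnorm \<rho> ?d (fvf_diag lam) \<le> (\<Sum>i\<in>UNIV. cmod (lam $ i) * \<rho>)"
          unfolding vtnorm_def fvf_diag_nth tnorm_const_mult
          using \<rho> by (intro sum_mono mult_left_mono tnorm_var_le) auto
        also have "vtnorm \<rho> ?d (vtrunc m r) \<le> \<rho>"
          using vtnorm_vtrunc_le[of \<rho> ?d m r] r1 \<rho> by simp
        finally show ?thesis by (simp add: distrib_right sum_distrib_right)
      qed
      have "(\<Sum>i\<in>UNIV. tnorm \<rho> ?d (dird (H $ i) G)) \<le>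
          (\<Sum>i\<in>UNIV. tnorm \<rho> ?d (G $ i) + tnorm \<rho> ?d (dird (hm $ i) G))"
        unfolding H_def using \<rho> by (intro sum_mono) (simp add: dird_add_left tnorm_add_le)
      also have "\<dots> = vtnorm \<rho> ?d G + (\<Sum>i\<in>UNIV. tnorm \<rho> ?d (dird (hm $ i) G))"
        by (simp add: sum.distrib vtnorm_def)
      also have "(\<Sum>i\<in>UNIV. tnorm \<rho> ?d (dird (hm $ i) G)) \<le> (\<Sum>i\<in>UNIV. gnorm \<rho> ?d (hm $ i)) * vtnorm \<rho> ?d G"
        using \<rho> by (intro vtnorm_dird_le) simp
      also have "\<dots> \<le> 1 * vtnorm \<rho> ?d G"
        using size_bounds(1)[OF \<rho>(1) size, of ?d] \<rho> by (intro mult_right_mono) auto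
      finally have 2: "(\<Sum>i\<in>UNIV. tnorm \<rho> ?d (dird (H $ i) G)) \<le> 2 * ((?lam + 1) * \<rho>)"
        using nG by linarith
      have "vtnorm \<rho> ?d E \<le> (\<Sum>i\<in>UNIV. tnorm \<rho> ?d (mfps_compose (Fs $ i) H) + tnorm \<rho> ?d (dird (H $ i) G))"
        unfolding vtnorm_def E_def using \<rho> by (intro sum_mono) (simp add: tnorm_diff_le)
      also have "\<dots> \<le> (2 * \<rho> / R) * CF + 2 * ((?lam + 1) * \<rho>)"
        unfolding sum.distrib by (rule add_mono[OF 1 2])
      also have "\<dots> = CE * \<rho>" by (simp add: CE_def algebra_simps)
      finally show ?thesis .
    qed
    have e: "vtnorm \<sigma> ?d E \<le> \<theta> ^ m * CE * \<sigma>"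
    proof -
      have "vtnorm \<sigma> ?d E \<le> \<theta> ^ Suc m * vtnorm \<rho> ?d E"
        unfolding vtnorm_def sum_distrib_left \<sigma>_def using \<rho> \<theta> vord_geD[OF w(2)]
        by (intro sum_mono tnorm_shrink) auto
      also have "\<dots> \<le> \<theta> ^ Suc m * (CE * \<rho>)" using \<theta> by (intro mult_left_mono nE) auto
      finally show ?thesis by (simp add: \<sigma>_def ac_simps)
    qed
    \<comment> \<open>the common bound for the nonconstant parts of the \<open>g j\<close>\<close>
    define \<tau> where "\<tau> = K * vtnorm \<sigma> m r / \<sigma>"
    have \<tau>1: "tnorm \<sigma> (m - 1) (g j - mfps_const (mfps_nth (g j) 0)) \<le> \<tau>" if "j \<in> {1..p}" for j
      using special_coeff_bound[OF special r K _ m that, of \<sigma>] \<sigma>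
      by (simp add: \<tau>_def le_divide_eq mult.commute)
    have Gspecial: "G = special_field p L (\<lambda>j. mfps_const (mfps_nth (g j) 0) + gh m j)"
      unfolding G_def gh_def by (rule special_field_trunc[OF special m])
    have dG: "resonant lam dG"
      using r_res by (auto simp: resonant_def has_weight_def dG_def)
    have dh: "vmult_by (res lam) dh = 0"
    proof -
      have z: "res lam (intv P - axis i 1) * mfps_nth (h $ i) P = 0" for i P
      proof -
        have "mfps_nth (vmult_by (res lam) h $ i) P = mfps_nth ((0 :: 'n fvf) $ i) P"
          by (simp only: h_nonres)
        then show ?thesis by (simp only: vmult_by_nth mfps_nth_smult_by zero_index mfps_nth_0)
      qed
      show ?thesis
      proof (unfold vec_eq_iff, intro allI mfps_eqI)
        fix i and P :: "nat ^ 'n"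
        show "mfps_nth (vmult_by (res lam) dh $ i) P = mfps_nth ((0 :: 'n fvf) $ i) P"
          using z[of P i] by (cases "res lam (intv P - axis i 1) = 0") (simp_all add: dh_def hm_def)
      qed
    qed
    define V where "V = (\<chi> k. dird (w $ k) G - dird (G $ k) w + dG $ k)"
    have V: "V $ k = dird (w $ k) (special_field p L (\<lambda>j. mfps_const (mfps_nth (g j) 0) + gh m j))
        - dird (special_field p L (\<lambda>j. mfps_const (mfps_nth (g j) 0) + gh m j) $ k) w + dG $ k" for k
      unfolding V_def Gspecial by simp
    have EV: "ord_ge (Suc ?d) (E $ i - dird ((idf + hm) $ i) V)" for i
      using w(3) by (simp only: V_def H_def)
    have \<tau>2: "tnorm \<sigma> ?d (gh m j) \<le> \<tau>" if "j \<in> {1..p}" for j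
      unfolding gh_def by (rule order_trans[OF tnorm_trunc_le[OF less_imp_le[OF \<sigma>]] \<tau>1[OF that]])
    have \<tau>3: "\<sigma> * gnorm \<sigma> ?d (gh m j) \<le> real m * \<tau>" if "j \<in> {1..p}" for j
    proof -
      let ?g = "g j - mfps_const (mfps_nth (g j) 0)"
      have "\<sigma> * gnorm \<sigma> ?d (gh m j) \<le> dnorm \<sigma> (m - 1) ?g"
        unfolding gh_def using \<sigma> by (intro gnorm_trunc_le) simp
      also have "\<dots> \<le> real (m - 1) * tnorm \<sigma> (m - 1) ?g" using \<sigma> by (intro dnorm_le) simp
      also have "\<dots> \<le> real m * \<tau>" using \<tau>1[OF that] \<sigma> by (intro mult_mono) auto
      finally show ?thesis .
    qed
    have \<tau>_sum: "c * (\<Sum>j=1..p. \<tau>) \<le> 1 / 2"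
    proof -
      have "(c * real p * K) * vtnorm \<sigma> m r \<le> \<mu> * vtnorm \<sigma> m r"
        using \<sigma> by (intro mult_right_mono) (simp_all add: \<mu>_def)
      then have "(c * real p * K) * vtnorm \<sigma> m r \<le> \<sigma> / 2"
        using size_bounds(2)[OF \<sigma> size''] by linarith
      then have "(c * real p * K) * vtnorm \<sigma> m r / \<sigma> \<le> \<sigma> / 2 / \<sigma>"
        using \<sigma> by (intro divide_right_mono) simp_all
      moreover have "c * (\<Sum>j=1..p. \<tau>) = (c * real p * K) * vtnorm \<sigma> m r / \<sigma>"
        by (simp add: \<tau>_def)
      moreover have "\<sigma> / 2 / \<sigma> = 1 / 2" using \<sigma> by simp
      ultimately show ?thesis by (simp only:)
    qed
    have d1: "1 \<le> ?d" using m by simp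
    note est = block_estimate[where E = E and hm = hm and \<tau> = "\<lambda>j. \<tau>" and v = dh, OF c hull gh
        special_linear_part[OF special r] dG V less_imp_le[OF \<sigma>] d1 m size_bounds(1)[OF \<sigma> size'']
        EV w(1)[unfolded H_def] dh \<tau>2 \<tau>3 \<tau>_sum \<Lambda> \<Lambda>0 \<Omega>, folded C1_def]
    define B where "B = C1 * real m ^ 2 * \<Omega> ^ 2 * (\<theta> ^ m * CE * \<sigma>)"
    have le_B: "C1 * real m ^ 2 * \<Omega> ^ 2 * vtnorm \<sigma> ?d E \<le> B"
      unfolding B_def using C1 by (intro mult_left_mono e) auto
    have n_dh: "vtnorm \<sigma> ?d dh \<le> B" by (rule order_trans[OF est(1) le_B])
    have n_dG: "vtnorm \<sigma> ?d dG \<le> B" by (rule order_trans[OF est(2) le_B])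
    let ?D = "\<Sum>i\<in>UNIV. dnorm \<sigma> ?d (dh $ i)"
    have "?D \<le> real ?d * vtnorm \<sigma> ?d dh"
      unfolding vtnorm_def sum_distrib_left using \<sigma> by (intro sum_mono dnorm_le) simp
    also have "\<dots> \<le> real ?d * B" by (intro mult_left_mono n_dh) simp
    finally have 1: "?D \<le> real ?d * B" .
    have B0: "B \<ge> 0" using n_dh vtnorm_nonneg[of \<sigma> ?d dh] \<sigma> by linarith
    have 2: "\<mu> * vtnorm \<sigma> ?d dG \<le> real m * (\<mu> * B)"
    proof -
      have "\<mu> * vtnorm \<sigma> ?d dG \<le> 1 * (\<mu> * B)" using \<mu> n_dG by (simp add: mult_left_mono)
      also have "\<dots> \<le> real m * (\<mu> * B)" using m B0 \<mu> by (intro mult_right_mono) auto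
      finally show ?thesis .
    qed
    have split_h: "dnorm \<sigma> ?d (h $ i) = dnorm \<sigma> m (h $ i) + dnorm \<sigma> ?d (dh $ i)" for i
      using dnorm_split[of m ?d \<sigma> "h $ i"] by (simp add: dh_def hm_def)
    have split_r: "vtnorm \<sigma> ?d r = vtnorm \<sigma> m r + vtnorm \<sigma> ?d dG"
      unfolding vtnorm_def sum.distrib[symmetric]
    proof (rule sum.cong)
      fix i show "tnorm \<sigma> ?d (r $ i) = tnorm \<sigma> m (r $ i) + tnorm \<sigma> ?d (dG $ i)"
        using tnorm_split[of m ?d \<sigma> "r $ i"] by (simp add: dG_def)
    qed simp
    have incr: "block_size \<mu> \<sigma> ?d h r = block_size \<mu> \<sigma> m h r
        + (?D + \<mu> * vtnorm \<sigma> ?d dG) / \<sigma>"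
    proof -
      have "(\<Sum>i\<in>UNIV. dnorm \<sigma> ?d (h $ i)) =
          (\<Sum>i\<in>UNIV. dnorm \<sigma> m (h $ i)) + ?D"
        by (simp only: split_h sum.distrib)
      then have "(\<Sum>i\<in>UNIV. dnorm \<sigma> ?d (h $ i)) + \<mu> * vtnorm \<sigma> ?d r =
          ((\<Sum>i\<in>UNIV. dnorm \<sigma> m (h $ i)) + \<mu> * vtnorm \<sigma> m r)
          + (?D + \<mu> * vtnorm \<sigma> ?d dG)"
        by (simp only: split_r distrib_left add_ac)
      then show ?thesis by (simp only: block_size_def add_divide_distrib)
    qed
    have "?D + \<mu> * vtnorm \<sigma> ?d dG \<le> real ?d * B + real m * (\<mu> * B)"
      by (rule add_mono[OF 1 2])
    also have "\<dots> = (2 + \<mu>) * (real m * B)"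
      by (simp add: distrib_right)
    also have "\<dots> = (C * real m ^ 3 * \<Omega> ^ 2 * \<theta> ^ m) * \<sigma>"
      by (simp only: B_def C_def power2_eq_square power3_eq_cube mult_ac)
    finally have "(?D + \<mu> * vtnorm \<sigma> ?d dG) / \<sigma>
        \<le> C * real m ^ 3 * \<Omega> ^ 2 * \<theta> ^ m"
      by (simp only: pos_divide_le_eq[OF \<sigma>])
    then have "block_size \<mu> \<sigma> ?d h r \<le> block_size \<mu> \<rho> m h r + C * real m ^ 3 * \<Omega> ^ 2 * \<theta> ^ m"
      unfolding incr by (rule add_mono[OF size'])
    then show ?thesis by (simp only: \<sigma>_def)
  qed
  have "0 \<le> \<mu>" using \<mu> by simp
  moreover have "block_growth_bound lam h r R \<mu> C"
    unfolding block_growth_bound_def by (intro allI impI main)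
  ultimately show ?thesis using C that by blast
qed

section \<open>Small divisors\<close>

lemma omega_le:
  assumes "Q \<in> N_all" "pairing Q lam \<noteq> 0" "Q_norm Q < 2 ^ k"
  shows "omega lam k \<le> cmod (pairing Q lam)"
  unfolding omega_def
  by (rule Min_le[OF finite_small_divisors]) (use assms in \<open>auto simp: small_divisors_def\<close>)

lemma small_divisors_nonempty:
  assumes "lam \<noteq> 0" "k \<ge> 1" shows "small_divisors lam k \<noteq> {}"
proof -
  obtain i where i: "lam $ i \<noteq> 0" using assms(1) by (auto simp: vec_eq_iff)
  have "Q_norm (axis i 1) = 1"
    using Q_norm_intv[of "axis i (Suc 0)"] by simp
  moreover have "(1 :: int) < 2 ^ k" using assms(2) by simp
  moreover have "axis i 1 \<in> N_all" using intv_in_N[of "axis i (Suc 0)"] by simp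
  ultimately have "cmod (pairing (axis i 1) lam) \<in> small_divisors lam k"
    unfolding small_divisors_def using i by fastforce
  then show ?thesis by blast
qed

lemma omega_pos: "lam \<noteq> 0 \<Longrightarrow> k \<ge> 1 \<Longrightarrow> omega lam k > 0"
  unfolding omega_def
  by (subst Min_gr_iff[OF finite_small_divisors small_divisors_nonempty]) (auto simp: small_divisors_def)

lemma omega_antimono:
  assumes "lam \<noteq> 0" "1 \<le> k" "k \<le> l" shows "omega lam l \<le> omega lam k"
  unfolding omega_def
proof (rule Min_antimono)
  have "(2 :: int) ^ k \<le> 2 ^ l" using assms(3) by (intro power_increasing) auto
  then have "Q_norm Q < 2 ^ l" if "Q_norm Q < 2 ^ k" for Q :: "int ^ 'a"
    using that by (rule less_le_trans[rotated])
  then show "small_divisors lam k \<subseteq> small_divisors lam l"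
    unfolding small_divisors_def by blast
qed (use assms finite_small_divisors small_divisors_nonempty in auto)

text \<open>Condition \<open>\<omega>\<close> bounds a sum whose terms may be negative. As \<open>omega lam\<close> is decreasing, the
logarithms are bounded below by the first one, so passing to their positive parts changes the sum by
at most a geometric series. The index \<open>k + 2\<close> covers all indices of \<open>N_all\<close> whose norm is at most
\<open>2 \<cdot> 2\<^sup>k\<close>.\<close>

lemma condition_omega_summable:
  assumes lam: "lam \<noteq> 0" and cond: "condition_omega lam"
  shows "summable (\<lambda>k. ln (max 1 (1 / omega lam (k + 2))) / 2 ^ k)"
proof -
  define x where "x k = ln (inverse (omega lam k))" for k
  have x_mono: "x 1 \<le> x k" if "k \<ge> 1" for k
    using omega_pos[OF lam] omega_antimono[OF lam _ that] that
    by (simp add: x_def ln_inverse)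
  have "summable (\<lambda>k. x (Suc k) / 2 ^ Suc k)"
    using cond by (simp add: condition_omega_def x_def)
  then have "summable (\<lambda>k. x (Suc (Suc k)) / 2 ^ Suc (Suc k))"
    by (subst summable_Suc_iff)
  then have "summable (\<lambda>k. 4 * (x (k + 2) / 2 ^ Suc (Suc k)) + \<bar>x 1\<bar> * (1 / 2) ^ k)"
    by (intro summable_add summable_mult summable_geometric) simp_all
  then show ?thesis
  proof (rule summable_comparison_test[rotated], intro exI allI impI)
    fix k :: nat
    have "ln (max 1 (1 / omega lam (k + 2))) \<le> x (k + 2) + \<bar>x 1\<bar>"
    proof (cases "1 \<le> 1 / omega lam (k + 2)")
      case True
      then show ?thesis by (simp add: x_def inverse_eq_divide max_def)
    next
      case False
      then show ?thesis using x_mono[of "k + 2"] by (simp add: max_def)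
    qed
    moreover have "0 \<le> ln (max 1 (1 / omega lam (k + 2)))" by simp
    ultimately have "norm (ln (max 1 (1 / omega lam (k + 2))) / 2 ^ k) \<le> (x (k + 2) + \<bar>x 1\<bar>) / 2 ^ k"
      by (simp add: divide_right_mono)
    also have "\<dots> = 4 * (x (k + 2) / 2 ^ Suc (Suc k)) + \<bar>x 1\<bar> * (1 / 2) ^ k"
      by (simp add: field_simps power_divide)
    finally show "norm (ln (max 1 (1 / omega lam (k + 2))) / 2 ^ k) \<le>
        4 * (x (k + 2) / 2 ^ Suc (Suc k)) + \<bar>x 1\<bar> * (1 / 2) ^ k" .
  qed
qed

section \<open>Convergence\<close>

lemma taylor_series_vtnorm_bounded:
  assumes "has_taylor_series F a f"
  obtains R B where "0 < R" "\<And>d. vtnorm R d f \<le> B"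
proof -
  obtain U where U: "open U" "0 \<in> U"
    and sum: "\<And>x i. x \<in> U \<Longrightarrow> ((\<lambda>P. mfps_nth (f $ i) P * mpower x P) has_sum (F (a + x) $ i)) UNIV"
    using assms by (auto simp: has_taylor_series_def)
  obtain \<epsilon> where \<epsilon>: "\<epsilon> > 0" "\<And>x. norm x < \<epsilon> \<Longrightarrow> x \<in> U"
    using U by (auto simp: open_contains_ball subset_eq)
  define R where "R = \<epsilon> / (2 * real CARD('a))"
  have R: "R > 0" using \<epsilon>(1) by (simp add: R_def)
  define x where "x = (\<chi> k :: 'a. complex_of_real R)"
  have "norm x \<le> (\<Sum>k\<in>UNIV. norm (x $ k))" 
    unfolding norm_vec_def by (rule L2_set_le_sum) simp
  also have "\<dots> = (\<Sum>k\<in>(UNIV :: 'a set). R)" using R by (simp add: x_def)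
  also have "\<dots> = \<epsilon> / 2" by (simp add: R_def)
  finally have "x \<in> U" using \<epsilon> by simp
  have mp: "mpower x P = of_real (R ^ mdegree P)" for P
    by (simp add: mpower_def x_def mdegree_def power_sum)
  have abs: "(\<lambda>P. cmod (mfps_nth (f $ i) P) * R ^ mdegree P) summable_on UNIV" for i
  proof -
    have "(\<lambda>P. mfps_nth (f $ i) P * mpower x P) summable_on UNIV"
      using sum[OF \<open>x \<in> U\<close>] by (rule has_sum_imp_summable)
    then have "(\<lambda>P. cmod (mfps_nth (f $ i) P * mpower x P)) summable_on UNIV"
      by (simp only: summable_on_iff_abs_summable_on_complex)
    then show ?thesis using R by (simp add: mp norm_mult norm_power)
  qed
  have "tnorm R d (f $ i) \<le> (\<Sum>\<^sub>\<infinity>P. cmod (mfps_nth (f $ i) P) * R ^ mdegree P)" for d i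
    unfolding tnorm_def using R
    by (intro finite_sum_le_infsum abs finite_mdegree_le) auto
  then have "vtnorm R d f \<le> (\<Sum>i\<in>UNIV. \<Sum>\<^sub>\<infinity>P. cmod (mfps_nth (f $ i) P) * R ^ mdegree P)" for d
    unfolding vtnorm_def by (intro sum_mono)
  then show ?thesis using that R by blast
qed

lemma fvf_convergent_if_tnorm_bounded:
  assumes \<rho>: "0 < \<rho>" and B: "\<And>i d. tnorm \<rho> d (H $ i) \<le> B"
  shows "fvf_convergent H"
  unfolding fvf_convergent_def
proof (intro exI conjI ballI allI)
  show "open (ball 0 \<rho>)" "0 \<in> ball 0 \<rho>" using \<rho> by auto
  fix x :: "complex ^ 'a" and i assume "x \<in> ball 0 \<rho>"
  then have x: "cmod (x $ k) \<le> \<rho>" for k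
    using Finite_Cartesian_Product.norm_nth_le[of x k] by simp
  have mp: "cmod (mpower x P) \<le> \<rho> ^ mdegree P" for P
  proof -
    have "cmod (mpower x P) = (\<Prod>k\<in>UNIV. cmod (x $ k) ^ (P $ k))"
      by (simp add: mpower_def norm_power flip: prod_norm)
    also have "\<dots> \<le> (\<Prod>k\<in>UNIV. \<rho> ^ (P $ k))"
      using x by (intro prod_mono conjI power_mono) auto
    finally show ?thesis by (simp add: mdegree_def power_sum)
  qed
  have "(\<lambda>P. cmod (mfps_nth (H $ i) P) * \<rho> ^ mdegree P) summable_on UNIV"
  proof (rule nonneg_bdd_above_summable_on)
    show "bdd_above (sum (\<lambda>P. cmod (mfps_nth (H $ i) P) * \<rho> ^ mdegree P) ` {F. F \<subseteq> UNIV \<and> finite F})"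
    proof (rule bdd_aboveI2)
      fix F :: "(nat ^ 'a) set" assume "F \<in> {F. F \<subseteq> UNIV \<and> finite F}"
      then have fin: "finite F" by simp
      have "(\<Sum>P\<in>F. cmod (mfps_nth (H $ i) P) * \<rho> ^ mdegree P) \<le> tnorm \<rho> (Max (insert 0 (mdegree ` F))) (H $ i)"
        unfolding tnorm_def using \<rho> fin
        by (intro sum_mono2 finite_mdegree_le) (auto intro: Max_ge)
      then show "(\<Sum>P\<in>F. cmod (mfps_nth (H $ i) P) * \<rho> ^ mdegree P) \<le> B"
        using B order_trans by blast
    qed
  qed (use \<rho> in simp)
  then have "(\<lambda>P. cmod (mfps_nth (H $ i) P * mpower x P)) summable_on UNIV"
  proof (rule summable_on_comparison_test)
    fix P
    show "cmod (mfps_nth (H $ i) P * mpower x P) \<le> cmod (mfps_nth (H $ i) P) * \<rho> ^ mdegree P"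
      unfolding norm_mult by (intro mult_left_mono mp) simp
  qed simp
  then show "(\<lambda>P. mfps_nth (H $ i) P * mpower x P) summable_on UNIV"
    by (rule abs_summable_summable)
qed

text \<open>With \<open>\<theta> k = exp (- t k)\<close> the required bound on \<open>\<theta> k ^ 2 ^ k\<close> fixes \<open>t k\<close> as \<open>2\<^sup>-\<^sup>k\<close> times the logarithm
of the losses in the \<open>k\<close>-th block, which is \<open>O(k) + 2 ln (\<Omega> k)\<close>. These numbers are summable, so the product
of the \<open>\<theta> k\<close> is positive.\<close>

lemma dyadic_radii:
  fixes \<Omega> :: "nat \<Rightarrow> real"
  assumes C: "0 < C" and \<Omega>: "\<And>k. 1 \<le> \<Omega> k" "summable (\<lambda>k. ln (\<Omega> k) / 2 ^ k)" and \<rho>0: "0 < \<rho>0"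
  obtains \<rho> \<theta> \<sigma> where "\<rho> 0 = \<rho>0" "\<And>k. \<rho> (Suc k) = \<theta> k * \<rho> k" "\<And>k. 0 < \<theta> k" "\<And>k. \<theta> k \<le> 1"
    "\<And>k. C * real (2 ^ k) ^ 3 * \<Omega> k ^ 2 * \<theta> k ^ (2 ^ k) \<le> 1 / 2 ^ (k + 2)"
    "0 < \<sigma>" "\<And>k. \<sigma> \<le> \<rho> k" "\<And>k. \<rho> k \<le> \<rho>0"
proof -
  define D where "D = max C 1"
  \<comment> \<open>the losses in the \<open>k\<close>-th block, times the factor that makes the increments summable;
    \<open>D \<ge> 1\<close> makes \<open>ln (y k)\<close> nonnegative\<close>
  define y where "y k = D * real (2 ^ k) ^ 3 * \<Omega> k ^ 2 * 2 ^ (k + 2)" for k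
  have y1: "1 \<le> y k" for k
  proof -
    have "1 \<le> (2 :: real) ^ (k + 2)" by (rule one_le_power) simp
    moreover have "1 \<le> D" "1 \<le> real (2 ^ k) ^ 3" "1 \<le> \<Omega> k ^ 2"
      using \<Omega>(1)[of k] by (simp_all add: D_def)
    ultimately have "1 * 1 * 1 * 1 \<le> y k" unfolding y_def by (intro mult_mono) auto
    then show ?thesis by simp
  qed
  define t where "t k = ln (y k) / 2 ^ k" for k
  have t0: "t k \<ge> 0" for k using y1[of k] by (simp add: t_def)
  have t_eq: "t k = (ln D + 2 * ln 2) * (1 / 2) ^ k + 4 * ln 2 * (real k * (1 / 2) ^ k)
      + 2 * (ln (\<Omega> k) / 2 ^ k)" for k
  proof -
    have "0 < D" "0 < \<Omega> k" using \<Omega>(1)[of k] by (simp_all add: D_def)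
    moreover have "ln (real (2 ^ k) ^ 3) = 3 * (real k * ln 2)" by (simp add: ln_realpow)
    moreover have "ln ((2 :: real) ^ (k + 2)) = real (k + 2) * ln 2" by (rule ln_realpow)
    ultimately have "ln (y k) = ln D + 3 * (real k * ln 2) + 2 * ln (\<Omega> k) + real (k + 2) * ln 2"
      unfolding y_def by (simp add: ln_mult_pos ln_realpow del: power_add power_Suc power_add_numeral)
    then show ?thesis by (simp add: t_def field_simps power_divide)
  qed
  have "summable (\<lambda>k. real k * (1 / 2) ^ k)"
  proof -
    have "summable (\<lambda>k. real (Suc k) * (1 / 2) ^ k)"
      using geometric_deriv_sums[of "1 / 2 :: real"] by (auto simp: sums_iff)
    then have "summable (\<lambda>k. real (Suc k) * (1 / 2) ^ k - (1 / 2 :: real) ^ k)"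
      by (intro summable_diff summable_geometric) auto
    then show ?thesis by (simp add: algebra_simps)
  qed
  then have t_summable: "summable t"
    unfolding t_eq[abs_def] by (intro summable_add summable_mult \<Omega>(2) summable_geometric) auto
  define \<rho> where "\<rho> k = \<rho>0 * exp (- (\<Sum>i<k. t i))" for k
  show ?thesis
  proof
    show "\<rho> 0 = \<rho>0" by (simp add: \<rho>_def)
    show "\<rho> (Suc k) = exp (- t k) * \<rho> k" for k by (simp add: \<rho>_def exp_add[symmetric] algebra_simps)
    show "exp (- t k) \<le> 1" for k using t0 by simp
    show "C * real (2 ^ k) ^ 3 * \<Omega> k ^ 2 * exp (- t k) ^ (2 ^ k) \<le> 1 / 2 ^ (k + 2)" for k
    proof -
      have "exp (- t k) ^ (2 ^ k) = exp (- ln (y k))"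
        by (simp add: t_def flip: exp_of_nat_mult)
      also have "\<dots> = 1 / y k" using y1[of k] by (simp add: exp_minus inverse_eq_divide)
      finally have e: "exp (- t k) ^ (2 ^ k) = 1 / y k" .
      have yk: "y k > 0" using y1[of k] by simp
      have "C * real (2 ^ k) ^ 3 * \<Omega> k ^ 2 * 2 ^ (k + 2) \<le> y k"
        unfolding y_def D_def by (intro mult_right_mono) auto
      then show ?thesis unfolding e using yk by (simp add: divide_simps)
    qed
    show "0 < \<rho>0 * exp (- suminf t)" using \<rho>0 by simp
    show "\<rho>0 * exp (- suminf t) \<le> \<rho> k" for k
      unfolding \<rho>_def using \<rho>0 sum_le_suminf[OF t_summable, of "{..<k}"] t0 by simp
    show "\<rho> k \<le> \<rho>0" for k
      unfolding \<rho>_def using \<rho>0 sum_nonneg[of "{..<k}" t] t0 by simp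
  qed simp
qed

lemma dnorm_mono_radius:
  assumes "0 \<le> \<rho>" "\<rho> \<le> \<rho>'" shows "dnorm \<rho> d f \<le> dnorm \<rho>' d f"
  unfolding dnorm_def using assms by (intro sum_mono mult_left_mono power_mono) auto

lemma tnorm_mono_degree:
  assumes "0 \<le> \<rho>" "d \<le> d'" shows "tnorm \<rho> d f \<le> tnorm \<rho> d' f"
  unfolding tnorm_def using assms by (intro sum_mono2 finite_mdegree_le) auto

text \<open>At degree \<open>1\<close> the block size is \<open>0\<close>, so the increments \<open>2\<^sup>-\<^sup>k\<^sup>-\<^sup>2\<close> keep it below \<open>1/2\<close> at all degrees \<open>2\<^sup>k\<close>. This
bounds the coefficient norms of \<open>h\<close> at the limit radius independently of the cut-off.\<close>

lemma convergence_from_growth: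
  fixes h r :: "'n::finite fvf"
  assumes h: "vord_ge 2 h" and r: "vord_ge 2 r" and lam: "lam \<noteq> 0" "condition_omega lam"
    and R: "0 < R" and \<mu>: "0 \<le> \<mu>" and C: "0 < C"
    and growth: "block_growth_bound lam h r R \<mu> C"
  shows "fvf_convergent (idf + h)"
proof -
  define \<Omega> where "\<Omega> k = max 1 (1 / omega lam (k + 2))" for k
  have \<Omega>1: "1 \<le> \<Omega> k" for k by (simp add: \<Omega>_def)
  have \<Omega>2: "1 \<le> \<Omega> k * cmod (pairing Q lam)"
    if Q: "Q \<in> N_all" "Q_norm Q \<le> int (2 * 2 ^ k)" "pairing Q lam \<noteq> 0" for k Q
  proof -
    have "int (2 * 2 ^ k) < 2 ^ (k + 2)" by simp
    then have "Q_norm Q < 2 ^ (k + 2)" using Q(2) by (rule le_less_trans[rotated])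
    then have le: "omega lam (k + 2) \<le> cmod (pairing Q lam)" by (rule omega_le[OF Q(1,3)])
    have pos: "0 < omega lam (k + 2)" using lam by (intro omega_pos) auto
    then have "1 = 1 / omega lam (k + 2) * omega lam (k + 2)" by simp
    also have "\<dots> \<le> \<Omega> k * cmod (pairing Q lam)"
      using le pos \<Omega>1[of k] by (intro mult_mono) (auto simp: \<Omega>_def)
    finally show ?thesis .
  qed
  have \<Omega>_summable: "summable (\<lambda>k. ln (\<Omega> k) / 2 ^ k)"
    unfolding \<Omega>_def using lam by (rule condition_omega_summable)
  obtain \<rho> \<theta> \<sigma> where \<rho>: "\<rho> 0 = R / 2" "\<And>k. \<rho> (Suc k) = \<theta> k * \<rho> k" and \<theta>: "\<And>k. 0 < \<theta> k" "\<And>k. \<theta> k \<le> 1"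
    and inc: "\<And>k. C * real (2 ^ k) ^ 3 * \<Omega> k ^ 2 * \<theta> k ^ (2 ^ k) \<le> 1 / 2 ^ (k + 2)"
    and \<sigma>: "0 < \<sigma>" "\<And>k. \<sigma> \<le> \<rho> k" "\<And>k. \<rho> k \<le> R / 2"
    using dyadic_radii[OF C \<Omega>1 \<Omega>_summable, of "R / 2"] R by auto
  have \<rho>_pos: "0 < \<rho> k" for k using \<sigma>(1,2) by (rule less_le_trans)
  have size: "block_size \<mu> (\<rho> k) (2 ^ k) h r \<le> 1 / 2 - 1 / 2 ^ (k + 1)" for k
  proof (induction k)
    case 0
    have "dnorm (\<rho> 0) 1 (h $ i) = 0" "tnorm (\<rho> 0) 1 (r $ i) = 0" for i
      unfolding dnorm_def tnorm_def using vord_geD[OF h, of i] vord_geD[OF r, of i]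
      by (simp_all add: ord_ge_def)
    then show ?case by (simp add: block_size_def vtnorm_def)
  next
    case (Suc k)
    have "1 / 2 - 1 / 2 ^ (k + 1) \<le> (1 / 2 :: real)" by simp
    then have half: "block_size \<mu> (\<rho> k) (2 ^ k) h r \<le> 1 / 2" using Suc by linarith
    have "\<forall>Q\<in>N_all. Q_norm Q \<le> int (2 * 2 ^ k) \<longrightarrow> pairing Q lam \<noteq> 0 \<longrightarrow>
        1 \<le> \<Omega> k * cmod (pairing Q lam)"
      using \<Omega>2 by blast
    moreover have "1 \<le> (2 :: nat) ^ k" "2 * \<rho> k \<le> R" using \<sigma>(3)[of k] by simp_all
    ultimately have "block_size \<mu> (\<theta> k * \<rho> k) (2 * 2 ^ k) h r \<le>
        block_size \<mu> (\<rho> k) (2 ^ k) h r + C * real (2 ^ k) ^ 3 * \<Omega> k ^ 2 * \<theta> k ^ (2 ^ k)"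
      using growth \<rho>_pos[of k] \<theta>[of k] \<Omega>1[of k] half unfolding block_growth_bound_def by blast
    then have "block_size \<mu> (\<rho> (Suc k)) (2 ^ Suc k) h r \<le>
        block_size \<mu> (\<rho> k) (2 ^ k) h r + C * real (2 ^ k) ^ 3 * \<Omega> k ^ 2 * \<theta> k ^ (2 ^ k)"
      by (simp only: \<rho>(2) power_Suc)
    also have "\<dots> \<le> (1 / 2 - 1 / 2 ^ (k + 1)) + 1 / 2 ^ (k + 2)"
      by (intro add_mono Suc inc)
    also have "\<dots> = 1 / 2 - 1 / 2 ^ (Suc k + 1)" by (simp add: field_simps)
    finally show ?case .
  qed
  have bound: "tnorm \<sigma> d ((idf + h) $ i) \<le> \<sigma> + R" for i d
  proof -
    have "tnorm \<sigma> d (h $ i) \<le> tnorm \<sigma> (2 ^ d) (h $ i)"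
      using \<sigma>(1) by (intro tnorm_mono_degree) (auto intro: less_imp_le)
    also have "\<dots> \<le> dnorm \<sigma> (2 ^ d) (h $ i)"
      using \<sigma>(1) by (intro tnorm_le_dnorm vord_ge_2D[OF h]) simp
    also have "\<dots> \<le> dnorm (\<rho> d) (2 ^ d) (h $ i)"
      using \<sigma> by (intro dnorm_mono_radius) (auto intro: less_imp_le)
    also have "\<dots> \<le> (\<Sum>i\<in>UNIV. dnorm (\<rho> d) (2 ^ d) (h $ i))"
      using \<rho>_pos[of d] by (intro member_le_sum) auto
    also have "\<dots> \<le> (\<Sum>i\<in>UNIV. dnorm (\<rho> d) (2 ^ d) (h $ i)) + \<mu> * vtnorm (\<rho> d) (2 ^ d) r"
      using \<mu> \<rho>_pos[of d] by simp
    also have "\<dots> = block_size \<mu> (\<rho> d) (2 ^ d) h r * \<rho> d"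
      using \<rho>_pos[of d] by (simp add: block_size_def)
    also have "\<dots> \<le> 1 * \<rho> d"
    proof (rule mult_right_mono)
      have "0 < 1 / (2 :: real) ^ (d + 1)" by simp
      then show "block_size \<mu> (\<rho> d) (2 ^ d) h r \<le> 1" using size[of d] by linarith
    qed (use \<rho>_pos[of d] in simp)
    finally have "tnorm \<sigma> d (h $ i) \<le> R" using \<sigma>(3)[of d] R by simp
    then show ?thesis
      using tnorm_add_le[of \<sigma> d "mfps_var i" "h $ i"] tnorm_var_le[of \<sigma> d i] \<sigma>(1) by simp
  qed
  show ?thesis by (rule fvf_convergent_if_tnorm_bounded[OF \<sigma>(1) bound])
qed

section \<open>Normal forms\<close>

lemma order_ge2_iff: "order_ge2 h \<longleftrightarrow> vord_ge 2 h"
  by (simp add: order_ge2_def vord_ge_def ord_ge_def)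

lemma is_transformation_iff: "is_transformation H \<longleftrightarrow> (\<exists>h. vord_ge 2 h \<and> H = idf + h)"
  by (simp add: is_transformation_def order_ge2_iff idf_def)

lemma transforms_to_iff:
  "transforms_to H F G \<longleftrightarrow> (\<forall>i. dird (H $ i) G = mfps_compose (F $ i) H)"
  by (simp add: transforms_to_def vec_eq_iff jacobian_mult_nth fvf_compose_def)

lemma resonant_imp_normal_form:
  assumes "resonant lam G" shows "normal_form lam G"
  unfolding normal_form_def
proof (intro ballI impI)
  fix Q :: "int ^ 'a" assume Q: "Q \<in> N_all" "pairing Q lam \<noteq> 0"
  have "fvf_coeff G Q $ i = 0" for i
  proof (cases "Q \<in> N_comp i")
    case True
    define P where "P = (\<chi> k. nat ((Q + axis i 1) $ k))"
    have "intv P = Q + axis i 1"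
      using True by (auto simp: P_def intv_def vec_eq_iff N_comp_def axis_def)
    then have "pairing (intv P) lam = pairing Q lam + lam $ i" by (simp add: pairing_add)
    then have "pairing (intv P) lam \<noteq> lam $ i" using Q(2) by simp
    then have "mfps_nth (G $ i) P = 0" using assms unfolding resonant_def has_weight_def by blast
    then show ?thesis by (simp add: fvf_coeff_def P_def)
  qed (simp add: fvf_coeff_def)
  then show "fvf_coeff G Q = 0" by (simp add: vec_eq_iff)
qed

lemma resonant_special_field:
  assumes "\<And>j. has_weight lam 0 (g j)" shows "resonant lam (special_field p L g)"
  unfolding resonant_def has_weight_def
proof (intro allI impI)
  fix i P assume nz: "mfps_nth (special_field p L g $ i) P \<noteq> 0"
  then have "P $ i \<noteq> 0" by (simp add: special_field_nth split: if_splits)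
  then obtain R where P: "P = R + axis i 1" using obtain_minus_axis by blast
  have "\<exists>j. mfps_nth (g j) R \<noteq> 0"
  proof (rule ccontr)
    assume "\<nexists>j. mfps_nth (g j) R \<noteq> 0"
    then show False using nz by (simp add: special_field_nth P)
  qed
  then show "pairing (intv P) lam = lam $ i"
    using assms by (auto simp: has_weight_def P intv_add pairing_add)
qed

text \<open>The index \<open>P - axis k 1\<close> of a coefficient in the \<open>k\<close>-th component lies outside \<open>M_plus lam\<close> when \<open>P $ k = 0\<close>,
so a field in the sense of Condition AS is divisible by \<open>x\<^sub>k\<close> in its \<open>k\<close>-th component.\<close>

lemma condition_AS_special_field:
  assumes "condition_AS lam G"
  obtains p L g c where "p \<ge> 1" "inj_on L {1..p}" "vec.independent (L ` {1..p})" "0 < c"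
    "\<And>j Q. j \<in> {1..p} \<Longrightarrow> Q \<in> N_all \<Longrightarrow> cmod (pairing Q (L j)) \<le> c * cmod (pairing Q lam)"
    "\<And>j. has_weight lam 0 (g j)" "G = special_field p L g"
proof -
  obtain p L \<beta> where dec: "additive_decomposition lam p L" and hull: "diophantine_hull lam p L"
    and zero: "\<forall>Q\<in>N_all - M_plus lam. fvf_coeff G Q = 0"
    and \<beta>: "\<forall>P\<in>M_plus lam. fvf_coeff G P = (\<Sum>j = 1..p. \<beta> j P *s L j)"
    using assms unfolding condition_AS_def by auto
  define g where "g j = Abs_mfps (\<lambda>P. if intv P \<in> M_plus lam then \<beta> j (intv P) else 0)" for j
  have "G = special_field p L g"
  proof (unfold vec_eq_iff, intro allI mfps_eqI)
    fix i P
    have nth: "mfps_nth (G $ i) P = fvf_coeff G (intv P - axis i 1) $ i"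
      unfolding intv_def by (rule mfps_nth_eq_fvf_coeff)
    show "mfps_nth (G $ i) P = mfps_nth (special_field p L g $ i) P"
    proof (cases "P $ i = 0")
      case True
      then have "(intv P - axis i 1) $ i < 0" by (simp add: intv_def axis_def)
      then have "\<not> (\<forall>k. 0 \<le> (intv P - axis i 1) $ k)" using not_le by blast
      then have "intv P - axis i 1 \<notin> M_plus lam" by (simp add: M_plus_def)
      then have "fvf_coeff G (intv P - axis i 1) = 0" using zero intv_minus_axis_in_N by blast
      then show ?thesis using True by (simp add: nth special_field_nth)
    next
      case False
      then obtain R where P: "P = R + axis i 1" using obtain_minus_axis by blast
      then have Q: "intv P - axis i 1 = intv R" by (simp add: intv_add)
      show ?thesis
      proof (cases "intv R \<in> M_plus lam")
        case True
        then show ?thesis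
          using False \<beta> by (simp add: nth Q special_field_nth g_def) (simp add: P mult.commute)
      next
        case R: False
        then show ?thesis
          using False zero intv_in_N[of R] by (simp add: nth Q special_field_nth g_def) (simp add: P)
      qed
    qed
  qed
  moreover have "has_weight lam 0 (g j)" for j
    by (auto simp: has_weight_def g_def M_plus_def split: if_splits)
  moreover obtain c where "c > 0" "\<forall>j\<in>{1..p}. \<forall>Q\<in>N_all. cmod (pairing Q (L j)) \<le> c * cmod (pairing Q lam)"
    using hull unfolding diophantine_hull_def by blast
  ultimately show ?thesis
    using that dec unfolding additive_decomposition_def by blast
qed

text \<open>For \<open>lam = 0\<close> the hull condition at the indices \<open>axis i 1\<close> would force \<open>L 1 = 0\<close>.\<close>

lemma hull_lam_nonzero:
  assumes "vec.independent (L ` {1..p})" "(p::nat) \<ge> 1"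
    and hull: "\<And>j Q. j \<in> {1..p} \<Longrightarrow> Q \<in> N_all \<Longrightarrow> cmod (pairing Q (L j)) \<le> c * cmod (pairing Q lam)"
  shows "lam \<noteq> (0 :: complex ^ 'n::finite)"
proof
  assume lam: "lam = 0"
  have "L 1 $ i = 0" for i
  proof -
    have "axis i 1 \<in> N_all" using intv_in_N[of "axis i (Suc 0)"] by simp
    moreover have "pairing Q (0 :: complex ^ 'n) = 0" for Q by (simp add: pairing_def)
    ultimately show ?thesis using hull[of 1 "axis i 1"] assms(2) by (simp add: lam)
  qed
  then have "0 \<in> L ` {1..p}" using assms(2) by (intro image_eqI[of _ _ 1]) (auto simp: vec_eq_iff)
  then show False using assms(1) vec.dependent_zero by blast
qed

theorem theorem34:
  fixes F :: "complex ^ 'n::finite \<Rightarrow> complex ^ 'n"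
    and U :: "(complex ^ 'n) set"
    and lam :: "complex ^ 'n"
    and Fs X :: "'n fvf"
  assumes "open U" and "0 \<in> U" and "vf_analytic_on F U"
    and "has_taylor_series F 0 Fs"
    and "Fs = fvf_diag lam + X" and "order_ge2 X"
    and "condition_omega lam"
    and "\<exists>G. normal_form_of lam Fs G \<and> condition_AS lam G"
  shows "\<exists>H. normalizing lam Fs H \<and> fvf_convergent H"
proof -
  note Fs = assms(5) and X = assms(6)[unfolded order_ge2_iff]
  obtain h0 G0 where h0: "vord_ge 2 h0"
    and conj0: "\<And>i. dird ((idf + h0) $ i) G0 = mfps_compose (Fs $ i) (idf + h0)"
    and AS: "condition_AS lam G0"
    using assms(8) unfolding normal_form_of_def is_transformation_iff transforms_to_iff by blast
  obtain p L g0 c where p: "p \<ge> 1" and indep: "inj_on L {1..p}" "vec.independent (L ` {1..p})"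
    and c: "0 < c"
    and hull: "\<And>j Q. j \<in> {1..p} \<Longrightarrow> Q \<in> N_all \<Longrightarrow> cmod (pairing Q (L j)) \<le> c * cmod (pairing Q lam)"
    and g0: "\<And>j. has_weight lam 0 (g0 j)" and G0: "G0 = special_field p L g0"
    by (rule condition_AS_special_field[OF AS]) (rule that)
  have lam: "lam \<noteq> 0" using indep(2) p hull by (rule hull_lam_nonzero)
  \<comment> \<open>\<open>G0\<close> has linear part \<open>fvf_diag lam\<close>: this follows by comparing linear parts in the conjugacy equation\<close>
  define r0 where "r0 = G0 - fvf_diag lam"
  have G0_eq: "fvf_diag lam + r0 = G0" by (simp add: r0_def)
  have H0: "vord_ge (Suc 0) (idf + h0)" using h0 by (rule vord_ge_idf_add)
  have r0: "vord_ge 2 r0"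
  proof -
    have G0_1: "vord_ge 1 G0"
      unfolding G0 vord_ge_def ord_ge_def special_field_nth
      by (auto simp: mdegree_eq_0_iff)
    have "r0 $ i = mfps_const (lam $ i) * h0 $ i + mfps_compose (X $ i) (idf + h0) - dird (h0 $ i) G0" for i
      using conj0[of i] H0
      by (simp add: Fs r0_def dird_add_left compose_add compose_mult algebra_simps)
    moreover have "ord_ge 2 (dird (h0 $ i) G0)" for i
      using ord_ge_dird[OF vord_geD[OF h0, of i] G0_1] by (simp add: numeral_2_eq_2)
    ultimately show ?thesis
      using vord_geD[OF h0] vord_geD[OF X] H0
      by (simp add: vord_ge_def ord_ge_add ord_ge_diff ord_ge_mult_left ord_ge_compose)
  qed
  have r0_res: "resonant lam r0"
  proof -
    have "resonant lam G0" unfolding G0 by (rule resonant_special_field[of lam g0, OF g0])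
    moreover have "has_weight lam (lam $ i) (fvf_diag lam $ i)" for i
      by (simp add: has_weight_def mfps_nth_var)
    ultimately show ?thesis unfolding resonant_def r0_def by (simp add: has_weight_diff)
  qed
  obtain h r where h: "vord_ge 2 h" and r: "vord_ge 2 r" and h_nonres: "vmult_by (res lam) h = 0"
    and r_res: "resonant lam r"
    and conj: "\<And>i. dird ((idf + h) $ i) (fvf_diag lam + r) = mfps_compose (Fs $ i) (idf + h)"
    by (rule distinguished_normal_form[OF X, of lam, folded Fs]) (rule that)
  have hull0: "pairing Q (L j) = 0" if "j \<in> {1..p}" "Q \<in> N_all" "pairing Q lam = 0" for j Q
    using hull[OF that(1,2)] that(3) by simp
  have conj0': "dird ((idf + h0) $ i) (fvf_diag lam + r0) = mfps_compose (Fs $ i) (idf + h0)" for i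
    unfolding G0_eq by (rule conj0)
  have G0': "fvf_diag lam + r0 = special_field p L g0"
    unfolding G0_eq by (rule G0)
  obtain g where special: "fvf_diag lam + r = special_field p L g" and g: "\<And>j. has_weight lam 0 (g j)"
    by (rule special_field_invariance[OF Fs X h0 h r0 r0_res r r_res conj0' conj hull0 G0' g0],
        assumption+) (rule that)
  obtain R B where R: "0 < R" and B: "\<And>d. vtnorm R d Fs \<le> B"
    by (rule taylor_series_vtnorm_bounded[OF assms(4)]) (rule that)
  have F1: "vord_ge (Suc 0) Fs"
  proof -
    have "vord_ge (Suc 0) (fvf_diag lam)" by (simp add: vord_ge_def ord_ge_mult_left)
    moreover have "vord_ge (Suc 0) X" using X by (rule vord_ge_mono) simp
    ultimately show ?thesis unfolding Fs by (rule vord_ge_add)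
  qed
  have "fvf_convergent (idf + h)"
    by (rule block_growth[OF F1 h r conj h_nonres r_res special g c hull indep R B], assumption+)
      (rule convergence_from_growth[OF h r lam assms(7) R])
  moreover have "normalizing lam Fs (idf + h)"
  proof -
    have "normal_form lam (fvf_diag lam + r)"
      unfolding special by (intro resonant_imp_normal_form resonant_special_field g)
    then show ?thesis
      unfolding normalizing_def is_transformation_iff transforms_to_iff using h conj by blast
  qed
  ultimately show ?thesis by blast
qed

end
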